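(* Let $\Gamma$ be a graded coalgebra over a commutative ring $A$ which is projective as an $A$-module, and let $M$ be a graded left $\Gamma^*$-module. Then $M$ is rational if and only if $M$ is distinguished-torsion.
   Context: Gradings are $\mathbb{Z}$-gradings; modules are left modules and comodules are right comodules. $\Gamma^*$ is the graded $A$-linear dual algebra of $\Gamma$: its degree $n$ summand is $\mathrm{Hom}_A(\Gamma^{-n},A)$, with the convolution product. The functor $\iota:\mathrm{gr\,Comod}(\Gamma)\to\mathrm{gr\,Mod}(\Gamma^* )$ sends a graded $\Gamma$-comodule $M$ with coaction $\psi_M:M\to M\otimes_A\Gamma$ to the graded $A$-module $M$ with the adjoint action, in which $f\in\Gamma^*$ acts by $M\xrightarrow{\psi_M}M\otimes_A\Gamma\xrightarrow{M\otimes f}M\otimes_A A\cong M$. A graded $\Gamma^*$-module is rational if it is in the essential image of $\iota$. A homogeneous left ideal of $\Gamma^*$ is strongly distinguished if it is the left annihilator in $\Gamma^*$ of some nonzero homogeneous element of $\iota\Gamma$. For a graded $\Gamma^*$-module $M$, let $h^0_{\mathrm{dist}}(M)$ be the graded subgroup of $M$ generated by all homogeneous elements $m$ such that $Im=0$ for some finite intersection $I$ of strongly distinguished left ideals, and let $H^0_{\mathrm{dist}}(M)$ be the graded $\Gamma^*$-submodule of $M$ generated by $h^0_{\mathrm{dist}}(M)$. $M$ is distinguished-torsion if the inclusion $H^0_{\mathrm{dist}}(M)\hookrightarrow M$ is an isomorphism. *)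

theory Defs
  imports "HOL-Algebra.Algebra"
begin

section \<open>Graded modules and linear maps\<close>

text \<open>
  A graded module is an internal direct sum: a module together with a family of subgroups
  indexed by the integers.  The fields \<open>mult\<close> and \<open>one\<close> inherited from the library's record
  of modules are irrelevant except for algebras.
\<close>

record ('a, 'b) gmodule = "('a, 'b) module" +
  grade :: "int \<Rightarrow> 'b set"

definition internal_direct_sum :: "('b, 'z) ring_scheme \<Rightarrow> (int \<Rightarrow> 'b set) \<Rightarrow> bool" where
  "internal_direct_sum M D \<longleftrightarrow>
     (\<forall>n. additive_subgroup (D n) M) \<and>
     (\<forall>x \<in> carrier M. \<exists>!c. (\<forall>n. c n \<in> D n) \<and> finite {n. c n \<noteq> \<zero>\<^bsub>M\<^esub>} \<and>
        x = finsum M c {n. c n \<noteq> \<zero>\<^bsub>M\<^esub>})"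

text \<open>The commutative ground ring is ungraded, i.e. concentrated in degree 0.\<close>

locale graded_module = module A M
  for A :: "('a, 'r) ring_scheme" and M :: "('a, 'b, 'z) gmodule_scheme" +
  assumes direct_sum: "internal_direct_sum M (grade M)"
    and smult_grade: "\<lbrakk>a \<in> carrier A; x \<in> grade M n\<rbrakk> \<Longrightarrow> a \<odot>\<^bsub>M\<^esub> x \<in> grade M n"

definition linear_maps ::
  "('a, 'r) ring_scheme \<Rightarrow> ('a, 'b, 'y) module_scheme \<Rightarrow> ('a, 'c, 'z) module_scheme \<Rightarrow> ('b \<Rightarrow> 'c) set" where
  "linear_maps A M N =
     {f \<in> carrier M \<rightarrow> carrier N.
        (\<forall>x \<in> carrier M. \<forall>y \<in> carrier M. f (x \<oplus>\<^bsub>M\<^esub> y) = f x \<oplus>\<^bsub>N\<^esub> f y) \<and>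
        (\<forall>a \<in> carrier A. \<forall>x \<in> carrier M. f (a \<odot>\<^bsub>M\<^esub> x) = a \<odot>\<^bsub>N\<^esub> f x)}"

definition graded_linear_maps ::
  "('a, 'r) ring_scheme \<Rightarrow> ('a, 'b, 'y) gmodule_scheme \<Rightarrow> ('a, 'c, 'z) gmodule_scheme \<Rightarrow> ('b \<Rightarrow> 'c) set" where
  "graded_linear_maps A M N = {f \<in> linear_maps A M N. \<forall>n. f ` grade M n \<subseteq> grade N n}"

definition base_module :: "('a, 'r) ring_scheme \<Rightarrow> ('a, 'a) gmodule" where
  "base_module A =
     \<lparr>carrier = carrier A, monoid.mult = monoid.mult A, monoid.one = \<one>\<^bsub>A\<^esub>,
      ring.zero = \<zero>\<^bsub>A\<^esub>, ring.add = add A,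
      smult = monoid.mult A, grade = (\<lambda>n. if n = 0 then carrier A else {\<zero>\<^bsub>A\<^esub>})\<rparr>"

text \<open>
  Projectivity is the lifting property along surjections \<open>N \<rightarrow> N'\<close>.  Higher-order logic cannot
  quantify over types, so the carriers of the test modules live in fixed types.  These types are
  large enough: \<open>N'\<close> may be \<open>P\<close> itself and \<open>N\<close> the free module of finitely supported functions
  on the carrier of \<open>P\<close>, and a splitting of that surjection gives the lifting property
  against test modules of any type.
\<close>

definition projective_module :: "('a, 'r) ring_scheme \<Rightarrow> ('a, 'c, 'z) module_scheme \<Rightarrow> bool" where
  "projective_module A P \<longleftrightarrow> module A P \<and>
     (\<forall>(N :: ('a, 'c \<Rightarrow> 'a) module) (N' :: ('a, 'c) module) g h.
        module A N \<and> module A N' \<and> g \<in> linear_maps A N N' \<and> g ` carrier N = carrier N' \<and>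
        h \<in> linear_maps A P N' \<longrightarrow>
        (\<exists>k \<in> linear_maps A P N. \<forall>x \<in> carrier P. g (k x) = h x))"


section \<open>Tensor products over the ground ring\<close>

text \<open>
  The tensor product is the free abelian group on pairs modulo the subgroup generated by the
  biadditivity and balancing relations; its elements are cosets.
\<close>

definition tensor_relations ::
  "('a, 'r) ring_scheme \<Rightarrow> ('a, 'b, 'y) gmodule_scheme \<Rightarrow> ('a, 'c, 'z) gmodule_scheme \<Rightarrow>
     ('b \<times> 'c \<Rightarrow>\<^sub>0 int) set" where
  "tensor_relations A M N =
     {frag_of (x \<oplus>\<^bsub>M\<^esub> x', y) - frag_of (x, y) - frag_of (x', y) | x x' y.
        x \<in> carrier M \<and> x' \<in> carrier M \<and> y \<in> carrier N} \<union>
     {frag_of (x, y \<oplus>\<^bsub>N\<^esub> y') - frag_of (x, y) - frag_of (x, y') | x y y'.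
        x \<in> carrier M \<and> y \<in> carrier N \<and> y' \<in> carrier N} \<union>
     {frag_of (a \<odot>\<^bsub>M\<^esub> x, y) - frag_of (x, a \<odot>\<^bsub>N\<^esub> y) | a x y.
        a \<in> carrier A \<and> x \<in> carrier M \<and> y \<in> carrier N}"

definition tensor_null ::
  "('a, 'r) ring_scheme \<Rightarrow> ('a, 'b, 'y) gmodule_scheme \<Rightarrow> ('a, 'c, 'z) gmodule_scheme \<Rightarrow>
     ('b \<times> 'c \<Rightarrow>\<^sub>0 int) set" where
  "tensor_null A M N =
     generate (free_Abelian_group (carrier M \<times> carrier N)) (tensor_relations A M N)"

definition tensor_group ::
  "('a, 'r) ring_scheme \<Rightarrow> ('a, 'b, 'y) gmodule_scheme \<Rightarrow> ('a, 'c, 'z) gmodule_scheme \<Rightarrow>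
     ('b \<times> 'c \<Rightarrow>\<^sub>0 int) set monoid" where
  "tensor_group A M N = free_Abelian_group (carrier M \<times> carrier N) Mod tensor_null A M N"

definition tensor_class ::
  "('a, 'r) ring_scheme \<Rightarrow> ('a, 'b, 'y) gmodule_scheme \<Rightarrow> ('a, 'c, 'z) gmodule_scheme \<Rightarrow>
     ('b \<times> 'c \<Rightarrow>\<^sub>0 int) \<Rightarrow> ('b \<times> 'c \<Rightarrow>\<^sub>0 int) set" where
  "tensor_class A M N u =
     tensor_null A M N #>\<^bsub>free_Abelian_group (carrier M \<times> carrier N)\<^esub> u"

definition pure_tensor ::
  "('a, 'r) ring_scheme \<Rightarrow> ('a, 'b, 'y) gmodule_scheme \<Rightarrow> ('a, 'c, 'z) gmodule_scheme \<Rightarrow>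
     'b \<Rightarrow> 'c \<Rightarrow> ('b \<times> 'c \<Rightarrow>\<^sub>0 int) set" where
  "pure_tensor A M N x y = tensor_class A M N (frag_of (x, y))"

text \<open>
  Scalars act through the left factor; the union below is a union of equal cosets.
  Degree \<open>n\<close> is spanned by the pure tensors of elements of degrees \<open>i\<close> and \<open>n - i\<close>.
\<close>

definition tensor ::
  "('a, 'r) ring_scheme \<Rightarrow> ('a, 'b, 'y) gmodule_scheme \<Rightarrow> ('a, 'c, 'z) gmodule_scheme \<Rightarrow>
     ('a, ('b \<times> 'c \<Rightarrow>\<^sub>0 int) set) gmodule" where
  "tensor A M N =
     \<lparr>carrier = carrier (tensor_group A M N),
      monoid.mult = undefined, monoid.one = undefined,
      ring.zero = \<one>\<^bsub>tensor_group A M N\<^esub>,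
      ring.add = monoid.mult (tensor_group A M N),
      smult = (\<lambda>a t. \<Union>u \<in> t.
        tensor_class A M N (frag_extend (\<lambda>(x, y). frag_of (a \<odot>\<^bsub>M\<^esub> x, y)) u)),
      grade = (\<lambda>n. generate (tensor_group A M N)
        {pure_tensor A M N x y | i x y. x \<in> grade M i \<and> y \<in> grade N (n - i)})\<rparr>"

text \<open>
  The linear map out of a tensor product induced by a bilinear map \<open>b\<close>, given by the
  universal property.
\<close>

definition tensor_lift ::
  "('a, 'r) ring_scheme \<Rightarrow> ('a, 'b, 'y) gmodule_scheme \<Rightarrow> ('a, 'c, 'z) gmodule_scheme \<Rightarrow>
     ('a, 'd, 'w) module_scheme \<Rightarrow> ('b \<Rightarrow> 'c \<Rightarrow> 'd) \<Rightarrow> ('b \<times> 'c \<Rightarrow>\<^sub>0 int) set \<Rightarrow> 'd" where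
  "tensor_lift A M N P b =
     (THE h. h \<in> linear_maps A (tensor A M N) P \<and> h \<in> extensional (carrier (tensor A M N)) \<and>
        (\<forall>x \<in> carrier M. \<forall>y \<in> carrier N. h (pure_tensor A M N x y) = b x y))"

definition tensor_map ::
  "('a, 'r) ring_scheme \<Rightarrow> ('a, 'b, 'y) gmodule_scheme \<Rightarrow> ('a, 'c, 'z) gmodule_scheme \<Rightarrow>
     ('a, 'd, 'v) gmodule_scheme \<Rightarrow> ('a, 'e, 'w) gmodule_scheme \<Rightarrow> ('b \<Rightarrow> 'd) \<Rightarrow> ('c \<Rightarrow> 'e) \<Rightarrow>
     ('b \<times> 'c \<Rightarrow>\<^sub>0 int) set \<Rightarrow> ('d \<times> 'e \<Rightarrow>\<^sub>0 int) set" where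
  "tensor_map A M N M' N' f g =
     tensor_lift A M N (tensor A M' N') (\<lambda>x y. pure_tensor A M' N' (f x) (g y))"

definition tensor_right_unit ::
  "('a, 'r) ring_scheme \<Rightarrow> ('a, 'b, 'z) gmodule_scheme \<Rightarrow> ('b \<times> 'a \<Rightarrow>\<^sub>0 int) set \<Rightarrow> 'b" where
  "tensor_right_unit A M = tensor_lift A M (base_module A) M (\<lambda>x a. a \<odot>\<^bsub>M\<^esub> x)"

definition tensor_left_unit ::
  "('a, 'r) ring_scheme \<Rightarrow> ('a, 'b, 'z) gmodule_scheme \<Rightarrow> ('a \<times> 'b \<Rightarrow>\<^sub>0 int) set \<Rightarrow> 'b" where
  "tensor_left_unit A M = tensor_lift A (base_module A) M M (\<lambda>a x. a \<odot>\<^bsub>M\<^esub> x)"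

definition tensor_assoc ::
  "('a, 'r) ring_scheme \<Rightarrow> ('a, 'b, 'y) gmodule_scheme \<Rightarrow> ('a, 'c, 'z) gmodule_scheme \<Rightarrow>
     ('a, 'd, 'w) gmodule_scheme \<Rightarrow>
     (('b \<times> 'c \<Rightarrow>\<^sub>0 int) set \<times> 'd \<Rightarrow>\<^sub>0 int) set \<Rightarrow> ('b \<times> ('c \<times> 'd \<Rightarrow>\<^sub>0 int) set \<Rightarrow>\<^sub>0 int) set" where
  "tensor_assoc A M N P =
     tensor_lift A (tensor A M N) P (tensor A M (tensor A N P))
       (\<lambda>t z. tensor_lift A M N (tensor A M (tensor A N P))
          (\<lambda>x y. pure_tensor A M (tensor A N P) x (pure_tensor A N P y z)) t)"


section \<open>Graded coalgebras and graded right comodules\<close>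

record ('a, 'c) gcoalgebra = "('a, 'c) gmodule" +
  comult :: "'c \<Rightarrow> ('c \<times> 'c \<Rightarrow>\<^sub>0 int) set"
  counit :: "'c \<Rightarrow> 'a"

locale graded_coalgebra = graded_module A C
  for A :: "('a, 'r) ring_scheme" and C :: "('a, 'c, 'z) gcoalgebra_scheme" +
  assumes comult_linear: "comult C \<in> graded_linear_maps A C (tensor A C C)"
    and counit_linear: "counit C \<in> graded_linear_maps A C (base_module A)"
    and coassoc: "x \<in> carrier C \<Longrightarrow>
      tensor_assoc A C C C (tensor_map A C C (tensor A C C) C (comult C) id (comult C x)) =
      tensor_map A C C C (tensor A C C) id (comult C) (comult C x)"
    and counit_right: "x \<in> carrier C \<Longrightarrow>
      tensor_right_unit A C (tensor_map A C C C (base_module A) id (counit C) (comult C x)) = x"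
    and counit_left: "x \<in> carrier C \<Longrightarrow>
      tensor_left_unit A C (tensor_map A C C (base_module A) C (counit C) id (comult C x)) = x"

record ('a, 'c, 'm) gcomodule = "('a, 'm) gmodule" +
  coact :: "'m \<Rightarrow> ('m \<times> 'c \<Rightarrow>\<^sub>0 int) set"

locale graded_comodule = graded_module A M
  for A :: "('a, 'r) ring_scheme" and C :: "('a, 'c, 'z) gcoalgebra_scheme"
    and M :: "('a, 'c, 'm, 'y) gcomodule_scheme" +
  assumes coact_linear: "coact M \<in> graded_linear_maps A M (tensor A M C)"
    and coact_coassoc: "x \<in> carrier M \<Longrightarrow>
      tensor_assoc A M C C (tensor_map A M C (tensor A M C) C (coact M) id (coact M x)) =
      tensor_map A M C M (tensor A C C) id (comult C) (coact M x)"
    and coact_counit: "x \<in> carrier M \<Longrightarrow>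
      tensor_right_unit A M (tensor_map A M C M (base_module A) id (counit C) (coact M x)) = x"

definition regular_comodule :: "('a, 'c, 'z) gcoalgebra_scheme \<Rightarrow> ('a, 'c, 'c) gcomodule" where
  "regular_comodule C =
     \<lparr>carrier = carrier C, monoid.mult = monoid.mult C, monoid.one = \<one>\<^bsub>C\<^esub>,
      ring.zero = \<zero>\<^bsub>C\<^esub>, ring.add = add C,
      smult = smult C, grade = grade C, coact = comult C\<rparr>"


section \<open>The graded dual algebra and its graded left modules\<close>

text \<open>
  A linear map \<open>C\<^sup>-\<^sup>n \<rightarrow> A\<close> is identified with its extension by zero to the whole of \<open>C\<close>.  The
  direct sum of the degrees then consists of the linear maps that vanish on all but finitely
  many degrees of \<open>C\<close>.  No Koszul signs are used, and the convolution product is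
  \<open>C \<rightarrow> C \<otimes> C \<rightarrow> A \<otimes> A \<cong> A\<close> with \<open>f \<otimes> g\<close> in the middle, so that right comodules become left
  modules.
\<close>

definition dual_carrier :: "('a, 'r) ring_scheme \<Rightarrow> ('a, 'c, 'z) gcoalgebra_scheme \<Rightarrow> ('c \<Rightarrow> 'a) set" where
  "dual_carrier A C =
     {f \<in> linear_maps A C (base_module A) \<inter> extensional (carrier C).
        finite {n. \<exists>x \<in> grade C n. f x \<noteq> \<zero>\<^bsub>A\<^esub>}}"

definition dual_algebra ::
  "('a, 'r) ring_scheme \<Rightarrow> ('a, 'c, 'z) gcoalgebra_scheme \<Rightarrow> ('a, 'c \<Rightarrow> 'a) gmodule" where
  "dual_algebra A C =
     \<lparr>carrier = dual_carrier A C,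
      monoid.mult = (\<lambda>f g. \<lambda>x \<in> carrier C.
        tensor_right_unit A (base_module A)
          (tensor_map A C C (base_module A) (base_module A) f g (comult C x))),
      monoid.one = restrict (counit C) (carrier C),
      ring.zero = (\<lambda>x \<in> carrier C. \<zero>\<^bsub>A\<^esub>),
      ring.add = (\<lambda>f g. \<lambda>x \<in> carrier C. f x \<oplus>\<^bsub>A\<^esub> g x),
      smult = (\<lambda>a f. \<lambda>x \<in> carrier C. a \<otimes>\<^bsub>A\<^esub> f x),
      grade = (\<lambda>n. {f \<in> dual_carrier A C. \<forall>k. k \<noteq> - n \<longrightarrow> (\<forall>x \<in> grade C k. f x = \<zero>\<^bsub>A\<^esub>)})\<rparr>"

text \<open>
  The library's modules are over commutative rings only.  That \<open>R\<close> is a graded ring is not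
  part of this locale: for the dual algebra of a graded coalgebra it is a consequence of the
  coalgebra axioms.
\<close>

locale graded_left_module = abelian_group M
  for R :: "('a, 'r, 'y) gmodule_scheme" and M :: "('r, 'm, 'z) gmodule_scheme" +
  assumes smult_closed: "\<lbrakk>r \<in> carrier R; x \<in> carrier M\<rbrakk> \<Longrightarrow> r \<odot>\<^bsub>M\<^esub> x \<in> carrier M"
    and smult_l_distr: "\<lbrakk>r \<in> carrier R; s \<in> carrier R; x \<in> carrier M\<rbrakk> \<Longrightarrow>
      (r \<oplus>\<^bsub>R\<^esub> s) \<odot>\<^bsub>M\<^esub> x = r \<odot>\<^bsub>M\<^esub> x \<oplus>\<^bsub>M\<^esub> s \<odot>\<^bsub>M\<^esub> x"
    and smult_r_distr: "\<lbrakk>r \<in> carrier R; x \<in> carrier M; y \<in> carrier M\<rbrakk> \<Longrightarrow>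
      r \<odot>\<^bsub>M\<^esub> (x \<oplus>\<^bsub>M\<^esub> y) = r \<odot>\<^bsub>M\<^esub> x \<oplus>\<^bsub>M\<^esub> r \<odot>\<^bsub>M\<^esub> y"
    and smult_assoc: "\<lbrakk>r \<in> carrier R; s \<in> carrier R; x \<in> carrier M\<rbrakk> \<Longrightarrow>
      (r \<otimes>\<^bsub>R\<^esub> s) \<odot>\<^bsub>M\<^esub> x = r \<odot>\<^bsub>M\<^esub> (s \<odot>\<^bsub>M\<^esub> x)"
    and smult_one: "x \<in> carrier M \<Longrightarrow> \<one>\<^bsub>R\<^esub> \<odot>\<^bsub>M\<^esub> x = x"
    and direct_sum: "internal_direct_sum M (grade M)"
    and smult_grade: "\<lbrakk>r \<in> grade R i; x \<in> grade M j\<rbrakk> \<Longrightarrow> r \<odot>\<^bsub>M\<^esub> x \<in> grade M (i + j)"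

definition graded_isos ::
  "('a, 'r, 'x) gmodule_scheme \<Rightarrow> ('r, 'm, 'y) gmodule_scheme \<Rightarrow> ('r, 'n, 'z) gmodule_scheme \<Rightarrow>
     ('m \<Rightarrow> 'n) set" where
  "graded_isos R M N = {f \<in> graded_linear_maps R M N. bij_betw f (carrier M) (carrier N)}"

text \<open>The functor from graded comodules to graded modules over the dual algebra, on objects.\<close>

definition adjoint_module ::
  "('a, 'r) ring_scheme \<Rightarrow> ('a, 'c, 'z) gcoalgebra_scheme \<Rightarrow> ('a, 'c, 'm, 'y) gcomodule_scheme \<Rightarrow>
     ('c \<Rightarrow> 'a, 'm) gmodule" where
  "adjoint_module A C M =
     \<lparr>carrier = carrier M, monoid.mult = monoid.mult M, monoid.one = \<one>\<^bsub>M\<^esub>,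
      ring.zero = \<zero>\<^bsub>M\<^esub>, ring.add = add M,
      smult = (\<lambda>f x. tensor_right_unit A M
        (tensor_map A M C M (base_module A) id f (coact M x))),
      grade = grade M\<rparr>"

text \<open>
  Any comodule whose adjoint module is isomorphic to \<open>M\<close> can be transported along the
  isomorphism to the type of \<open>M\<close>, so it is enough to let comodules range over that type.
\<close>

definition rational ::
  "('a, 'r) ring_scheme \<Rightarrow> ('a, 'c, 'z) gcoalgebra_scheme \<Rightarrow> ('c \<Rightarrow> 'a, 'm, 'y) gmodule_scheme \<Rightarrow> bool" where
  "rational A C M \<longleftrightarrow>
     (\<exists>N :: ('a, 'c, 'm) gcomodule. graded_comodule A C N \<and>
        graded_isos (dual_algebra A C) (adjoint_module A C N) M \<noteq> {})"


section \<open>Distinguished torsion\<close>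

definition homogeneous_subgroup :: "('a, 'm, 'z) gmodule_scheme \<Rightarrow> 'm set \<Rightarrow> bool" where
  "homogeneous_subgroup M H \<longleftrightarrow>
     additive_subgroup H M \<and> generate (add_monoid M) (H \<inter> (\<Union>n. grade M n)) = H"

definition homogeneous_left_ideal :: "('a, 'r, 'z) gmodule_scheme \<Rightarrow> 'r set \<Rightarrow> bool" where
  "homogeneous_left_ideal R I \<longleftrightarrow>
     homogeneous_subgroup R I \<and> (\<forall>r \<in> carrier R. \<forall>x \<in> I. r \<otimes>\<^bsub>R\<^esub> x \<in> I)"

definition graded_submodule ::
  "('a, 'r, 'y) gmodule_scheme \<Rightarrow> ('r, 'm, 'z) gmodule_scheme \<Rightarrow> 'm set \<Rightarrow> bool" where
  "graded_submodule R M H \<longleftrightarrow>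
     homogeneous_subgroup M H \<and> (\<forall>r \<in> carrier R. \<forall>x \<in> H. r \<odot>\<^bsub>M\<^esub> x \<in> H)"

definition left_annihilator ::
  "('a, 'r, 'y) gmodule_scheme \<Rightarrow> ('r, 'm, 'z) gmodule_scheme \<Rightarrow> 'm \<Rightarrow> 'r set" where
  "left_annihilator R M x = {r \<in> carrier R. r \<odot>\<^bsub>M\<^esub> x = \<zero>\<^bsub>M\<^esub>}"

definition strongly_distinguished ::
  "('a, 'r) ring_scheme \<Rightarrow> ('a, 'c, 'z) gcoalgebra_scheme \<Rightarrow> ('c \<Rightarrow> 'a) set \<Rightarrow> bool" where
  "strongly_distinguished A C I \<longleftrightarrow>
     homogeneous_left_ideal (dual_algebra A C) I \<and>
     (\<exists>n. \<exists>x \<in> grade C n. x \<noteq> \<zero>\<^bsub>C\<^esub> \<and>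
        I = left_annihilator (dual_algebra A C) (adjoint_module A C (regular_comodule C)) x)"

text \<open>The empty intersection is the whole dual algebra; it annihilates only 0.\<close>

definition h0_dist ::
  "('a, 'r) ring_scheme \<Rightarrow> ('a, 'c, 'z) gcoalgebra_scheme \<Rightarrow> ('c \<Rightarrow> 'a, 'm, 'y) gmodule_scheme \<Rightarrow> 'm set" where
  "h0_dist A C M = generate (add_monoid M)
     {m. (\<exists>n. m \<in> grade M n) \<and>
         (\<exists>F. finite F \<and> (\<forall>I \<in> F. strongly_distinguished A C I) \<and>
            (\<forall>f \<in> carrier (dual_algebra A C) \<inter> \<Inter>F. f \<odot>\<^bsub>M\<^esub> m = \<zero>\<^bsub>M\<^esub>))}"

definition H0_dist ::
  "('a, 'r) ring_scheme \<Rightarrow> ('a, 'c, 'z) gcoalgebra_scheme \<Rightarrow> ('c \<Rightarrow> 'a, 'm, 'y) gmodule_scheme \<Rightarrow> 'm set" where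
  "H0_dist A C M = \<Inter>{H. graded_submodule (dual_algebra A C) M H \<and> h0_dist A C M \<subseteq> H}"

text \<open>The inclusion of a graded submodule is an isomorphism iff the submodule is everything.\<close>

definition distinguished_torsion ::
  "('a, 'r) ring_scheme \<Rightarrow> ('a, 'c, 'z) gcoalgebra_scheme \<Rightarrow> ('c \<Rightarrow> 'a, 'm, 'y) gmodule_scheme \<Rightarrow> bool" where
  "distinguished_torsion A C M \<longleftrightarrow> H0_dist A C M = carrier M"

end

theory Submission
  imports Defs
begin

text \<open>
  Write \<open>f c\<close> for the action of an element \<open>f\<close> of the dual algebra on \<open>c\<close> in the coalgebra \<open>C\<close>,
  \<open>f(c)\<close> for its value there, and \<open>(id \<otimes> f) t\<close> for the slice by \<open>f\<close> of a tensor \<open>t\<close> in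
  \<open>N \<otimes> C\<close>.  On a comodule \<open>N\<close> with coaction \<open>\<rho>\<close> the dual algebra acts by
  \<open>f x = (id \<otimes> f) (\<rho> x)\<close>.

  Suppose first that the module comes from a comodule.  Write \<open>\<rho> x\<close> as a finite sum
  of tensors \<open>x\<^sub>i \<otimes> c\<^sub>i\<close> with \<open>c\<^sub>i\<close> homogeneous.  If \<open>f\<close> annihilates every \<open>c\<^sub>i\<close>, then
  \<open>f(c\<^sub>i) = \<epsilon>(f c\<^sub>i) = 0\<close>, and so \<open>f x = 0\<close>.  The annihilators of homogeneous elements are
  homogeneous ideals, so \<open>x\<close> is killed by a finite intersection of strongly distinguished ideals
  (\<open>coaction_element_torsion\<close>).

  The converse uses a homogeneous dual basis \<open>\<phi>\<^sub>j\<close>, \<open>e\<^sub>j\<close> of the projective module \<open>C\<close>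
  (\<open>homogeneous_dual_basis\<close>).  Every tensor \<open>t\<close> in \<open>N \<otimes> C\<close> is the sum of the
  \<open>(id \<otimes> \<phi>\<^sub>j) t \<otimes> e\<^sub>j\<close> over any sufficiently large finite set of indices (\<open>tensor_expansion\<close>), and
  therefore is determined by its slices (\<open>tensor_eqI\<close>).  For \<open>t = \<Delta> c\<close> this says that \<open>f\<close> and the
  finite combination \<open>\<Sum>j. f(e\<^sub>j) \<phi>\<^sub>j\<close> act alike on \<open>c\<close>, with one finite index set for all \<open>f\<close> and for
  finitely many \<open>c\<close>.  If the intersection of the annihilators of these \<open>c\<close> kills \<open>m\<close>, it follows that
  \<open>f m = (\<Sum>j. f(e\<^sub>j) (\<phi>\<^sub>j m))\<close> for all \<open>f\<close>; that is, the tensor \<open>\<Sum>j. \<phi>\<^sub>j m \<otimes> e\<^sub>j\<close> has the slices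
  that a coaction of \<open>m\<close> must have (\<open>torsion_in_rational_part\<close>).  The elements for which such a tensor
  exists form a submodule, so in a distinguished-torsion module there is one for every element.  It
  is unique, and the uniqueness yields the comodule axioms from the module axioms; coassociativity
  comes from the associativity of the action and the expansion of \<open>\<Delta> c\<close> (\<open>rational_action\<close>).

  The tensor product is a quotient of a free abelian group, so its module structure and its
  universal property are established beforehand.
\<close>

section \<open>Additive and linear maps\<close>

lemma hom_finsum:
  assumes "abelian_group G" "abelian_group H"
    and h: "h \<in> hom (add_monoid G) (add_monoid H)"
    and "finite J" and "\<And>j. j \<in> J \<Longrightarrow> f j \<in> carrier G"
  shows "h (finsum G f J) = finsum H (\<lambda>j. h (f j)) J"
proof -
  interpret G: abelian_group G by fact
  interpret H: abelian_group H by fact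
  have clo: "x \<in> carrier G \<Longrightarrow> h x \<in> carrier H" for x
    using hom_in_carrier[OF h] by simp
  have "h \<zero>\<^bsub>G\<^esub> = \<zero>\<^bsub>H\<^esub>"
    using hom_one[OF h G.a_group H.a_group] by simp
  with assms(4,5) show ?thesis
  proof (induction J rule: finite_induct)
    case (insert j J)
    have "h (f j \<oplus>\<^bsub>G\<^esub> finsum G f J) = h (f j) \<oplus>\<^bsub>H\<^esub> h (finsum G f J)"
      using hom_mult[OF h, of "f j" "finsum G f J"] insert.prems
      by (simp add: G.finsum_closed Pi_iff)
    then show ?case
      using insert clo by (simp add: G.finsum_insert H.finsum_insert Pi_iff)
  qed simp
qed

lemma linear_maps_closed: "f \<in> linear_maps A M N \<Longrightarrow> x \<in> carrier M \<Longrightarrow> f x \<in> carrier N"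
  by (auto simp: linear_maps_def)

lemma linear_maps_add:
  "f \<in> linear_maps A M N \<Longrightarrow> x \<in> carrier M \<Longrightarrow> y \<in> carrier M \<Longrightarrow> f (x \<oplus>\<^bsub>M\<^esub> y) = f x \<oplus>\<^bsub>N\<^esub> f y"
  by (auto simp: linear_maps_def)

lemma linear_maps_smult:
  "f \<in> linear_maps A M N \<Longrightarrow> a \<in> carrier A \<Longrightarrow> x \<in> carrier M \<Longrightarrow> f (a \<odot>\<^bsub>M\<^esub> x) = a \<odot>\<^bsub>N\<^esub> f x"
  by (auto simp: linear_maps_def)

lemma linear_mapsI:
  assumes "\<And>x. x \<in> carrier M \<Longrightarrow> f x \<in> carrier N"
    and "\<And>x y. x \<in> carrier M \<Longrightarrow> y \<in> carrier M \<Longrightarrow> f (x \<oplus>\<^bsub>M\<^esub> y) = f x \<oplus>\<^bsub>N\<^esub> f y"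
    and "\<And>a x. a \<in> carrier A \<Longrightarrow> x \<in> carrier M \<Longrightarrow> f (a \<odot>\<^bsub>M\<^esub> x) = a \<odot>\<^bsub>N\<^esub> f x"
  shows "f \<in> linear_maps A M N"
  using assms by (auto simp: linear_maps_def)

lemma linear_maps_hom: "f \<in> linear_maps A M N \<Longrightarrow> f \<in> hom (add_monoid M) (add_monoid N)"
  by (auto simp: linear_maps_def hom_def)

lemma linear_maps_cong:
  assumes "module A M" "f \<in> linear_maps A M N" "\<And>x. x \<in> carrier M \<Longrightarrow> g x = f x"
  shows "g \<in> linear_maps A M N"
proof -
  interpret module A M by fact
  show ?thesis using assms(2,3) by (auto simp: linear_maps_def)
qed

lemma linear_maps_compose:
  "f \<in> linear_maps A M N \<Longrightarrow> g \<in> linear_maps A N P \<Longrightarrow> (\<lambda>x. g (f x)) \<in> linear_maps A M P"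
  by (auto simp: linear_maps_def Pi_iff)

lemma linear_maps_id: "id \<in> linear_maps A M M"
  by (auto simp: linear_maps_def)

lemma linear_maps_zero:
  assumes "abelian_group M" "abelian_group N" "f \<in> linear_maps A M N"
  shows "f \<zero>\<^bsub>M\<^esub> = \<zero>\<^bsub>N\<^esub>"
  using hom_one[OF linear_maps_hom[OF assms(3)]] abelian_group.a_group[OF assms(1)]
    abelian_group.a_group[OF assms(2)] by simp

definition bilinear_maps ::
  "('a, 'r) ring_scheme \<Rightarrow> ('a, 'b, 'y) module_scheme \<Rightarrow> ('a, 'c, 'z) module_scheme \<Rightarrow>
     ('a, 'd, 'w) module_scheme \<Rightarrow> ('b \<Rightarrow> 'c \<Rightarrow> 'd) set" where
  "bilinear_maps A M N P = {b.
     (\<forall>x \<in> carrier M. b x \<in> linear_maps A N P) \<and>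
     (\<forall>y \<in> carrier N. (\<lambda>x. b x y) \<in> linear_maps A M P)}"

section \<open>The universal property of the tensor product\<close>

locale module_pair = M: module A M + N: module A N
  for A :: "('a, 'r) ring_scheme" and M :: "('a, 'b, 'y) gmodule_scheme"
    and N :: "('a, 'c, 'z) gmodule_scheme"
begin

abbreviation "FG \<equiv> free_Abelian_group (carrier M \<times> carrier N)"

lemma comm_group_FG: "comm_group FG"
  by (rule abelian_free_Abelian_group)

lemma tensor_relations_subset: "tensor_relations A M N \<subseteq> carrier FG"
  unfolding tensor_relations_def
  by (auto dest!: subsetD[OF keys_diff] split: if_splits)

lemma tensor_null_subgroup: "subgroup (tensor_null A M N) FG"
  unfolding tensor_null_def
  by (intro group.generate_is_subgroup tensor_relations_subset) simp

lemma tensor_null_normal: "normal (tensor_null A M N) FG"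
  using comm_group_FG tensor_null_subgroup by (simp add: comm_group.subgroup_imp_normal)

lemma tensor_relations_null: "u \<in> tensor_relations A M N \<Longrightarrow> u \<in> tensor_null A M N"
  unfolding tensor_null_def by (rule generate.incl)

lemma tensor_class_hom: "tensor_class A M N \<in> hom FG (tensor_group A M N)"
  using normal.r_coset_hom_Mod[OF tensor_null_normal]
  by (simp add: tensor_class_def[abs_def] tensor_group_def)

lemma comm_group_tensor_group: "comm_group (tensor_group A M N)"
  unfolding tensor_group_def
  by (rule comm_group.abelian_FactGroup[OF comm_group_FG tensor_null_subgroup])

lemma tensor_fields:
  "carrier (tensor A M N) = carrier (tensor_group A M N)"
  "\<zero>\<^bsub>tensor A M N\<^esub> = \<one>\<^bsub>tensor_group A M N\<^esub>"
  "add (tensor A M N) = monoid.mult (tensor_group A M N)"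
  by (simp_all add: tensor_def)

lemma abelian_group_tensor: "abelian_group (tensor A M N)"
proof -
  interpret G: comm_group "tensor_group A M N" by (rule comm_group_tensor_group)
  show ?thesis
    by (rule abelian_groupI)
      (simp_all add: tensor_fields G.m_assoc G.l_inv_ex, simp add: G.m_comm)
qed

lemma carrier_tensor: "carrier (tensor A M N) = tensor_class A M N ` carrier FG"
  by (simp add: tensor_fields tensor_group_def carrier_FactGroup tensor_class_def[abs_def])

lemma tensor_class_closed: "u \<in> carrier FG \<Longrightarrow> tensor_class A M N u \<in> carrier (tensor A M N)"
  using carrier_tensor by blast

lemma tensor_class_add:
  assumes "u \<in> carrier FG" "v \<in> carrier FG"
  shows "tensor_class A M N (u + v) = tensor_class A M N u \<oplus>\<^bsub>tensor A M N\<^esub> tensor_class A M N v"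
  using hom_mult[OF tensor_class_hom assms] by (simp add: tensor_fields)

lemma tensor_class_eqI:
  assumes "u \<in> carrier FG" "v \<in> carrier FG" "u - v \<in> tensor_null A M N"
  shows "tensor_class A M N u = tensor_class A M N v"
proof -
  interpret F: comm_group FG by (rule comm_group_FG)
  have "u \<in> tensor_null A M N #>\<^bsub>FG\<^esub> v"
    using assms by (auto simp: r_coset_def intro!: bexI[where x = "u - v"])
  then show ?thesis
    unfolding tensor_class_def
    using F.repr_independence[OF _ assms(2) tensor_null_subgroup] by metis
qed

lemma pure_closed [simp]:
  "x \<in> carrier M \<Longrightarrow> y \<in> carrier N \<Longrightarrow> pure_tensor A M N x y \<in> carrier (tensor A M N)"
  unfolding pure_tensor_def by (rule tensor_class_closed) simp

lemma pure_add_left: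
  assumes "x \<in> carrier M" "x' \<in> carrier M" "y \<in> carrier N"
  shows "pure_tensor A M N (x \<oplus>\<^bsub>M\<^esub> x') y =
    pure_tensor A M N x y \<oplus>\<^bsub>tensor A M N\<^esub> pure_tensor A M N x' y"
proof -
  have "frag_of (x \<oplus>\<^bsub>M\<^esub> x', y) - (frag_of (x, y) + frag_of (x', y)) \<in> tensor_null A M N"
    by (rule tensor_relations_null) (use assms in \<open>force simp: tensor_relations_def diff_diff_eq\<close>)
  from tensor_class_eqI[OF _ _ this] show ?thesis
    using assms group.subgroup_self[of FG]
    by (simp add: pure_tensor_def tensor_class_add [symmetric] subsetD[OF keys_add]
        order_trans[OF keys_add])
qed

lemma pure_add_right:
  assumes "x \<in> carrier M" "y' \<in> carrier N" "y \<in> carrier N"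
  shows "pure_tensor A M N x (y \<oplus>\<^bsub>N\<^esub> y') =
    pure_tensor A M N x y \<oplus>\<^bsub>tensor A M N\<^esub> pure_tensor A M N x y'"
proof -
  have "frag_of (x, y \<oplus>\<^bsub>N\<^esub> y') - (frag_of (x, y) + frag_of (x, y')) \<in> tensor_null A M N"
    by (rule tensor_relations_null) (use assms in \<open>force simp: tensor_relations_def diff_diff_eq\<close>)
  from tensor_class_eqI[OF _ _ this] show ?thesis
    using assms
    by (simp add: pure_tensor_def tensor_class_add [symmetric]
        order_trans[OF keys_add])
qed

lemma pure_balanced:
  assumes "a \<in> carrier A" "x \<in> carrier M" "y \<in> carrier N"
  shows "pure_tensor A M N (a \<odot>\<^bsub>M\<^esub> x) y = pure_tensor A M N x (a \<odot>\<^bsub>N\<^esub> y)"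
proof -
  have "frag_of (a \<odot>\<^bsub>M\<^esub> x, y) - frag_of (x, a \<odot>\<^bsub>N\<^esub> y) \<in> tensor_null A M N"
    by (rule tensor_relations_null) (use assms in \<open>force simp: tensor_relations_def\<close>)
  from tensor_class_eqI[OF _ _ this] show ?thesis
    using assms by (simp add: pure_tensor_def)
qed

lemma pure_uminus_left:
  assumes "x \<in> carrier M" "y \<in> carrier N"
  shows "\<ominus>\<^bsub>tensor A M N\<^esub> pure_tensor A M N x y = pure_tensor A M N (\<ominus>\<^bsub>M\<^esub> x) y"
proof -
  interpret T: abelian_group "tensor A M N" by (rule abelian_group_tensor)
  have z: "pure_tensor A M N \<zero>\<^bsub>M\<^esub> y = \<zero>\<^bsub>tensor A M N\<^esub>"
    using pure_add_left[of "\<zero>\<^bsub>M\<^esub>" "\<zero>\<^bsub>M\<^esub>" y] assms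
    by (metis M.M.add.m_closed M.M.l_zero M.M.zero_closed T.add.l_cancel_one' pure_closed)
  have "pure_tensor A M N (\<ominus>\<^bsub>M\<^esub> x) y \<oplus>\<^bsub>tensor A M N\<^esub> pure_tensor A M N x y = \<zero>\<^bsub>tensor A M N\<^esub>"
    using pure_add_left[of "\<ominus>\<^bsub>M\<^esub> x" x y] assms z by (simp add: M.M.l_neg)
  then show ?thesis using assms T.minus_equality by auto
qed

text \<open>
  Elements of a tensor product are integer combinations of pure tensors.  The case of a difference
  is not listed because \<open>- (x \<otimes> y) = (- x) \<otimes> y\<close> is again pure; to make the induction on the
  free abelian group pass through differences, the property is carried for the negative as well.
\<close>

lemma tensor_induct [consumes 1, case_names pure add]:
  assumes t: "t \<in> carrier (tensor A M N)"
    and P: "\<And>x y. x \<in> carrier M \<Longrightarrow> y \<in> carrier N \<Longrightarrow> P (pure_tensor A M N x y)"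
    and plus: "\<And>s t. s \<in> carrier (tensor A M N) \<Longrightarrow> t \<in> carrier (tensor A M N) \<Longrightarrow>
      P s \<Longrightarrow> P t \<Longrightarrow> P (s \<oplus>\<^bsub>tensor A M N\<^esub> t)"
  shows "P t"
proof -
  interpret T: abelian_group "tensor A M N" by (rule abelian_group_tensor)
  from t obtain u where u: "Poly_Mapping.keys u \<subseteq> carrier M \<times> carrier N" and tu: "t = tensor_class A M N u"
    by (auto simp: carrier_tensor)
  have "u \<in> carrier FG \<and> P (tensor_class A M N u) \<and> P (\<ominus>\<^bsub>tensor A M N\<^esub> tensor_class A M N u)"
    using u
  proof (induction u rule: frag_induction)
    case zero
    have "tensor_class A M N 0 = \<zero>\<^bsub>tensor A M N\<^esub>"
      using hom_one[OF tensor_class_hom] comm_group_tensor_group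
      by (simp add: tensor_fields comm_group_def)
    moreover have "pure_tensor A M N \<zero>\<^bsub>M\<^esub> \<zero>\<^bsub>N\<^esub> = \<zero>\<^bsub>tensor A M N\<^esub>"
      using pure_add_left[of "\<zero>\<^bsub>M\<^esub>" "\<zero>\<^bsub>M\<^esub>" "\<zero>\<^bsub>N\<^esub>"]
      by (metis M.M.add.m_closed M.M.l_zero M.M.zero_closed N.M.zero_closed T.add.l_cancel_one' pure_closed)
    ultimately show ?case using P[of "\<zero>\<^bsub>M\<^esub>" "\<zero>\<^bsub>N\<^esub>"] P[of "\<ominus>\<^bsub>M\<^esub> \<zero>\<^bsub>M\<^esub>" "\<zero>\<^bsub>N\<^esub>"]
      pure_uminus_left[of "\<zero>\<^bsub>M\<^esub>" "\<zero>\<^bsub>N\<^esub>"] by simp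
  next
    case (one x)
    then obtain y z where "x = (y, z)" "y \<in> carrier M" "z \<in> carrier N" by auto
    with P[of y z] P[of "\<ominus>\<^bsub>M\<^esub> y" z] pure_uminus_left[of y z] show ?case
      by (simp add: pure_tensor_def)
  next
    case (diff a b)
    then have ab: "a \<in> carrier FG" "b \<in> carrier FG" by auto
    have c: "a - b \<in> carrier FG"
      using ab by (auto dest!: subsetD[OF keys_diff])
    have "tensor_class A M N a = tensor_class A M N (a - b) \<oplus>\<^bsub>tensor A M N\<^esub> tensor_class A M N b"
      using tensor_class_add[OF c ab(2)] by simp
    then have e: "tensor_class A M N (a - b) = tensor_class A M N a \<oplus>\<^bsub>tensor A M N\<^esub> \<ominus>\<^bsub>tensor A M N\<^esub> tensor_class A M N b"
      using tensor_class_closed ab c by (simp add: T.a_assoc T.r_neg)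
    then have "\<ominus>\<^bsub>tensor A M N\<^esub> tensor_class A M N (a - b) = tensor_class A M N b \<oplus>\<^bsub>tensor A M N\<^esub> \<ominus>\<^bsub>tensor A M N\<^esub> tensor_class A M N a"
      using tensor_class_closed ab by (simp add: T.minus_add T.a_comm)
    then show ?case using e diff.IH c ab tensor_class_closed plus by simp
  qed
  then show ?thesis using tu by simp
qed

abbreviation "scale a \<equiv> frag_extend (\<lambda>(x, y). frag_of (a \<odot>\<^bsub>M\<^esub> x, y))"

lemma scale_closed:
  assumes "a \<in> carrier A" "u \<in> carrier FG"
  shows "scale a u \<in> carrier FG"
proof -
  have "Poly_Mapping.keys (scale a u) \<subseteq>
      (\<Union>z \<in> Poly_Mapping.keys u. Poly_Mapping.keys (case z of (x, y) \<Rightarrow> frag_of (a \<odot>\<^bsub>M\<^esub> x, y)))"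
    by (rule keys_frag_extend)
  also have "\<dots> \<subseteq> carrier M \<times> carrier N"
    using assms by auto
  finally show ?thesis by simp
qed

lemma scale_relations:
  assumes a: "a \<in> carrier A" and h: "h \<in> tensor_relations A M N"
  shows "scale a h \<in> tensor_relations A M N"
  using h unfolding tensor_relations_def
proof (elim UnE CollectE exE conjE, goal_cases)
  case (1 x x' y)
  have "scale a h = frag_of (a \<odot>\<^bsub>M\<^esub> x \<oplus>\<^bsub>M\<^esub> a \<odot>\<^bsub>M\<^esub> x', y) - frag_of (a \<odot>\<^bsub>M\<^esub> x, y) - frag_of (a \<odot>\<^bsub>M\<^esub> x', y)"
    using 1 a by (simp add: frag_extend_diff M.smult_r_distr)
  then show ?case using 1 a by blast
next
  case (2 x y y')
  have "scale a h = frag_of (a \<odot>\<^bsub>M\<^esub> x, y \<oplus>\<^bsub>N\<^esub> y') - frag_of (a \<odot>\<^bsub>M\<^esub> x, y) - frag_of (a \<odot>\<^bsub>M\<^esub> x, y')"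
    using 2 by (simp add: frag_extend_diff)
  then show ?case using 2 a by blast
next
  case (3 b x y)
  then have "a \<odot>\<^bsub>M\<^esub> (b \<odot>\<^bsub>M\<^esub> x) = b \<odot>\<^bsub>M\<^esub> (a \<odot>\<^bsub>M\<^esub> x)"
    using a by (simp add: M.R.m_comm flip: M.smult_assoc1)
  then have "scale a h = frag_of (b \<odot>\<^bsub>M\<^esub> (a \<odot>\<^bsub>M\<^esub> x), y) - frag_of (a \<odot>\<^bsub>M\<^esub> x, b \<odot>\<^bsub>N\<^esub> y)"
    using 3 by (simp add: frag_extend_diff)
  then show ?case using 3 a by blast
qed

text \<open>
  The scalar action on cosets is well defined because scaling the left entry of every pair maps
  each kind of defining relation to a relation of the same kind; for the balancing relation this
  uses the commutativity of \<open>A\<close>.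
\<close>

lemma scale_null:
  assumes a: "a \<in> carrier A" and "u \<in> tensor_null A M N"
  shows "scale a u \<in> tensor_null A M N"
  using assms(2) unfolding tensor_null_def
proof (induction u rule: generate.induct)
  case one
  then show ?case using generate.one[of FG] by simp
next
  case (incl h)
  then show ?case using scale_relations[OF a] by (blast intro: generate.incl)
next
  case (inv h)
  have "h \<in> carrier FG" "scale a h \<in> carrier FG"
    using subsetD[OF tensor_relations_subset] scale_relations[OF a] inv by blast+
  then have "scale a (inv\<^bsub>FG\<^esub> h) = inv\<^bsub>FG\<^esub> scale a h"
    by (simp add: frag_extend_minus)
  then show ?case using generate.inv[OF scale_relations[OF a inv]] by simp
next
  case (eng h1 h2)
  then show ?case using generate.eng[OF eng.IH] by (simp add: frag_extend_add)
qed

lemma tensor_smult_class: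
  assumes "a \<in> carrier A" "u \<in> carrier FG"
  shows "a \<odot>\<^bsub>tensor A M N\<^esub> tensor_class A M N u = tensor_class A M N (scale a u)"
proof -
  have "tensor_class A M N (scale a v) = tensor_class A M N (scale a u)"
    if v: "v \<in> tensor_class A M N u" for v
  proof -
    from v obtain k where k: "k \<in> tensor_null A M N" "v = k + u"
      by (auto simp: tensor_class_def r_coset_def)
    have "k \<in> carrier FG" using k subgroup.subset[OF tensor_null_subgroup] by blast
    then have "v \<in> carrier FG" using k assms by (auto dest!: subsetD[OF keys_add])
    moreover have "scale a v - scale a u = scale a k"
      by (simp add: k frag_extend_add)
    ultimately show ?thesis
      using k assms by (intro tensor_class_eqI scale_closed) (simp_all add: scale_null)
  qed
  moreover have "u \<in> tensor_class A M N u"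
    unfolding tensor_class_def
    using assms tensor_null_subgroup by (metis group.rcos_self group_free_Abelian_group)
  ultimately have "(\<Union>v \<in> tensor_class A M N u. tensor_class A M N (scale a v)) = tensor_class A M N (scale a u)"
    by blast
  then show ?thesis by (simp add: tensor_def)
qed

lemma tensor_smult_closed:
  assumes "a \<in> carrier A" "t \<in> carrier (tensor A M N)"
  shows "a \<odot>\<^bsub>tensor A M N\<^esub> t \<in> carrier (tensor A M N)"
  using assms by (auto simp: carrier_tensor tensor_smult_class intro: scale_closed simp del: carrier_free_Abelian_group_iff)

lemma tensor_smult_add:
  assumes "a \<in> carrier A" "s \<in> carrier (tensor A M N)" "t \<in> carrier (tensor A M N)"
  shows "a \<odot>\<^bsub>tensor A M N\<^esub> (s \<oplus>\<^bsub>tensor A M N\<^esub> t) =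
    a \<odot>\<^bsub>tensor A M N\<^esub> s \<oplus>\<^bsub>tensor A M N\<^esub> a \<odot>\<^bsub>tensor A M N\<^esub> t"
proof -
  from assms obtain u v where uv: "u \<in> carrier FG" "v \<in> carrier FG"
    "s = tensor_class A M N u" "t = tensor_class A M N v"
    by (auto simp: carrier_tensor)
  then have "u + v \<in> carrier FG" by (auto dest!: subsetD[OF keys_add])
  then have "a \<odot>\<^bsub>tensor A M N\<^esub> tensor_class A M N (u + v) = tensor_class A M N (scale a (u + v))"
    using assms by (intro tensor_smult_class)
  also have "\<dots> = tensor_class A M N (scale a u + scale a v)"
    by (simp add: frag_extend_add)
  also have "\<dots> = tensor_class A M N (scale a u) \<oplus>\<^bsub>tensor A M N\<^esub> tensor_class A M N (scale a v)"
    using assms uv by (intro tensor_class_add scale_closed)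
  finally show ?thesis
    using assms uv tensor_class_add tensor_smult_class by metis
qed

lemma tensor_smult_pure:
  assumes "a \<in> carrier A" "x \<in> carrier M" "y \<in> carrier N"
  shows "a \<odot>\<^bsub>tensor A M N\<^esub> pure_tensor A M N x y = pure_tensor A M N (a \<odot>\<^bsub>M\<^esub> x) y"
  using assms by (simp add: pure_tensor_def tensor_smult_class)

lemma module_tensor: "module A (tensor A M N)"
proof -
  interpret T: abelian_group "tensor A M N" by (rule abelian_group_tensor)
  note [simp] = tensor_smult_closed tensor_smult_add tensor_smult_pure
  show ?thesis
  proof (rule moduleI)
    show "cring A" by (rule M.R.is_cring)
    show "abelian_group (tensor A M N)" by (rule abelian_group_tensor)
  next
    fix a b t assume ab: "a \<in> carrier A" "b \<in> carrier A" and "t \<in> carrier (tensor A M N)"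
    show "(a \<oplus>\<^bsub>A\<^esub> b) \<odot>\<^bsub>tensor A M N\<^esub> t =
        a \<odot>\<^bsub>tensor A M N\<^esub> t \<oplus>\<^bsub>tensor A M N\<^esub> b \<odot>\<^bsub>tensor A M N\<^esub> t"
      using \<open>t \<in> _\<close>
    proof (induction t rule: tensor_induct)
      case (pure x y)
      then show ?case using ab by (simp add: M.smult_l_distr pure_add_left)
    next
      case (add s t)
      then show ?case using ab by (simp add: T.a_ac)
    qed
    show "(a \<otimes>\<^bsub>A\<^esub> b) \<odot>\<^bsub>tensor A M N\<^esub> t = a \<odot>\<^bsub>tensor A M N\<^esub> (b \<odot>\<^bsub>tensor A M N\<^esub> t)"
      using \<open>t \<in> _\<close>
    proof (induction t rule: tensor_induct)
      case (pure x y)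
      then show ?case using ab by (simp add: M.smult_assoc1)
    next
      case (add s t)
      then show ?case using ab by simp
    qed
  next
    fix t assume "t \<in> carrier (tensor A M N)"
    then show "\<one>\<^bsub>A\<^esub> \<odot>\<^bsub>tensor A M N\<^esub> t = t"
      by (induction t rule: tensor_induct) simp_all
  qed simp_all
qed

lemma pure_smult_right:
  assumes "a \<in> carrier A" "x \<in> carrier M" "y \<in> carrier N"
  shows "pure_tensor A M N x (a \<odot>\<^bsub>N\<^esub> y) = a \<odot>\<^bsub>tensor A M N\<^esub> pure_tensor A M N x y"
  using assms by (simp add: tensor_smult_pure pure_balanced)

lemma pure_bilinear: "pure_tensor A M N \<in> bilinear_maps A M N (tensor A M N)"
  unfolding bilinear_maps_def
  by (auto intro!: linear_mapsI simp: pure_add_left pure_add_right pure_smult_right tensor_smult_pure)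

lemma additive_eq_on_tensor:
  assumes "t \<in> carrier (tensor A M N)"
    and h: "h \<in> hom (add_monoid (tensor A M N)) (add_monoid P)"
    and k: "k \<in> hom (add_monoid (tensor A M N)) (add_monoid P)"
    and "\<And>x y. x \<in> carrier M \<Longrightarrow> y \<in> carrier N \<Longrightarrow>
      h (pure_tensor A M N x y) = k (pure_tensor A M N x y)"
  shows "h t = k t"
  using assms(1)
proof (induction t rule: tensor_induct)
  case (add s t)
  then show ?case using hom_mult[OF h] hom_mult[OF k] by simp
qed (rule assms(4))

lemma linear_eq_on_tensor:
  assumes "t \<in> carrier (tensor A M N)"
    and h: "h \<in> linear_maps A (tensor A M N) P"
    and k: "k \<in> linear_maps A (tensor A M N) P"
    and "\<And>x y. x \<in> carrier M \<Longrightarrow> y \<in> carrier N \<Longrightarrow>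
      h (pure_tensor A M N x y) = k (pure_tensor A M N x y)"
  shows "h t = k t"
  using additive_eq_on_tensor[OF assms(1) linear_maps_hom[OF h] linear_maps_hom[OF k] assms(4)] .

text \<open>
  The function \<open>b\<close> extends to the free abelian group on pairs, and bilinearity makes
  the extension kill the defining relations.
\<close>

lemma tensor_universal:
  assumes P: "module A P" and b: "b \<in> bilinear_maps A M N P"
  obtains h where "h \<in> linear_maps A (tensor A M N) P"
    and "h \<in> extensional (carrier (tensor A M N))"
    and "\<And>x y. x \<in> carrier M \<Longrightarrow> y \<in> carrier N \<Longrightarrow> h (pure_tensor A M N x y) = b x y"
proof -
  interpret P: module A P by fact
  interpret T: module A "tensor A M N" by (rule module_tensor)
  note b1 = b[unfolded bilinear_maps_def, simplified]
  have bc: "b x y \<in> carrier P" if "x \<in> carrier M" "y \<in> carrier N" for x y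
  proof -
    from b1 that have "b x \<in> linear_maps A N P" by blast
    then show ?thesis using that(2) by (rule linear_maps_closed)
  qed
  have "case_prod b ` (carrier M \<times> carrier N) \<subseteq> carrier (add_monoid P)"
    using bc by auto
  then obtain \<beta> where \<beta>: "\<beta> \<in> hom FG (add_monoid P)"
    and \<beta>f: "\<And>z. z \<in> carrier M \<times> carrier N \<Longrightarrow> \<beta> (frag_of z) = case_prod b z"
    by (rule comm_group.free_Abelian_group_universal[OF P.M.a_comm_group]) blast
  interpret \<beta>: group_hom FG "add_monoid P" \<beta>
    by (simp add: \<beta> group_hom_axioms_def group_hom_def)
  have \<beta>diff: "\<beta> (u - v) = \<beta> u \<ominus>\<^bsub>P\<^esub> \<beta> v" if "u \<in> carrier FG" "v \<in> carrier FG" for u v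
  proof -
    have "u - v \<in> carrier FG" using that by (auto dest!: subsetD[OF keys_diff])
    then have "\<beta> u = \<beta> (u - v) \<oplus>\<^bsub>P\<^esub> \<beta> v"
      using \<beta>.hom_mult[of "u - v" v] that by simp
    then show ?thesis
      using \<beta>.hom_closed that \<open>u - v \<in> carrier FG\<close> by (simp add: P.M.minus_eq P.M.a_assoc P.M.r_neg)
  qed
  have "tensor_relations A M N \<subseteq> kernel FG (add_monoid P) \<beta>"
  proof
    fix u assume u: "u \<in> tensor_relations A M N"
    have k: "frag_of z \<in> carrier FG" if "z \<in> carrier M \<times> carrier N" for z using that by simp
    have d: "frag_of z - frag_of w \<in> carrier FG" if "z \<in> carrier M \<times> carrier N" "w \<in> carrier M \<times> carrier N" for z w
      using that by (auto dest!: subsetD[OF keys_diff] split: if_splits)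
    have l: "\<And>x. x \<in> carrier M \<Longrightarrow> b x \<in> linear_maps A N P"
       "\<And>y. y \<in> carrier N \<Longrightarrow> (\<lambda>x. b x y) \<in> linear_maps A M P" using b1 by auto
    have "\<beta> u = \<zero>\<^bsub>P\<^esub>"
      using u unfolding tensor_relations_def
      apply (elim UnE CollectE exE conjE)
      subgoal for x x' y
        using linear_maps_add[OF l(2), of y x x'] bc
        by (simp add: \<beta>diff k d \<beta>f P.M.minus_eq P.M.r_neg P.M.a_ac P.M.minus_add P.M.r_neg1 P.M.r_neg2 del: carrier_free_Abelian_group_iff)
      subgoal for x y y'
        using linear_maps_add[OF l(1), of x y y'] bc
        by (simp add: \<beta>diff k d \<beta>f P.M.minus_eq P.M.r_neg P.M.a_ac P.M.minus_add P.M.r_neg1 P.M.r_neg2 del: carrier_free_Abelian_group_iff)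
      subgoal for a x y
        using linear_maps_smult[OF l(1), of x a y] linear_maps_smult[OF l(2), of y a x] bc
        by (simp add: \<beta>diff k d \<beta>f P.M.minus_eq P.M.r_neg del: carrier_free_Abelian_group_iff)
      done
    then show "u \<in> kernel FG (add_monoid P) \<beta>"
      using subsetD[OF tensor_relations_subset u] by (simp add: kernel_def)
  qed
  then have null: "tensor_null A M N \<subseteq> kernel FG (add_monoid P) \<beta>"
    unfolding tensor_null_def
    by (intro group.generate_subgroup_incl \<beta>.subgroup_kernel) auto
  obtain g where g: "g \<in> hom (FG Mod tensor_null A M N) (add_monoid P)"
    and gu: "\<And>u. u \<in> carrier FG \<Longrightarrow> g (tensor_null A M N #>\<^bsub>FG\<^esub> u) = \<beta> u"
    using \<beta>.FactGroup_universal_kernel[OF tensor_null_normal null] by metis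
  have gh: "g \<in> hom (add_monoid (tensor A M N)) (add_monoid P)"
    using g by (simp add: hom_def tensor_fields tensor_group_def)
  have gp: "g (pure_tensor A M N x y) = b x y" if "x \<in> carrier M" "y \<in> carrier N" for x y
    using gu[of "frag_of (x, y)"] that \<beta>f[of "(x, y)"] by (simp add: pure_tensor_def tensor_class_def)
  have gadd: "g (s \<oplus>\<^bsub>tensor A M N\<^esub> t) = g s \<oplus>\<^bsub>P\<^esub> g t"
    if "s \<in> carrier (tensor A M N)" "t \<in> carrier (tensor A M N)" for s t
    using hom_mult[OF gh] that by simp
  have gc: "g t \<in> carrier P" if "t \<in> carrier (tensor A M N)" for t
    using hom_in_carrier[OF gh] that by simp
  have gs: "g (a \<odot>\<^bsub>tensor A M N\<^esub> t) = a \<odot>\<^bsub>P\<^esub> g t"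
    if a: "a \<in> carrier A" and t: "t \<in> carrier (tensor A M N)" for a t
    using t
  proof (induction t rule: tensor_induct)
    case (pure x y)
    have "b (a \<odot>\<^bsub>M\<^esub> x) y = a \<odot>\<^bsub>P\<^esub> b x y"
      using b1 pure a linear_maps_smult[of "\<lambda>x. b x y" A M P a x] by simp
    then show ?case using pure a by (simp add: tensor_smult_pure gp)
  next
    case (add s t)
    then show ?case using a by (simp add: T.smult_r_distr gadd P.smult_r_distr gc)
  qed
  have "g \<in> linear_maps A (tensor A M N) P"
    by (rule linear_mapsI) (simp_all add: gc gadd gs)
  then have "restrict g (carrier (tensor A M N)) \<in> linear_maps A (tensor A M N) P"
    by (rule linear_maps_cong[OF module_tensor]) simp
  then show ?thesis
    by (rule that) (simp_all add: gp)
qed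

text \<open>
  A linear map is determined by its values on pure tensors, which gives the uniqueness that the
  definite description in the definition of the lift requires.
\<close>

lemma
  assumes P: "module A P" and b: "b \<in> bilinear_maps A M N P"
  shows tensor_lift_linear: "tensor_lift A M N P b \<in> linear_maps A (tensor A M N) P" (is ?lin)
    and tensor_lift_pure: "\<And>x y. x \<in> carrier M \<Longrightarrow> y \<in> carrier N \<Longrightarrow>
      tensor_lift A M N P b (pure_tensor A M N x y) = b x y"
proof -
  let ?Q = "\<lambda>h. h \<in> linear_maps A (tensor A M N) P \<and> h \<in> extensional (carrier (tensor A M N)) \<and>
        (\<forall>x \<in> carrier M. \<forall>y \<in> carrier N. h (pure_tensor A M N x y) = b x y)"
  obtain h where h: "?Q h" using tensor_universal[OF assms] by metis
  have "k = h" if k: "?Q k" for k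
  proof (rule extensionalityI[of _ "carrier (tensor A M N)"])
    fix t assume "t \<in> carrier (tensor A M N)"
    then show "k t = h t"
      by (rule linear_eq_on_tensor[where P = P]) (use h k in simp_all)
  qed (use h k in simp_all)
  with h have "tensor_lift A M N P b = h"
    unfolding tensor_lift_def by (rule the_equality)
  with h show ?lin and "\<And>x y. x \<in> carrier M \<Longrightarrow> y \<in> carrier N \<Longrightarrow>
      tensor_lift A M N P b (pure_tensor A M N x y) = b x y" by auto
qed

end

section \<open>Additive subgroups\<close>

lemma additive_subgroup_finsum:
  assumes "abelian_group M" "additive_subgroup H M" "finite J" "\<And>j. j \<in> J \<Longrightarrow> f j \<in> H"
  shows "finsum M f J \<in> H"
proof -
  interpret abelian_group M by fact
  interpret additive_subgroup H M by fact
  note [simp] = subsetD[OF a_subset]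
  from assms(3,4) show ?thesis
    by (induction J rule: finite_induct) (simp_all add: finsum_insert Pi_iff)
qed

lemma additive_subgroup_generate:
  assumes "abelian_group M" "S \<subseteq> carrier M"
  shows "additive_subgroup (generate (add_monoid M) S) M"
  using assms group.generate_is_subgroup[of "add_monoid M" S]
  by (simp add: additive_subgroup_def abelian_group.a_group)

lemma generate_subset_additive_subgroup:
  assumes "abelian_group M" "additive_subgroup H M" "S \<subseteq> H"
  shows "generate (add_monoid M) S \<subseteq> H"
  using assms group.generate_subgroup_incl[of "add_monoid M" S H]
  by (simp add: additive_subgroup_def abelian_group.a_group)

lemma additive_subgroup_preimage:
  assumes "abelian_group M" "abelian_group N" "h \<in> hom (add_monoid M) (add_monoid N)" "additive_subgroup K N"
  shows "additive_subgroup {x \<in> carrier M. h x \<in> K} M"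
proof -
  interpret M: abelian_group M by fact
  interpret N: abelian_group N by fact
  interpret K: additive_subgroup K N by fact
  interpret h: group_hom "add_monoid M" "add_monoid N" h
    by (simp add: group_hom_def group_hom_axioms_def assms(3) M.a_group N.a_group)
  show ?thesis
  proof (rule additive_subgroupI, rule M.add.subgroupI)
    have "h \<zero>\<^bsub>M\<^esub> \<in> K" using h.hom_one K.zero_closed by simp
    then show "{x \<in> carrier M. h x \<in> K} \<noteq> {}" using M.zero_closed by blast
    fix x assume "x \<in> {x \<in> carrier M. h x \<in> K}"
    then show "\<ominus>\<^bsub>M\<^esub> x \<in> {x \<in> carrier M. h x \<in> K}"
      using h.hom_inv[of x] by (simp flip: a_inv_def)
    fix y assume "y \<in> {x \<in> carrier M. h x \<in> K}"
    with \<open>x \<in> _\<close> show "x \<oplus>\<^bsub>M\<^esub> y \<in> {x \<in> carrier M. h x \<in> K}"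
      using h.hom_mult[of x y] by simp
  qed auto
qed

lemma additive_subgroup_zero:
  assumes "abelian_group M" shows "additive_subgroup {\<zero>\<^bsub>M\<^esub>} M"
  using group.triv_subgroup[OF abelian_group.a_group[OF assms]]
  by (simp add: additive_subgroup_def)

section \<open>Homogeneous components\<close>

definition component :: "('b, 'z) ring_scheme \<Rightarrow> (int \<Rightarrow> 'b set) \<Rightarrow> 'b \<Rightarrow> int \<Rightarrow> 'b" where
  "component M D x = (THE c. (\<forall>n. c n \<in> D n) \<and> finite {n. c n \<noteq> \<zero>\<^bsub>M\<^esub>} \<and>
     x = finsum M c {n. c n \<noteq> \<zero>\<^bsub>M\<^esub>})"

locale direct_sum = abelian_group M
  for M :: "('b, 'z) ring_scheme" (structure) and D :: "int \<Rightarrow> 'b set" +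
  assumes decomposition: "internal_direct_sum M D"
begin

lemma additive_subgroup_D: "additive_subgroup (D n) M"
  using decomposition by (simp add: internal_direct_sum_def)

lemma D_carrier: "x \<in> D n \<Longrightarrow> x \<in> carrier M"
  using additive_subgroup.a_subset[OF additive_subgroup_D] by blast

lemma D_zero [simp]: "\<zero> \<in> D n"
  using additive_subgroup.zero_closed[OF additive_subgroup_D] .

lemma D_add: "x \<in> D n \<Longrightarrow> y \<in> D n \<Longrightarrow> x \<oplus> y \<in> D n"
  using additive_subgroup.a_closed[OF additive_subgroup_D] .

text \<open>
  The index set \<open>J\<close> may be larger than the support, so components of sums can be computed over a
  common index set.
\<close>

lemma component_unique:
  assumes c: "\<And>n. c n \<in> D n" and J: "finite J" "\<And>n. n \<notin> J \<Longrightarrow> c n = \<zero>"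
    and x: "x = finsum M c J"
  shows "component M D x = c"
proof -
  have sub: "{n. c n \<noteq> \<zero>} \<subseteq> J" using J by blast
  have "finsum M c {n. c n \<noteq> \<zero>} = finsum M c J"
    using c D_carrier J(1) sub by (intro add.finprod_mono_neutral_cong_left) auto
  moreover have "x \<in> carrier M" using x c D_carrier finsum_closed[of c J] by blast
  ultimately show ?thesis
    using decomposition c finite_subset[OF sub J(1)] x
    unfolding component_def internal_direct_sum_def
    by (intro the1_equality) auto
qed

lemma
  assumes "x \<in> carrier M"
  shows component_in: "component M D x n \<in> D n"
    and finite_support: "finite {n. component M D x n \<noteq> \<zero>}"
    and sum_components: "finsum M (component M D x) {n. component M D x n \<noteq> \<zero>} = x"
proof -
  have "\<exists>!c. (\<forall>n. c n \<in> D n) \<and> finite {n. c n \<noteq> \<zero>} \<and> x = finsum M c {n. c n \<noteq> \<zero>}"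
    using decomposition assms by (simp add: internal_direct_sum_def)
  from theI'[OF this, folded component_def]
  show "component M D x n \<in> D n" "finite {n. component M D x n \<noteq> \<zero>}"
    "finsum M (component M D x) {n. component M D x n \<noteq> \<zero>} = x" by simp_all
qed

lemma component_carrier [simp]: "x \<in> carrier M \<Longrightarrow> component M D x n \<in> carrier M"
  using component_in D_carrier by blast

lemma sum_components_superset:
  assumes "x \<in> carrier M" "finite J" "\<And>n. n \<notin> J \<Longrightarrow> component M D x n = \<zero>"
  shows "finsum M (component M D x) J = x"
proof -
  have "finsum M (component M D x) {n. component M D x n \<noteq> \<zero>} = finsum M (component M D x) J"
    using assms by (intro add.finprod_mono_neutral_cong_left) auto
  then show ?thesis using sum_components assms by simp
qed

lemma component_homogeneous:
  assumes "x \<in> D n"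
  shows "component M D x k = (if k = n then x else \<zero>)"
proof -
  have "component M D x = (\<lambda>k. if k = n then x else \<zero>)"
    by (rule component_unique[of _ "{n}"]) (use assms D_carrier in \<open>auto simp: finsum_insert\<close>)
  then show ?thesis by simp
qed

lemma component_add:
  assumes "x \<in> carrier M" "y \<in> carrier M"
  shows "component M D (x \<oplus> y) n = component M D x n \<oplus> component M D y n"
proof -
  let ?J = "{n. component M D x n \<noteq> \<zero>} \<union> {n. component M D y n \<noteq> \<zero>}"
  have J: "finite ?J" using assms finite_support by auto
  have "x \<oplus> y = finsum M (component M D x) ?J \<oplus> finsum M (component M D y) ?J"
    using assms J by (subst (1 2) sum_components_superset) auto
  also have "\<dots> = finsum M (\<lambda>n. component M D x n \<oplus> component M D y n) ?J"
    using assms by (simp add: finsum_addf Pi_iff)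
  finally have "component M D (x \<oplus> y) = (\<lambda>n. component M D x n \<oplus> component M D y n)"
    by (intro component_unique[OF _ J]) (use assms component_in D_add in auto)
  then show ?thesis by simp
qed

lemma homogeneous_induct [consumes 1, case_names homogeneous add]:
  assumes x: "x \<in> carrier M"
    and hom: "\<And>n x. x \<in> D n \<Longrightarrow> P x"
    and add: "\<And>x y. x \<in> carrier M \<Longrightarrow> y \<in> carrier M \<Longrightarrow> P x \<Longrightarrow> P y \<Longrightarrow> P (x \<oplus> y)"
  shows "P x"
proof -
  have "P (finsum M (component M D x) J)" if "finite J" for J
    using that
  proof (induction J rule: finite_induct)
    case empty
    then show ?case using hom[OF D_zero] by simp
  next
    case (insert n J)
    then show ?case
      using x by (simp add: finsum_insert Pi_iff add hom[OF component_in] finsum_closed)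
  qed
  then show ?thesis using sum_components finite_support x by metis
qed

lemma generate_homogeneous: "generate (add_monoid M) (\<Union>n. D n) = carrier M"
proof
  have sub: "(\<Union>n. D n) \<subseteq> carrier M" using D_carrier by blast
  interpret H: additive_subgroup "generate (add_monoid M) (\<Union>n. D n)" M
    by (rule additive_subgroup_generate[OF abelian_group_axioms sub])
  show "generate (add_monoid M) (\<Union>n. D n) \<subseteq> carrier M" by (rule H.a_subset)
  show "carrier M \<subseteq> generate (add_monoid M) (\<Union>n. D n)"
  proof
    fix x assume "x \<in> carrier M"
    then show "x \<in> generate (add_monoid M) (\<Union>n. D n)"
      by (induction x rule: homogeneous_induct) (auto intro: generate.incl)
  qed
qed

end

lemma (in graded_module) graded_direct_sum: "direct_sum M (grade M)"
  by (intro direct_sum.intro direct_sum_axioms.intro direct_sum M.abelian_group_axioms)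

sublocale graded_module \<subseteq> gr: direct_sum M "grade M"
  by (rule graded_direct_sum)

context graded_module
begin

lemma component_smult:
  assumes a: "a \<in> carrier A" and x: "x \<in> carrier M"
  shows "component M (grade M) (a \<odot>\<^bsub>M\<^esub> x) n = a \<odot>\<^bsub>M\<^esub> component M (grade M) x n"
  using x
proof (induction x rule: gr.homogeneous_induct)
  case (homogeneous k x)
  then show ?case
    using a smult_grade[OF a homogeneous] by (simp add: gr.component_homogeneous)
next
  case (add x y)
  then show ?case using a by (simp add: smult_r_distr gr.component_add)
qed

lemma component_linear: "(\<lambda>x. component M (grade M) x n) \<in> linear_maps A M M"
  by (rule linear_mapsI) (simp_all add: gr.component_add component_smult)

end

section \<open>Functoriality of the tensor product\<close>

lemma module_base_module:
  assumes "cring A" shows "module A (base_module A)"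
proof -
  interpret A: cring A by fact
  have "abelian_group (base_module A)"
    by (rule abelian_groupI) (auto simp: base_module_def A.a_ac intro: A.r_neg)
  then show ?thesis
    using assms by (intro moduleI) (simp_all add: base_module_def A.l_distr A.r_distr A.m_assoc)
qed

lemma base_module_simps [simp]:
  "carrier (base_module A) = carrier A" "add (base_module A) = add A"
  "\<zero>\<^bsub>base_module A\<^esub> = \<zero>\<^bsub>A\<^esub>" "smult (base_module A) = monoid.mult A"
  by (simp_all add: base_module_def)

context module_pair
begin

lemma
  assumes "module_pair A M' N'" and f: "f \<in> linear_maps A M M'" and g: "g \<in> linear_maps A N N'"
  shows tensor_map_linear: "tensor_map A M N M' N' f g \<in> linear_maps A (tensor A M N) (tensor A M' N')"
    and tensor_map_pure: "x \<in> carrier M \<Longrightarrow> y \<in> carrier N \<Longrightarrow>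
      tensor_map A M N M' N' f g (pure_tensor A M N x y) = pure_tensor A M' N' (f x) (g y)"
proof -
  interpret T': module_pair A M' N' by fact
  have "(\<lambda>x y. pure_tensor A M' N' (f x) (g y)) \<in> bilinear_maps A M N (tensor A M' N')"
    using linear_maps_closed[OF f] linear_maps_closed[OF g]
    by (auto simp: bilinear_maps_def linear_maps_add[OF f] linear_maps_add[OF g]
        linear_maps_smult[OF f] linear_maps_smult[OF g] T'.pure_add_left T'.pure_add_right
        T'.pure_smult_right T'.tensor_smult_pure intro!: linear_mapsI)
  from tensor_lift_linear[OF T'.module_tensor this] tensor_lift_pure[OF T'.module_tensor this]
  show "tensor_map A M N M' N' f g \<in> linear_maps A (tensor A M N) (tensor A M' N')"
    "x \<in> carrier M \<Longrightarrow> y \<in> carrier N \<Longrightarrow>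
      tensor_map A M N M' N' f g (pure_tensor A M N x y) = pure_tensor A M' N' (f x) (g y)"
    by (simp_all add: tensor_map_def)
qed

end

lemma
  assumes "module A M"
  shows tensor_right_unit_linear: "tensor_right_unit A M \<in> linear_maps A (tensor A M (base_module A)) M"
    and tensor_right_unit_pure: "x \<in> carrier M \<Longrightarrow> a \<in> carrier A \<Longrightarrow>
      tensor_right_unit A M (pure_tensor A M (base_module A) x a) = a \<odot>\<^bsub>M\<^esub> x"
proof -
  interpret M: module A M by fact
  interpret B: module_pair A M "base_module A"
    by (intro module_pair.intro assms module_base_module M.R.is_cring)
  have "(\<lambda>x a. a \<odot>\<^bsub>M\<^esub> x) \<in> bilinear_maps A M (base_module A) M"
    by (auto simp: bilinear_maps_def M.smult_l_distr M.smult_r_distr M.R.m_comm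
        simp flip: M.smult_assoc1 intro!: linear_mapsI)
  from B.tensor_lift_linear[OF assms this] B.tensor_lift_pure[OF assms this]
  show "tensor_right_unit A M \<in> linear_maps A (tensor A M (base_module A)) M"
    "x \<in> carrier M \<Longrightarrow> a \<in> carrier A \<Longrightarrow>
      tensor_right_unit A M (pure_tensor A M (base_module A) x a) = a \<odot>\<^bsub>M\<^esub> x"
    by (simp_all add: tensor_right_unit_def)
qed

lemma
  assumes "module A M"
  shows tensor_left_unit_linear: "tensor_left_unit A M \<in> linear_maps A (tensor A (base_module A) M) M"
    and tensor_left_unit_pure: "a \<in> carrier A \<Longrightarrow> x \<in> carrier M \<Longrightarrow>
      tensor_left_unit A M (pure_tensor A (base_module A) M a x) = a \<odot>\<^bsub>M\<^esub> x"
proof -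
  interpret M: module A M by fact
  interpret B: module_pair A "base_module A" M
    by (intro module_pair.intro assms module_base_module M.R.is_cring)
  have "(\<lambda>a x. a \<odot>\<^bsub>M\<^esub> x) \<in> bilinear_maps A (base_module A) M M"
    by (auto simp: bilinear_maps_def M.smult_l_distr M.smult_r_distr M.R.m_comm
        simp flip: M.smult_assoc1 intro!: linear_mapsI)
  from B.tensor_lift_linear[OF assms this] B.tensor_lift_pure[OF assms this]
  show "tensor_left_unit A M \<in> linear_maps A (tensor A (base_module A) M) M"
    "a \<in> carrier A \<Longrightarrow> x \<in> carrier M \<Longrightarrow>
      tensor_left_unit A M (pure_tensor A (base_module A) M a x) = a \<odot>\<^bsub>M\<^esub> x"
    by (simp_all add: tensor_left_unit_def)
qed

text \<open>
  The inner lift is linear in its tensor argument by construction.  Its linearity in the element \<open>z\<close>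
  of the third factor is what makes the outer lift defined, and is checked on pure tensors.
\<close>

lemma
  assumes "module A M" "module A N" "module A P"
  shows tensor_assoc_linear: "tensor_assoc A M N P \<in>
      linear_maps A (tensor A (tensor A M N) P) (tensor A M (tensor A N P))"
    and tensor_assoc_pure: "x \<in> carrier M \<Longrightarrow> y \<in> carrier N \<Longrightarrow> z \<in> carrier P \<Longrightarrow>
      tensor_assoc A M N P (pure_tensor A (tensor A M N) P (pure_tensor A M N x y) z) =
      pure_tensor A M (tensor A N P) x (pure_tensor A N P y z)"
proof -
  interpret MN: module_pair A M N by (intro module_pair.intro assms)
  interpret NP: module_pair A N P by (intro module_pair.intro assms)
  interpret L: module_pair A "tensor A M N" P by (intro module_pair.intro assms MN.module_tensor)
  interpret R: module_pair A M "tensor A N P" by (intro module_pair.intro assms NP.module_tensor)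
  interpret RM: module A "tensor A M (tensor A N P)" by (rule R.module_tensor)
  let ?b = "\<lambda>z x y. pure_tensor A M (tensor A N P) x (pure_tensor A N P y z)"
  let ?l = "\<lambda>t z. tensor_lift A M N (tensor A M (tensor A N P)) (?b z) t"
  have b: "?b z \<in> bilinear_maps A M N (tensor A M (tensor A N P))" if "z \<in> carrier P" for z
    using that
    by (auto simp: bilinear_maps_def NP.pure_add_left NP.tensor_smult_pure[symmetric] R.pure_add_left
        R.pure_add_right R.pure_smult_right R.tensor_smult_pure intro!: linear_mapsI)
  have lin: "(\<lambda>t. ?l t z) \<in> linear_maps A (tensor A M N) (tensor A M (tensor A N P))"
    if "z \<in> carrier P" for z
    by (rule MN.tensor_lift_linear[OF R.module_tensor b[OF that]])
  have pur: "?l (pure_tensor A M N x y) z = ?b z x y"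
    if "z \<in> carrier P" "x \<in> carrier M" "y \<in> carrier N" for x y z
    by (rule MN.tensor_lift_pure[OF R.module_tensor b[OF that(1)] that(2,3)])
  have clo: "?l t z \<in> carrier (tensor A M (tensor A N P))"
    if "z \<in> carrier P" "t \<in> carrier (tensor A M N)" for t z
    using linear_maps_closed[OF lin] that by blast
  have "?l t (z \<oplus>\<^bsub>P\<^esub> z') = ?l t z \<oplus>\<^bsub>tensor A M (tensor A N P)\<^esub> ?l t z'"
    if "z \<in> carrier P" "z' \<in> carrier P" "t \<in> carrier (tensor A M N)" for t z z'
    using that(3)
  proof (induction t rule: MN.tensor_induct)
    case (pure x y)
    then show ?case using that by (simp add: pur NP.pure_add_right R.pure_add_right)
  next
    case (add s t)
    then show ?case using that
      by (simp add: linear_maps_add[OF lin] clo RM.M.a_ac)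
  qed
  moreover have "?l t (a \<odot>\<^bsub>P\<^esub> z) = a \<odot>\<^bsub>tensor A M (tensor A N P)\<^esub> ?l t z"
    if "z \<in> carrier P" "a \<in> carrier A" "t \<in> carrier (tensor A M N)" for t z a
    using that(3)
  proof (induction t rule: MN.tensor_induct)
    case (pure x y)
    then show ?case using that by (simp add: pur NP.pure_smult_right R.pure_smult_right)
  next
    case (add s t)
    then show ?case using that
      by (simp add: linear_maps_add[OF lin] clo RM.smult_r_distr)
  qed
  ultimately have bil: "?l \<in> bilinear_maps A (tensor A M N) P (tensor A M (tensor A N P))"
    using lin clo unfolding bilinear_maps_def by (auto intro!: linear_mapsI)
  show "tensor_assoc A M N P \<in>
      linear_maps A (tensor A (tensor A M N) P) (tensor A M (tensor A N P))"
    unfolding tensor_assoc_def by (rule L.tensor_lift_linear[OF R.module_tensor bil])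
  show "tensor_assoc A M N P (pure_tensor A (tensor A M N) P (pure_tensor A M N x y) z) =
      pure_tensor A M (tensor A N P) x (pure_tensor A N P y z)"
    if "x \<in> carrier M" "y \<in> carrier N" "z \<in> carrier P"
    using L.tensor_lift_pure[OF R.module_tensor bil, of "pure_tensor A M N x y" z] that
    by (simp add: tensor_assoc_def pur)
qed

text \<open>
  This is \<open>id \<otimes> f\<close> followed by the isomorphism of \<open>M \<otimes> A\<close> with \<open>M\<close>.  At \<open>t = \<rho> x\<close>, for a
  coaction \<open>\<rho>\<close>, it is the action of \<open>f\<close> on \<open>x\<close>.
\<close>

definition slice ::
  "('a, 'r) ring_scheme \<Rightarrow> ('a, 'b, 'y) gmodule_scheme \<Rightarrow> ('a, 'c, 'z) gmodule_scheme \<Rightarrow>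
     ('c \<Rightarrow> 'a) \<Rightarrow> ('b \<times> 'c \<Rightarrow>\<^sub>0 int) set \<Rightarrow> 'b" where
  "slice A M C f t = tensor_right_unit A M (tensor_map A M C M (base_module A) id f t)"

context module_pair
begin

lemma
  assumes f: "f \<in> linear_maps A N (base_module A)"
  shows slice_linear: "slice A M N f \<in> linear_maps A (tensor A M N) M"
    and slice_pure: "x \<in> carrier M \<Longrightarrow> y \<in> carrier N \<Longrightarrow>
      slice A M N f (pure_tensor A M N x y) = f y \<odot>\<^bsub>M\<^esub> x"
proof -
  have MB: "module_pair A M (base_module A)"
    by (intro module_pair.intro M.module_axioms module_base_module M.R.is_cring)
  have "(\<lambda>t. tensor_right_unit A M (tensor_map A M N M (base_module A) id f t))
      \<in> linear_maps A (tensor A M N) M"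
    by (rule linear_maps_compose[OF tensor_map_linear[OF MB linear_maps_id f]
      tensor_right_unit_linear[OF M.module_axioms]])
  then show "slice A M N f \<in> linear_maps A (tensor A M N) M"
    by (simp add: slice_def[abs_def])
  show "slice A M N f (pure_tensor A M N x y) = f y \<odot>\<^bsub>M\<^esub> x"
    if "x \<in> carrier M" "y \<in> carrier N"
    using that linear_maps_closed[OF f that(2)]
    by (simp add: slice_def tensor_map_pure[OF MB linear_maps_id f]
        tensor_right_unit_pure[OF M.module_axioms])
qed

end

section \<open>Homogeneous dual bases\<close>

text \<open>
  The free module on \<open>B\<close>.
\<close>

definition finitely_supported :: "('a, 'r) ring_scheme \<Rightarrow> 'c set \<Rightarrow> ('a, 'c \<Rightarrow> 'a) module" where
  "finitely_supported A B =
     \<lparr>carrier = {u. (\<forall>c. u c \<in> carrier A) \<and> finite {c. u c \<noteq> \<zero>\<^bsub>A\<^esub>} \<and> {c. u c \<noteq> \<zero>\<^bsub>A\<^esub>} \<subseteq> B},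
      monoid.mult = undefined, monoid.one = undefined,
      ring.zero = (\<lambda>c. \<zero>\<^bsub>A\<^esub>), ring.add = (\<lambda>u v c. u c \<oplus>\<^bsub>A\<^esub> v c),
      smult = (\<lambda>a u c. a \<otimes>\<^bsub>A\<^esub> u c)\<rparr>"

lemma module_finitely_supported:
  fixes A :: "('a, 'r) ring_scheme" and B :: "'c set"
  assumes "cring A" shows "module A (finitely_supported A B)"
proof -
  interpret A: cring A by fact
  have memI: "u \<in> carrier (finitely_supported A B)"
    if "\<And>c. u c \<in> carrier A" "{c. u c \<noteq> \<zero>\<^bsub>A\<^esub>} \<subseteq> S" "finite S" "S \<subseteq> B" for u S
    using that finite_subset[OF that(2,3)] by (auto simp: finitely_supported_def)
  have memD: "\<And>c. u c \<in> carrier A" "finite {c. u c \<noteq> \<zero>\<^bsub>A\<^esub>}" "{c. u c \<noteq> \<zero>\<^bsub>A\<^esub>} \<subseteq> B"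
    if "u \<in> carrier (finitely_supported A B)" for u
    using that by (auto simp: finitely_supported_def)
  have ops: "\<And>u v c. (u \<oplus>\<^bsub>finitely_supported A B\<^esub> v) c = u c \<oplus>\<^bsub>A\<^esub> v c"
    "\<And>c. \<zero>\<^bsub>finitely_supported A B\<^esub> c = \<zero>\<^bsub>A\<^esub>"
    "\<And>a u c. (a \<odot>\<^bsub>finitely_supported A B\<^esub> u) c = a \<otimes>\<^bsub>A\<^esub> u c"
    by (simp_all add: finitely_supported_def)
  have "abelian_group (finitely_supported A B)"
  proof (rule abelian_groupI)
    fix u assume u: "u \<in> carrier (finitely_supported A B)"
    show "\<exists>v \<in> carrier (finitely_supported A B).
        v \<oplus>\<^bsub>finitely_supported A B\<^esub> u = \<zero>\<^bsub>finitely_supported A B\<^esub>"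
    proof
      show "(\<lambda>c. \<ominus>\<^bsub>A\<^esub> u c) \<in> carrier (finitely_supported A B)"
        by (rule memI[OF _ _ memD(2,3)[OF u]]) (auto simp: memD(1)[OF u])
    qed (auto simp: ops memD(1)[OF u] A.l_neg fun_eq_iff)
    show "\<zero>\<^bsub>finitely_supported A B\<^esub> \<oplus>\<^bsub>finitely_supported A B\<^esub> u = u"
      by (simp add: ops memD(1)[OF u] fun_eq_iff)
  next
    fix u v assume u: "u \<in> carrier (finitely_supported A B)" and v: "v \<in> carrier (finitely_supported A B)"
    show "u \<oplus>\<^bsub>finitely_supported A B\<^esub> v \<in> carrier (finitely_supported A B)"
      using memD(2,3)[OF u] memD(2,3)[OF v]
      by (intro memI[of _ "{c. u c \<noteq> \<zero>\<^bsub>A\<^esub>} \<union> {c. v c \<noteq> \<zero>\<^bsub>A\<^esub>}"])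
        (auto simp: ops memD(1)[OF u] memD(1)[OF v])
    show "u \<oplus>\<^bsub>finitely_supported A B\<^esub> v = v \<oplus>\<^bsub>finitely_supported A B\<^esub> u"
      using memD(1)[OF u] memD(1)[OF v] by (simp add: ops fun_eq_iff A.a_comm)
    fix w assume w: "w \<in> carrier (finitely_supported A B)"
    show "u \<oplus>\<^bsub>finitely_supported A B\<^esub> v \<oplus>\<^bsub>finitely_supported A B\<^esub> w =
        u \<oplus>\<^bsub>finitely_supported A B\<^esub> (v \<oplus>\<^bsub>finitely_supported A B\<^esub> w)"
      using memD(1)[OF u] memD(1)[OF v] memD(1)[OF w] by (simp add: ops fun_eq_iff A.a_assoc)
  next
    show "\<zero>\<^bsub>finitely_supported A B\<^esub> \<in> carrier (finitely_supported A B)"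
      by (rule memI[of _ "{}"]) (auto simp: ops)
  qed
  then show ?thesis
  proof (rule moduleI[OF assms])
    fix a u assume a: "a \<in> carrier A" and u: "u \<in> carrier (finitely_supported A B)"
    show "a \<odot>\<^bsub>finitely_supported A B\<^esub> u \<in> carrier (finitely_supported A B)"
      by (rule memI[OF _ _ memD(2,3)[OF u]]) (auto simp: ops a memD(1)[OF u])
  qed (simp_all add: ops memD(1) fun_eq_iff A.l_distr A.r_distr A.m_assoc)
qed

text \<open>
  The functions \<open>\<phi> c\<close> are the coordinates of a splitting of the surjection from the free module on
  the carrier of \<open>C\<close> to \<open>C\<close>.
\<close>

lemma projective_dual_basis:
  fixes C :: "('a, 'c, 'z) module_scheme"
  assumes "projective_module A C"
  obtains \<phi> :: "'c \<Rightarrow> 'c \<Rightarrow> 'a" where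
    "\<And>c. c \<in> carrier C \<Longrightarrow> \<phi> c \<in> linear_maps A C (base_module A)"
    "\<And>x. x \<in> carrier C \<Longrightarrow> finite {c. \<phi> c x \<noteq> \<zero>\<^bsub>A\<^esub>} \<and> {c. \<phi> c x \<noteq> \<zero>\<^bsub>A\<^esub>} \<subseteq> carrier C \<and>
       finsum C (\<lambda>c. \<phi> c x \<odot>\<^bsub>C\<^esub> c) {c. \<phi> c x \<noteq> \<zero>\<^bsub>A\<^esub>} = x"
proof -
  interpret C: module A C using assms by (simp add: projective_module_def)
  define F where "F = finitely_supported A (carrier C)"
  interpret F: module A F unfolding F_def by (rule module_finitely_supported[OF C.R.is_cring])
  \<comment> \<open>The target of a lifting problem is a module record without further fields.\<close>
  define C' :: "('a, 'c) module" where
    "C' = \<lparr>carrier = carrier C, monoid.mult = monoid.mult C, monoid.one = \<one>\<^bsub>C\<^esub>,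
      ring.zero = \<zero>\<^bsub>C\<^esub>, ring.add = add C, smult = smult C\<rparr>"
  have "abelian_group C'"
    by (rule abelian_groupI) (auto simp: C'_def C.M.a_ac intro: C.M.r_neg)
  then have C': "module A C'"
    by (intro moduleI C.R.is_cring)
      (simp_all add: C'_def C.smult_l_distr C.smult_r_distr C.smult_assoc1)
  define \<pi> where "\<pi> u = finsum C (\<lambda>c. u c \<odot>\<^bsub>C\<^esub> c) {c. u c \<noteq> \<zero>\<^bsub>A\<^esub>}" for u
  have F: "finite {c. u c \<noteq> \<zero>\<^bsub>A\<^esub>}" "{c. u c \<noteq> \<zero>\<^bsub>A\<^esub>} \<subseteq> carrier C" "\<And>c. u c \<in> carrier A"
    if "u \<in> carrier F" for u
    using that by (auto simp: F_def finitely_supported_def)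
  have \<pi>J: "\<pi> u = finsum C (\<lambda>c. u c \<odot>\<^bsub>C\<^esub> c) J"
    if "u \<in> carrier F" "finite J" "{c. u c \<noteq> \<zero>\<^bsub>A\<^esub>} \<subseteq> J" "J \<subseteq> carrier C" for u J
    unfolding \<pi>_def using that F[OF that(1)]
    by (intro C.M.add.finprod_mono_neutral_cong_left) auto
  have "\<pi> \<in> linear_maps A F C'"
  proof (rule linear_mapsI)
    fix u assume u: "u \<in> carrier F"
    from F[OF u] show "\<pi> u \<in> carrier C'"
      by (auto simp: \<pi>_def C'_def intro!: C.M.finsum_closed)
    fix a assume a: "a \<in> carrier A"
    from a u have au: "a \<odot>\<^bsub>F\<^esub> u \<in> carrier F" by simp
    have "{c. (a \<odot>\<^bsub>F\<^esub> u) c \<noteq> \<zero>\<^bsub>A\<^esub>} \<subseteq> {c. u c \<noteq> \<zero>\<^bsub>A\<^esub>}"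
      using a by (auto simp: F_def finitely_supported_def)
    from \<pi>J[OF au F(1)[OF u] this F(2)[OF u]]
    have "\<pi> (a \<odot>\<^bsub>F\<^esub> u) = finsum C (\<lambda>c. a \<odot>\<^bsub>C\<^esub> (u c \<odot>\<^bsub>C\<^esub> c)) {c. u c \<noteq> \<zero>\<^bsub>A\<^esub>}"
      apply simp
      using a F(2,3)[OF u] by (intro C.M.finsum_cong')
        (auto simp: F_def finitely_supported_def C.smult_assoc1)
    also have "\<dots> = a \<odot>\<^bsub>C\<^esub> \<pi> u"
      unfolding \<pi>_def using a F[OF u]
      by (intro hom_finsum[symmetric, of C C "\<lambda>x. a \<odot>\<^bsub>C\<^esub> x"] C.M.abelian_group_axioms)
        (auto simp: hom_def C.smult_r_distr)
    finally show "\<pi> (a \<odot>\<^bsub>F\<^esub> u) = a \<odot>\<^bsub>C'\<^esub> \<pi> u" by (simp add: C'_def)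
  next
    fix u v assume uv: "u \<in> carrier F" "v \<in> carrier F"
    let ?J = "{c. u c \<noteq> \<zero>\<^bsub>A\<^esub>} \<union> {c. v c \<noteq> \<zero>\<^bsub>A\<^esub>}"
    have J: "finite ?J" "?J \<subseteq> carrier C" using F uv by auto
    have "{c. (u \<oplus>\<^bsub>F\<^esub> v) c \<noteq> \<zero>\<^bsub>A\<^esub>} \<subseteq> ?J"
      by (auto simp: F_def finitely_supported_def)
    with uv J have "\<pi> (u \<oplus>\<^bsub>F\<^esub> v) = finsum C (\<lambda>c. (u \<oplus>\<^bsub>F\<^esub> v) c \<odot>\<^bsub>C\<^esub> c) ?J"
      by (intro \<pi>J) auto
    also have "\<dots> = finsum C (\<lambda>c. u c \<odot>\<^bsub>C\<^esub> c \<oplus>\<^bsub>C\<^esub> v c \<odot>\<^bsub>C\<^esub> c) ?J"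
      using J(2) F(3)[OF uv(1)] F(3)[OF uv(2)]
      by (intro C.M.finsum_cong') (auto simp: F_def finitely_supported_def C.smult_l_distr)
    also have "\<dots> = finsum C (\<lambda>c. u c \<odot>\<^bsub>C\<^esub> c) ?J \<oplus>\<^bsub>C\<^esub> finsum C (\<lambda>c. v c \<odot>\<^bsub>C\<^esub> c) ?J"
      using J(2) F(3)[OF uv(1)] F(3)[OF uv(2)]
      by (intro C.M.finsum_addf) auto
    also have "\<dots> = \<pi> u \<oplus>\<^bsub>C\<^esub> \<pi> v"
      using uv J by (subst (1 2) \<pi>J) auto
    finally show "\<pi> (u \<oplus>\<^bsub>F\<^esub> v) = \<pi> u \<oplus>\<^bsub>C'\<^esub> \<pi> v" by (simp add: C'_def)
  qed
  moreover have "\<pi> ` carrier F = carrier C'"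
  proof
    show "\<pi> ` carrier F \<subseteq> carrier C'"
      using linear_maps_closed[OF \<open>\<pi> \<in> linear_maps A F C'\<close>] by blast
    show "carrier C' \<subseteq> \<pi> ` carrier F"
    proof
      fix x assume "x \<in> carrier C'"
      then have x: "x \<in> carrier C" by (simp add: C'_def)
      let ?u = "\<lambda>c. if c = x then \<one>\<^bsub>A\<^esub> else \<zero>\<^bsub>A\<^esub>"
      have sub: "{c. ?u c \<noteq> \<zero>\<^bsub>A\<^esub>} \<subseteq> {x}" by auto
      have u: "?u \<in> carrier F"
        using x finite_subset[OF sub] by (auto simp: F_def finitely_supported_def)
      have "\<pi> ?u = finsum C (\<lambda>c. ?u c \<odot>\<^bsub>C\<^esub> c) {x}"
        using x sub by (intro \<pi>J u) auto
      also have "\<dots> = x" using x by (simp add: C.M.finsum_insert)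
      finally show "x \<in> \<pi> ` carrier F" using u by (metis image_eqI)
    qed
  qed
  moreover have "id \<in> linear_maps A C C'"
    by (rule linear_mapsI) (simp_all add: C'_def)
  ultimately have "\<exists>k \<in> linear_maps A C F. \<forall>x \<in> carrier C. \<pi> (k x) = id x"
    using F.module_axioms C'
    by (intro assms[unfolded projective_module_def, THEN conjunct2, rule_format, of F C' \<pi> id] conjI)
  then obtain k where k: "k \<in> linear_maps A C F" and \<pi>k: "\<And>x. x \<in> carrier C \<Longrightarrow> \<pi> (k x) = x"
    by auto
  show ?thesis
  proof (rule that[of "\<lambda>c x. k x c"])
    show "(\<lambda>x. k x c) \<in> linear_maps A C (base_module A)" if "c \<in> carrier C" for c
      using linear_maps_closed[OF k] linear_maps_add[OF k] linear_maps_smult[OF k]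
      by (intro linear_mapsI) (auto simp: F_def finitely_supported_def)
    show "finite {c. k x c \<noteq> \<zero>\<^bsub>A\<^esub>} \<and> {c. k x c \<noteq> \<zero>\<^bsub>A\<^esub>} \<subseteq> carrier C \<and>
       finsum C (\<lambda>c. k x c \<odot>\<^bsub>C\<^esub> c) {c. k x c \<noteq> \<zero>\<^bsub>A\<^esub>} = x" if x: "x \<in> carrier C" for x
      using F[OF linear_maps_closed[OF k x]] \<pi>k[OF x] by (simp add: \<pi>_def)
  qed
qed

text \<open>
  A dual basis becomes homogeneous by splitting each pair of a functional \<open>\<phi> c\<close> and a vector \<open>c\<close>
  into its graded pieces.  For \<open>x\<close> of degree \<open>n\<close> the expansion over the pieces of degree \<open>n\<close> is
  the degree \<open>n\<close> component of the original expansion of \<open>x\<close>, which is \<open>x\<close> itself.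

  The expansion holds over every sufficiently large finite index set.  This form lets finitely many
  expansions be made over one common index set by intersecting eventualities.
\<close>

lemma homogeneous_dual_basis:
  fixes C :: "('a, 'c, 'z) gcoalgebra_scheme"
  assumes "graded_module A C" "projective_module A C"
  obtains \<phi> :: "'c \<times> int \<Rightarrow> 'c \<Rightarrow> 'a" and e :: "'c \<times> int \<Rightarrow> 'c" where
    "\<And>j. \<phi> j \<in> grade (dual_algebra A C) (- snd j)"
    "\<And>j. e j \<in> grade C (snd j)"
    "\<And>x. x \<in> carrier C \<Longrightarrow>
       \<forall>\<^sub>F J in finite_subsets_at_top UNIV. finsum C (\<lambda>j. \<phi> j x \<odot>\<^bsub>C\<^esub> e j) J = x"
proof -
  interpret C: graded_module A C by fact
  obtain \<phi> :: "'c \<Rightarrow> 'c \<Rightarrow> 'a" where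
    lin: "\<And>c. c \<in> carrier C \<Longrightarrow> \<phi> c \<in> linear_maps A C (base_module A)" and
    bas: "\<And>x. x \<in> carrier C \<Longrightarrow> finite {c. \<phi> c x \<noteq> \<zero>\<^bsub>A\<^esub>} \<and> {c. \<phi> c x \<noteq> \<zero>\<^bsub>A\<^esub>} \<subseteq> carrier C \<and>
       finsum C (\<lambda>c. \<phi> c x \<odot>\<^bsub>C\<^esub> c) {c. \<phi> c x \<noteq> \<zero>\<^bsub>A\<^esub>} = x"
    by (rule projective_dual_basis[OF assms(2)]) blast
  let ?p = "\<lambda>n x. component C (grade C) x n"
  define \<psi> where "\<psi> j = (\<lambda>x \<in> carrier C. if fst j \<in> carrier C then \<phi> (fst j) (?p (snd j) x) else \<zero>\<^bsub>A\<^esub>)" for j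
  define e where "e j = (if fst j \<in> carrier C then ?p (snd j) (fst j) else \<zero>\<^bsub>C\<^esub>)" for j
  note phi0 = linear_maps_zero[OF C.M.abelian_group_axioms module.axioms(2)[OF module_base_module[OF C.R.is_cring]] lin, simplified]
  have lin\<psi>: "\<psi> j \<in> linear_maps A C (base_module A)" for j
  proof (cases "fst j \<in> carrier C")
    case True
    from linear_maps_compose[OF C.component_linear lin[OF True]] show ?thesis
      by (rule linear_maps_cong[OF C.module_axioms]) (simp add: \<psi>_def True)
  next
    case False
    then show ?thesis by (intro linear_mapsI) (simp_all add: \<psi>_def)
  qed
  have \<psi>hom: "\<psi> j x = (if fst j \<in> carrier C \<and> snd j = n then \<phi> (fst j) x else \<zero>\<^bsub>A\<^esub>)"
    if "x \<in> grade C n" for j x n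
    using C.gr.D_carrier[OF that] C.gr.component_homogeneous[OF that] phi0 by (simp add: \<psi>_def)
  have \<psi>grade: "\<psi> j \<in> grade (dual_algebra A C) (- snd j)" for j
  proof -
    have "finite {n. \<exists>x \<in> grade C n. \<psi> j x \<noteq> \<zero>\<^bsub>A\<^esub>}"
      by (rule finite_subset[of _ "{snd j}"]) (auto simp: \<psi>hom)
    then show ?thesis
      using lin\<psi>[of j] by (auto simp: dual_algebra_def dual_carrier_def \<psi>hom) (simp add: \<psi>_def)
  qed
  have egrade: "e j \<in> grade C (snd j)" for j
    by (simp add: e_def C.gr.component_in)
  have summand [simp]: "\<psi> j x \<odot>\<^bsub>C\<^esub> e j \<in> carrier C" if "x \<in> carrier C" for j x
    using linear_maps_closed[OF lin\<psi> that] C.gr.D_carrier[OF egrade] by simp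
  have "\<forall>\<^sub>F J in finite_subsets_at_top UNIV. finsum C (\<lambda>j. \<psi> j x \<odot>\<^bsub>C\<^esub> e j) J = x" if "x \<in> carrier C" for x
    using that
  proof (induction x rule: C.gr.homogeneous_induct)
    case (homogeneous n x)
    have x: "x \<in> carrier C" by (rule C.gr.D_carrier[OF homogeneous])
    let ?S = "{c. \<phi> c x \<noteq> \<zero>\<^bsub>A\<^esub>}"
    note S = bas[OF x]
    have coef: "c \<in> ?S \<Longrightarrow> \<phi> c x \<in> carrier A" for c
      using S linear_maps_closed[OF lin x] by auto
    have "finsum C (\<lambda>j. \<psi> j x \<odot>\<^bsub>C\<^esub> e j) J = x" if J: "finite J" "(\<lambda>c. (c, n)) ` ?S \<subseteq> J" for J
    proof -
      have "finsum C (\<lambda>j. \<psi> j x \<odot>\<^bsub>C\<^esub> e j) J = finsum C (\<lambda>j. \<psi> j x \<odot>\<^bsub>C\<^esub> e j) ((\<lambda>c. (c, n)) ` ?S)"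
      proof (rule C.M.add.finprod_mono_neutral_cong_right)
        fix j assume "j \<in> J - (\<lambda>c. (c, n)) ` ?S"
        then have "\<psi> j x = \<zero>\<^bsub>A\<^esub>"
          by (cases j) (auto simp: \<psi>hom[OF homogeneous])
        then show "\<psi> j x \<odot>\<^bsub>C\<^esub> e j = \<zero>\<^bsub>C\<^esub>"
          using C.gr.D_carrier[OF egrade] by simp
      qed (use J x in auto)
      also have "\<dots> = finsum C (\<lambda>c. \<psi> (c, n) x \<odot>\<^bsub>C\<^esub> e (c, n)) ?S"
        using x by (intro C.M.finsum_reindex) (auto simp: inj_on_def)
      also have "\<dots> = finsum C (\<lambda>c. ?p n (\<phi> c x \<odot>\<^bsub>C\<^esub> c)) ?S"
        using S coef by (intro C.M.finsum_cong')
          (auto simp: \<psi>hom[OF homogeneous] e_def C.component_smult subset_iff)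
      also have "\<dots> = ?p n (finsum C (\<lambda>c. \<phi> c x \<odot>\<^bsub>C\<^esub> c) ?S)"
        using S coef by (intro hom_finsum[symmetric, of C C "?p n"] C.M.abelian_group_axioms
            linear_maps_hom[OF C.component_linear]) auto
      also have "\<dots> = x" using S C.gr.component_homogeneous[OF homogeneous] by simp
      finally show ?thesis .
    qed
    then show ?case
      using S by (intro eventually_finite_subsets_at_top[THEN iffD2]) (meson finite_imageI subset_UNIV)
  next
    case (add x y)
    from add.IH show ?case
    proof eventually_elim
      case (elim J)
      have "finsum C (\<lambda>j. \<psi> j (x \<oplus>\<^bsub>C\<^esub> y) \<odot>\<^bsub>C\<^esub> e j) J = finsum C (\<lambda>j. \<psi> j x \<odot>\<^bsub>C\<^esub> e j \<oplus>\<^bsub>C\<^esub> \<psi> j y \<odot>\<^bsub>C\<^esub> e j) J"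
        using add.hyps linear_maps_closed[OF lin\<psi>] C.gr.D_carrier[OF egrade]
        by (intro C.M.finsum_cong') (auto simp: linear_maps_add[OF lin\<psi>] C.smult_l_distr)
      also have "\<dots> = x \<oplus>\<^bsub>C\<^esub> y"
        using add.hyps elim by (subst C.M.finsum_addf) auto
      finally show ?case .
    qed
  qed
  with \<psi>grade egrade show ?thesis by (rule that)
qed

section \<open>Degrees and changes of the module in tensor products\<close>

lemma generate_cong:
  assumes "carrier G = carrier H" "monoid.mult G = monoid.mult H" "\<one>\<^bsub>G\<^esub> = \<one>\<^bsub>H\<^esub>"
  shows "generate G S = generate H S"
proof -
  have sub: "generate G S \<subseteq> generate H S"
    if "carrier G = carrier H" "monoid.mult G = monoid.mult H" "\<one>\<^bsub>G\<^esub> = \<one>\<^bsub>H\<^esub>"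
    for G :: "('a, 'x) monoid_scheme" and H :: "('a, 'y) monoid_scheme"
  proof
    fix x assume "x \<in> generate G S"
    then show "x \<in> generate H S"
    proof (induction rule: generate.induct)
      case one
      show ?case unfolding that(3) by (rule generate.one)
    next
      case (incl h)
      then show ?case by (rule generate.incl)
    next
      case (inv h)
      have "inv\<^bsub>G\<^esub> h = inv\<^bsub>H\<^esub> h" using that by (simp add: m_inv_def)
      then show ?case using generate.inv[OF inv, of H] by simp
    next
      case (eng h1 h2)
      show ?case unfolding that(2) using eng.IH by (rule generate.eng)
    qed
  qed
  show ?thesis
    using sub[of G H] sub[of H G] assms by auto
qed

context module_pair
begin

lemma grade_tensor:
  "grade (tensor A M N) n = generate (add_monoid (tensor A M N))
     {pure_tensor A M N x y | i x y. x \<in> grade M i \<and> y \<in> grade N (n - i)}"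
proof -
  have "grade (tensor A M N) n = generate (tensor_group A M N)
     {pure_tensor A M N x y | i x y. x \<in> grade M i \<and> y \<in> grade N (n - i)}"
    by (simp add: tensor_def)
  also have "\<dots> = generate (add_monoid (tensor A M N))
     {pure_tensor A M N x y | i x y. x \<in> grade M i \<and> y \<in> grade N (n - i)}"
    by (rule generate_cong) (simp_all add: tensor_fields)
  finally show ?thesis .
qed

lemma pure_in_grade:
  assumes "x \<in> grade M i" "y \<in> grade N j" "n = i + j"
  shows "pure_tensor A M N x y \<in> grade (tensor A M N) n"
  unfolding grade_tensor using assms by (intro generate.incl) force

text \<open>
  Statements about one degree of a tensor product are equalities of additive maps, and these need
  checking only on pure tensors of homogeneous elements of complementary degrees.
\<close>

lemma hom_eq_on_tensor_grade:
  assumes P: "abelian_group P" and M: "\<And>i. grade M i \<subseteq> carrier M" and N: "\<And>i. grade N i \<subseteq> carrier N"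
    and h: "h \<in> hom (add_monoid (tensor A M N)) (add_monoid P)"
    and k: "k \<in> hom (add_monoid (tensor A M N)) (add_monoid P)"
    and t: "t \<in> grade (tensor A M N) n"
    and eq: "\<And>i x y. x \<in> grade M i \<Longrightarrow> y \<in> grade N (n - i) \<Longrightarrow>
      h (pure_tensor A M N x y) = k (pure_tensor A M N x y)"
  shows "h t = k t"
proof -
  interpret P: abelian_group P by fact
  interpret T: abelian_group "tensor A M N" by (rule abelian_group_tensor)
  interpret h: group_hom "add_monoid (tensor A M N)" "add_monoid P" h
    by (simp add: group_hom_def group_hom_axioms_def h T.a_group P.a_group)
  interpret k: group_hom "add_monoid (tensor A M N)" "add_monoid P" k
    by (simp add: group_hom_def group_hom_axioms_def k T.a_group P.a_group)
  have "t \<in> carrier (tensor A M N) \<and> h t = k t"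
    using t unfolding grade_tensor
  proof (induction t rule: generate.induct)
    case one
    then show ?case using h.hom_one k.hom_one by simp
  next
    case (incl t)
    then show ?case using eq subsetD[OF M] subsetD[OF N] by (auto intro!: pure_closed)
  next
    case (inv t)
    then have "t \<in> carrier (tensor A M N)" "h t = k t" using eq subsetD[OF M] subsetD[OF N] by (auto intro!: pure_closed)
    then show ?case using h.hom_inv[of t] k.hom_inv[of t] by (simp flip: a_inv_def)
  next
    case (eng s t)
    then show ?case using h.hom_mult[of s t] k.hom_mult[of s t] by simp
  qed
  then show ?thesis by simp
qed

lemma slice_cong:
  assumes f: "f \<in> linear_maps A N (base_module A)" and g: "\<And>y. y \<in> carrier N \<Longrightarrow> g y = f y"
    and t: "t \<in> carrier (tensor A M N)"
  shows "slice A M N g t = slice A M N f t"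
proof -
  have g': "g \<in> linear_maps A N (base_module A)"
    by (rule linear_maps_cong[OF N.module_axioms f g])
  show ?thesis
    by (rule linear_eq_on_tensor[OF t slice_linear[OF g'] slice_linear[OF f]])
      (simp add: slice_pure f g g')
qed

end

lemma
  assumes "carrier M = carrier M'" "\<And>x y. x \<oplus>\<^bsub>M\<^esub> y = x \<oplus>\<^bsub>M'\<^esub> y"
    "\<And>a x. a \<odot>\<^bsub>M\<^esub> x = a \<odot>\<^bsub>M'\<^esub> x"
  shows tensor_class_cong: "tensor_class A M N = tensor_class A M' N"
    and tensor_group_cong: "tensor_group A M N = tensor_group A M' N"
    and pure_tensor_cong: "pure_tensor A M N = pure_tensor A M' N"
proof -
  have "tensor_null A M N = tensor_null A M' N"
    by (simp add: tensor_null_def tensor_relations_def assms)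
  then show 1: "tensor_class A M N = tensor_class A M' N"
    and "tensor_group A M N = tensor_group A M' N"
    by (simp_all add: tensor_class_def[abs_def] tensor_group_def assms)
  then show "pure_tensor A M N = pure_tensor A M' N"
    by (simp add: pure_tensor_def[abs_def])
qed

lemma tensor_cong:
  assumes "carrier M = carrier M'" "\<And>x y. x \<oplus>\<^bsub>M\<^esub> y = x \<oplus>\<^bsub>M'\<^esub> y"
    "\<And>a x. a \<odot>\<^bsub>M\<^esub> x = a \<odot>\<^bsub>M'\<^esub> x"
    "grade M = grade M'"
  shows "tensor A M N = tensor A M' N"
  by (simp add: tensor_def tensor_class_cong[OF assms(1-3)] tensor_group_cong[OF assms(1-3)]
      pure_tensor_cong[OF assms(1-3)] assms)

lemma linear_maps_target_cong:
  assumes "carrier M = carrier M'" "\<And>x y. x \<oplus>\<^bsub>M\<^esub> y = x \<oplus>\<^bsub>M'\<^esub> y"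
    "\<And>a x. a \<odot>\<^bsub>M\<^esub> x = a \<odot>\<^bsub>M'\<^esub> x"
  shows "linear_maps A L M = linear_maps A L M'"
  by (simp add: linear_maps_def assms)

text \<open>
  A comodule and its underlying module are records of different types, so the slices formed from
  them are different terms; this lemma and the preceding ones identify them.
\<close>

lemma slice_module_cong:
  assumes "carrier M = carrier M'" "\<And>x y. x \<oplus>\<^bsub>M\<^esub> y = x \<oplus>\<^bsub>M'\<^esub> y"
    "\<And>a x. a \<odot>\<^bsub>M\<^esub> x = a \<odot>\<^bsub>M'\<^esub> x"
    "grade M = grade M'"
  shows "slice A M N f = slice A M' N f"
proof -
  note cong = tensor_cong[OF assms] pure_tensor_cong[OF assms(1-3)] linear_maps_target_cong[OF assms(1-3)] assms(1,3)
  have "tensor_right_unit A M = tensor_right_unit A M'"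
    unfolding tensor_right_unit_def tensor_lift_def cong ..
  moreover have "tensor_map A M N M (base_module A) id f = tensor_map A M' N M' (base_module A) id f"
    unfolding tensor_map_def tensor_lift_def cong ..
  ultimately show ?thesis
    by (simp add: slice_def[abs_def])
qed

lemma smult_adjoint_module:
  "f \<odot>\<^bsub>adjoint_module A C N\<^esub> x = slice A N C f (coact N x)"
  by (simp add: adjoint_module_def slice_def)

lemma smult_adjoint_regular:
  "f \<odot>\<^bsub>adjoint_module A C (regular_comodule C)\<^esub> x = slice A C C f (comult C x)"
proof -
  have "slice A (regular_comodule C) C f = slice A C C f"
    by (rule slice_module_cong) (simp_all add: regular_comodule_def)
  then show ?thesis
    by (simp add: smult_adjoint_module) (simp add: regular_comodule_def)
qed

section \<open>The dual algebra\<close>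

context graded_coalgebra
begin

abbreviation "D \<equiv> dual_algebra A C"

abbreviation "act f c \<equiv> slice A C C f (comult C c)"

lemma pair: "module_pair A C C"
  by (intro module_pair.intro module_axioms)

lemma carrier_dual: "carrier D = dual_carrier A C"
  by (simp add: dual_algebra_def)

lemma dual_add: "c \<in> carrier C \<Longrightarrow> (f \<oplus>\<^bsub>D\<^esub> g) c = f c \<oplus>\<^bsub>A\<^esub> g c"
  and dual_zero: "c \<in> carrier C \<Longrightarrow> \<zero>\<^bsub>D\<^esub> c = \<zero>\<^bsub>A\<^esub>"
  and dual_smult: "c \<in> carrier C \<Longrightarrow> (a \<odot>\<^bsub>D\<^esub> f) c = a \<otimes>\<^bsub>A\<^esub> f c"
  and dual_one: "c \<in> carrier C \<Longrightarrow> \<one>\<^bsub>D\<^esub> c = counit C c"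
  by (simp_all add: dual_algebra_def)

lemma dual_extensional:
  "f \<in> carrier D \<Longrightarrow> f \<in> extensional (carrier C)"
  "f \<oplus>\<^bsub>D\<^esub> g \<in> extensional (carrier C)"
  "\<zero>\<^bsub>D\<^esub> \<in> extensional (carrier C)"
  "a \<odot>\<^bsub>D\<^esub> f \<in> extensional (carrier C)"
  "\<one>\<^bsub>D\<^esub> \<in> extensional (carrier C)"
  "f \<otimes>\<^bsub>D\<^esub> g \<in> extensional (carrier C)"
  by (simp_all add: dual_algebra_def dual_carrier_def)

lemma dual_eqI:
  assumes "f \<in> extensional (carrier C)" "g \<in> extensional (carrier C)"
    and "\<And>c. c \<in> carrier C \<Longrightarrow> f c = g c"
  shows "f = g"
  using assms by (rule extensionalityI)

lemma dual_linear: "f \<in> carrier D \<Longrightarrow> f \<in> linear_maps A C (base_module A)"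
  by (simp add: dual_algebra_def dual_carrier_def)

lemma dual_closed: "f \<in> carrier D \<Longrightarrow> c \<in> carrier C \<Longrightarrow> f c \<in> carrier A"
  using linear_maps_closed[OF dual_linear] by simp

lemma dual_carrierI:
  assumes "f \<in> linear_maps A C (base_module A)" "f \<in> extensional (carrier C)"
    and "finite S" "\<And>n x. n \<notin> S \<Longrightarrow> x \<in> grade C n \<Longrightarrow> f x = \<zero>\<^bsub>A\<^esub>"
  shows "f \<in> carrier D"
proof -
  have "{n. \<exists>x \<in> grade C n. f x \<noteq> \<zero>\<^bsub>A\<^esub>} \<subseteq> S" using assms(4) by blast
  then show ?thesis
    using assms finite_subset by (auto simp: carrier_dual dual_carrier_def)
qed

lemma dual_support: "f \<in> carrier D \<Longrightarrow> finite {n. \<exists>x \<in> grade C n. f x \<noteq> \<zero>\<^bsub>A\<^esub>}"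
  by (simp add: carrier_dual dual_carrier_def)

lemma grade_dual: "f \<in> grade D n \<longleftrightarrow> f \<in> carrier D \<and> (\<forall>k x. k \<noteq> - n \<longrightarrow> x \<in> grade C k \<longrightarrow> f x = \<zero>\<^bsub>A\<^esub>)"
  by (auto simp: dual_algebra_def)

lemma grade_dualI:
  assumes "f \<in> linear_maps A C (base_module A)" "f \<in> extensional (carrier C)"
    and "\<And>k x. k \<noteq> - n \<Longrightarrow> x \<in> grade C k \<Longrightarrow> f x = \<zero>\<^bsub>A\<^esub>"
  shows "f \<in> grade D n"
  unfolding grade_dual using assms
  by (auto intro!: dual_carrierI[of f "{- n}"])

lemma counit_lin: "counit C \<in> linear_maps A C (base_module A)"
  using counit_linear by (simp add: graded_linear_maps_def)

lemma comult_lin: "comult C \<in> linear_maps A C (tensor A C C)"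
  using comult_linear by (simp add: graded_linear_maps_def)

lemma comult_grade: "x \<in> grade C n \<Longrightarrow> comult C x \<in> grade (tensor A C C) n"
  using comult_linear by (auto simp: graded_linear_maps_def)

lemma abelian_group_dual: "abelian_group D"
proof (rule abelian_groupI)
  fix f g assume fg: "f \<in> carrier D" "g \<in> carrier D"
  show "f \<oplus>\<^bsub>D\<^esub> g \<in> carrier D"
  proof (rule dual_carrierI)
    show "f \<oplus>\<^bsub>D\<^esub> g \<in> linear_maps A C (base_module A)"
      using fg linear_maps_add[OF dual_linear[OF fg(1)]] linear_maps_smult[OF dual_linear[OF fg(1)]]
        linear_maps_add[OF dual_linear[OF fg(2)]] linear_maps_smult[OF dual_linear[OF fg(2)]]
      by (intro linear_mapsI) (simp_all add: dual_add dual_closed R.a_ac R.r_distr)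
    show "finite ({n. \<exists>x \<in> grade C n. f x \<noteq> \<zero>\<^bsub>A\<^esub>} \<union> {n. \<exists>x \<in> grade C n. g x \<noteq> \<zero>\<^bsub>A\<^esub>})"
      using fg dual_support by simp
  qed (auto simp: dual_extensional dual_add gr.D_carrier)
  show "f \<oplus>\<^bsub>D\<^esub> g = g \<oplus>\<^bsub>D\<^esub> f"
    using fg by (intro dual_eqI dual_extensional) (simp add: dual_add dual_closed R.a_comm)
  fix h assume h: "h \<in> carrier D"
  show "f \<oplus>\<^bsub>D\<^esub> g \<oplus>\<^bsub>D\<^esub> h = f \<oplus>\<^bsub>D\<^esub> (g \<oplus>\<^bsub>D\<^esub> h)"
    using fg h by (intro dual_eqI dual_extensional) (simp add: dual_add dual_closed R.a_assoc)
next
  show "\<zero>\<^bsub>D\<^esub> \<in> carrier D"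
    by (rule dual_carrierI[of _ "{}"])
      (auto simp: dual_extensional dual_zero gr.D_carrier intro!: linear_mapsI)
next
  fix f assume f: "f \<in> carrier D"
  show "\<zero>\<^bsub>D\<^esub> \<oplus>\<^bsub>D\<^esub> f = f"
    using f by (intro dual_eqI dual_extensional) (simp_all add: dual_add dual_zero dual_closed)
  show "\<exists>g \<in> carrier D. g \<oplus>\<^bsub>D\<^esub> f = \<zero>\<^bsub>D\<^esub>"
  proof
    show "(\<lambda>c \<in> carrier C. \<ominus>\<^bsub>A\<^esub> f c) \<in> carrier D"
    proof (rule dual_carrierI[OF _ _ dual_support[OF f]])
      show "(\<lambda>c \<in> carrier C. \<ominus>\<^bsub>A\<^esub> f c) \<in> linear_maps A C (base_module A)"
        using f linear_maps_add[OF dual_linear[OF f]] linear_maps_smult[OF dual_linear[OF f]]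
        by (intro linear_mapsI) (simp_all add: dual_closed R.minus_add R.r_minus)
    qed (auto simp: gr.D_carrier)
    show "(\<lambda>c \<in> carrier C. \<ominus>\<^bsub>A\<^esub> f c) \<oplus>\<^bsub>D\<^esub> f = \<zero>\<^bsub>D\<^esub>"
      using f by (intro dual_eqI dual_extensional) (simp_all add: dual_add dual_zero dual_closed R.l_neg)
  qed
qed

lemma dual_smult_closed:
  assumes "a \<in> carrier A" "f \<in> carrier D"
  shows "a \<odot>\<^bsub>D\<^esub> f \<in> carrier D"
proof (rule dual_carrierI[OF _ _ dual_support[OF assms(2)]])
  show "a \<odot>\<^bsub>D\<^esub> f \<in> linear_maps A C (base_module A)"
    using assms linear_maps_add[OF dual_linear[OF assms(2)]] linear_maps_smult[OF dual_linear[OF assms(2)]]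
    by (intro linear_mapsI) (simp_all add: dual_smult dual_closed R.r_distr R.m_lcomm)
qed (use assms in \<open>auto simp: dual_extensional dual_smult gr.D_carrier\<close>)

lemma dual_one_grade: "\<one>\<^bsub>D\<^esub> \<in> grade D 0"
proof (rule grade_dualI)
  show "\<one>\<^bsub>D\<^esub> \<in> linear_maps A C (base_module A)"
    by (rule linear_maps_cong[OF module_axioms counit_lin]) (simp add: dual_one)
  fix k x assume "k \<noteq> - 0" and x: "x \<in> grade C k"
  then have "counit C x \<in> grade (base_module A) k" "k \<noteq> 0"
    using counit_linear by (auto simp: graded_linear_maps_def)
  then show "\<one>\<^bsub>D\<^esub> x = \<zero>\<^bsub>A\<^esub>"
    using gr.D_carrier[OF x] by (simp add: dual_one base_module_def)
qed (rule dual_extensional)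

lemma dual_one_closed: "\<one>\<^bsub>D\<^esub> \<in> carrier D"
  using dual_one_grade by (simp add: grade_dual)

lemma dual_smult_grade: "a \<in> carrier A \<Longrightarrow> f \<in> grade D n \<Longrightarrow> a \<odot>\<^bsub>D\<^esub> f \<in> grade D n"
  by (auto simp: grade_dual dual_smult_closed dual_smult gr.D_carrier)

lemma act_linear: "f \<in> linear_maps A C (base_module A) \<Longrightarrow> (\<lambda>c. act f c) \<in> linear_maps A C C"
  by (rule linear_maps_compose[OF comult_lin module_pair.slice_linear[OF pair]])

lemma act_closed: "f \<in> linear_maps A C (base_module A) \<Longrightarrow> c \<in> carrier C \<Longrightarrow> act f c \<in> carrier C"
  using linear_maps_closed[OF act_linear] by blast

lemma act_counit: "c \<in> carrier C \<Longrightarrow> act (counit C) c = c"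
  using counit_right by (simp add: slice_def)

lemma act_one: "c \<in> carrier C \<Longrightarrow> act \<one>\<^bsub>D\<^esub> c = c"
  using module_pair.slice_cong[OF pair counit_lin dual_one, of "comult C c"] act_counit
    linear_maps_closed[OF comult_lin] by simp

text \<open>
  Both sides come from \<open>\<epsilon> \<otimes> f\<close> evaluated at \<open>\<Delta> c\<close>, so this is the left counit axiom.  It recovers
  \<open>f c\<close> from the action of \<open>f\<close> on \<open>c\<close>; hence whatever annihilates \<open>c\<close> also vanishes at \<open>c\<close>.
\<close>

lemma counit_act:
  assumes f: "f \<in> linear_maps A C (base_module A)" and c: "c \<in> carrier C"
  shows "counit C (act f c) = f c"
proof -
  interpret CC: module_pair A C C by (rule pair)
  interpret B: module A "base_module A" by (rule module_base_module[OF R.is_cring])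
  have BC: "module_pair A (base_module A) C" by (intro module_pair.intro module_axioms B.module_axioms)
  let ?k = "\<lambda>t. f (tensor_left_unit A C (tensor_map A C C (base_module A) C (counit C) id t))"
  have "counit C (slice A C C f (comult C c)) = ?k (comult C c)"
  proof (rule CC.linear_eq_on_tensor[where P = "base_module A"])
    show "comult C c \<in> carrier (tensor A C C)" by (rule linear_maps_closed[OF comult_lin c])
    show "(\<lambda>t. counit C (slice A C C f t)) \<in> linear_maps A (tensor A C C) (base_module A)"
      by (rule linear_maps_compose[OF CC.slice_linear[OF f] counit_lin])
    show "?k \<in> linear_maps A (tensor A C C) (base_module A)"
      by (intro linear_maps_compose[OF _ f] linear_maps_compose[OF _ tensor_left_unit_linear[OF module_axioms]]
          CC.tensor_map_linear[OF BC] counit_lin linear_maps_id)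
    fix x y assume xy: "x \<in> carrier C" "y \<in> carrier C"
    then show "counit C (slice A C C f (pure_tensor A C C x y)) = ?k (pure_tensor A C C x y)"
      using linear_maps_closed[OF f] linear_maps_closed[OF counit_lin]
      by (simp add: CC.slice_pure[OF f] CC.tensor_map_pure[OF BC counit_lin linear_maps_id]
          tensor_left_unit_pure[OF module_axioms] linear_maps_smult[OF f] linear_maps_smult[OF counit_lin]
          R.m_comm)
  qed
  then show ?thesis using counit_left[OF c] by simp
qed

text \<open>
  The linear form \<open>f \<otimes> g\<close> on \<open>C \<otimes> C\<close>; the convolution product of \<open>f\<close> and \<open>g\<close> is its composite
  with the comultiplication.
\<close>

definition conv_form :: "('c \<Rightarrow> 'a) \<Rightarrow> ('c \<Rightarrow> 'a) \<Rightarrow> ('c \<times> 'c \<Rightarrow>\<^sub>0 int) set \<Rightarrow> 'a" where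
  "conv_form f g t = tensor_right_unit A (base_module A)
     (tensor_map A C C (base_module A) (base_module A) f g t)"

lemma dual_mult: "c \<in> carrier C \<Longrightarrow> (f \<otimes>\<^bsub>D\<^esub> g) c = conv_form f g (comult C c)"
  by (simp add: dual_algebra_def conv_form_def)

lemma
  assumes f: "f \<in> linear_maps A C (base_module A)" and g: "g \<in> linear_maps A C (base_module A)"
  shows conv_form_linear: "conv_form f g \<in> linear_maps A (tensor A C C) (base_module A)"
    and conv_form_pure: "x \<in> carrier C \<Longrightarrow> y \<in> carrier C \<Longrightarrow>
      conv_form f g (pure_tensor A C C x y) = g y \<otimes>\<^bsub>A\<^esub> f x"
proof -
  interpret CC: module_pair A C C by (rule pair)
  interpret B: module A "base_module A" by (rule module_base_module[OF R.is_cring])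
  have BB: "module_pair A (base_module A) (base_module A)" by (intro module_pair.intro B.module_axioms)
  show "conv_form f g \<in> linear_maps A (tensor A C C) (base_module A)"
    unfolding conv_form_def[abs_def]
    by (rule linear_maps_compose[OF CC.tensor_map_linear[OF BB f g] tensor_right_unit_linear[OF B.module_axioms]])
  show "conv_form f g (pure_tensor A C C x y) = g y \<otimes>\<^bsub>A\<^esub> f x" if "x \<in> carrier C" "y \<in> carrier C"
    using that linear_maps_closed[OF f] linear_maps_closed[OF g]
    by (simp add: conv_form_def CC.tensor_map_pure[OF BB f g] tensor_right_unit_pure[OF B.module_axioms])
qed

lemma dual_mult_act:
  assumes f: "f \<in> linear_maps A C (base_module A)" and g: "g \<in> linear_maps A C (base_module A)"
    and c: "c \<in> carrier C"
  shows "(f \<otimes>\<^bsub>D\<^esub> g) c = f (act g c)"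
proof -
  interpret CC: module_pair A C C by (rule pair)
  have "conv_form f g (comult C c) = f (slice A C C g (comult C c))"
    by (rule CC.linear_eq_on_tensor[OF linear_maps_closed[OF comult_lin c] conv_form_linear[OF f g]
        linear_maps_compose[OF CC.slice_linear[OF g] f]])
      (use linear_maps_closed[OF g] in \<open>simp add: conv_form_pure[OF f g] CC.slice_pure[OF g] linear_maps_smult[OF f]\<close>)
  with c show ?thesis by (simp add: dual_mult)
qed

lemma dual_mult_linear:
  assumes "f \<in> linear_maps A C (base_module A)" "g \<in> linear_maps A C (base_module A)"
  shows "f \<otimes>\<^bsub>D\<^esub> g \<in> linear_maps A C (base_module A)"
  by (rule linear_maps_cong[OF module_axioms linear_maps_compose[OF act_linear[OF assms(2)] assms(1)]])
    (rule dual_mult_act[OF assms])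

text \<open>
  If \<open>f\<close> and \<open>g\<close> live in finitely many degrees, their product lives in the sums of those degrees,
  because comultiplication preserves degree.
\<close>

lemma dual_mult_closed:
  assumes f: "f \<in> carrier D" and g: "g \<in> carrier D"
  shows "f \<otimes>\<^bsub>D\<^esub> g \<in> carrier D"
proof (rule dual_carrierI)
  interpret CC: module_pair A C C by (rule pair)
  interpret B: module A "base_module A" by (rule module_base_module[OF R.is_cring])
  note lf = dual_linear[OF f] and lg = dual_linear[OF g]
  let ?S = "\<lambda>f. {n. \<exists>x \<in> grade C n. f x \<noteq> \<zero>\<^bsub>A\<^esub>}"
  show "f \<otimes>\<^bsub>D\<^esub> g \<in> linear_maps A C (base_module A)" by (rule dual_mult_linear[OF lf lg])
  show "finite ((\<lambda>(i, j). i + j) ` (?S f \<times> ?S g))"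
    using dual_support f g by blast
  fix n x assume n: "n \<notin> (\<lambda>(i, j). i + j) ` (?S f \<times> ?S g)" and x: "x \<in> grade C n"
  have "conv_form f g (comult C x) = (\<lambda>_. \<zero>\<^bsub>A\<^esub>) (comult C x)"
  proof (rule CC.hom_eq_on_tensor_grade[of "base_module A" _ _ _ n])
    show "conv_form f g \<in> hom (add_monoid (tensor A C C)) (add_monoid (base_module A))"
      by (rule linear_maps_hom[OF conv_form_linear[OF lf lg]])
    show "(\<lambda>_. \<zero>\<^bsub>A\<^esub>) \<in> hom (add_monoid (tensor A C C)) (add_monoid (base_module A))"
      by (simp add: hom_def)
    fix i y z assume y: "y \<in> grade C i" and z: "z \<in> grade C (n - i)"
    have "i \<notin> ?S f \<or> n - i \<notin> ?S g"
    proof (rule ccontr)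
      assume "\<not> ?thesis"
      then have "(\<lambda>(i, j). i + j) (i, n - i) \<in> (\<lambda>(i, j). i + j) ` (?S f \<times> ?S g)" by blast
      with n show False by simp
    qed
    then have "f y = \<zero>\<^bsub>A\<^esub> \<or> g z = \<zero>\<^bsub>A\<^esub>" using y z by blast
    then show "conv_form f g (pure_tensor A C C y z) = \<zero>\<^bsub>A\<^esub>"
      using gr.D_carrier[OF y] gr.D_carrier[OF z] dual_closed f g
      by (auto simp: conv_form_pure[OF lf lg])
  qed (use gr.D_carrier B.M.abelian_group_axioms comult_grade[OF x] in auto)
  then show "(f \<otimes>\<^bsub>D\<^esub> g) x = \<zero>\<^bsub>A\<^esub>" using gr.D_carrier[OF x] by (simp add: dual_mult)
qed (rule dual_extensional)

text \<open>
  Coassociativity, tested with \<open>id \<otimes> (f \<otimes> g)\<close>: the map \<open>?\<Phi>\<close> turns \<open>(id \<otimes> \<Delta>) (\<Delta> c)\<close> into the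
  left-hand side and \<open>(\<Delta> \<otimes> id) (\<Delta> c)\<close> into the right-hand side.
\<close>

lemma act_mult:
  assumes f: "f \<in> linear_maps A C (base_module A)" and g: "g \<in> linear_maps A C (base_module A)"
    and c: "c \<in> carrier C"
  shows "act (f \<otimes>\<^bsub>D\<^esub> g) c = act f (act g c)"
proof -
  interpret CC: module_pair A C C by (rule pair)
  interpret T: module A "tensor A C C" by (rule CC.module_tensor)
  interpret CT: module_pair A C "tensor A C C" by (intro module_pair.intro module_axioms T.module_axioms)
  interpret TC: module_pair A "tensor A C C" C by (intro module_pair.intro module_axioms T.module_axioms)
  note fg = dual_mult_linear[OF f g]
  note cf = conv_form_linear[OF f g]
  let ?\<Phi> = "slice A C (tensor A C C) (conv_form f g)"
  note \<Phi> = CT.slice_linear[OF cf]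
  note assoc = tensor_assoc_linear[OF module_axioms module_axioms module_axioms]
  note clo = linear_maps_closed[OF comult_lin] linear_maps_closed[OF f, simplified]
    linear_maps_closed[OF g, simplified]
  let ?l = "tensor_map A C C C (tensor A C C) id (comult C)"
  let ?r = "tensor_map A C C (tensor A C C) C (comult C) id"
  have 1: "?\<Phi> (?l t) = slice A C C (f \<otimes>\<^bsub>D\<^esub> g) t" if "t \<in> carrier (tensor A C C)" for t
    by (rule CC.linear_eq_on_tensor[OF that
          linear_maps_compose[OF CC.tensor_map_linear[OF CT.module_pair_axioms linear_maps_id comult_lin] \<Phi>]
          CC.slice_linear[OF fg]])
      (simp add: CC.tensor_map_pure[OF CT.module_pair_axioms linear_maps_id comult_lin] clo
        CT.slice_pure[OF cf] CC.slice_pure[OF fg] dual_mult)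
  have 2: "?\<Phi> (tensor_assoc A C C C (pure_tensor A (tensor A C C) C u y)) = g y \<odot>\<^bsub>C\<^esub> slice A C C f u"
    if u: "u \<in> carrier (tensor A C C)" and y: "y \<in> carrier C" for u y
  proof -
    have p: "(\<lambda>u. pure_tensor A (tensor A C C) C u y) \<in> linear_maps A (tensor A C C) (tensor A (tensor A C C) C)"
      using TC.pure_bilinear y by (simp add: bilinear_maps_def)
    have s: "(\<lambda>u. g y \<odot>\<^bsub>C\<^esub> slice A C C f u) \<in> linear_maps A (tensor A C C) C"
      using clo(3)[OF y] linear_maps_closed[OF CC.slice_linear[OF f]]
      by (intro linear_mapsI) (simp_all add: linear_maps_add[OF CC.slice_linear[OF f]]
          linear_maps_smult[OF CC.slice_linear[OF f]] smult_r_distr R.m_comm flip: smult_assoc1)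
    show ?thesis
      by (rule CC.linear_eq_on_tensor[OF u linear_maps_compose[OF linear_maps_compose[OF p assoc] \<Phi>] s])
        (use y in \<open>simp add: tensor_assoc_pure[OF module_axioms module_axioms module_axioms]
          CT.slice_pure[OF cf] CC.slice_pure[OF f] clo conv_form_pure[OF f g] smult_assoc1\<close>)
  qed
  have 3: "?\<Phi> (tensor_assoc A C C C (?r t)) = act f (slice A C C g t)" if "t \<in> carrier (tensor A C C)" for t
    by (rule CC.linear_eq_on_tensor[OF that
          linear_maps_compose[OF linear_maps_compose[OF CC.tensor_map_linear[OF TC.module_pair_axioms comult_lin linear_maps_id] assoc] \<Phi>]
          linear_maps_compose[OF CC.slice_linear[OF g] act_linear[OF f]]])
      (simp add: CC.tensor_map_pure[OF TC.module_pair_axioms comult_lin linear_maps_id] clo 2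
        CC.slice_pure[OF g] linear_maps_smult[OF act_linear[OF f]])
  have t: "comult C c \<in> carrier (tensor A C C)" by (rule clo(1)[OF c])
  show ?thesis using 1[OF t] 3[OF t] coassoc[OF c] by simp
qed

text \<open>
  The scalars \<open>a \<epsilon>\<close> act centrally on the dual algebra, so any module over the dual algebra
  becomes an \<open>A\<close>-module on which the dual algebra acts linearly.
\<close>

lemma dual_smult_one_mult:
  assumes "a \<in> carrier A" "f \<in> carrier D"
  shows "(a \<odot>\<^bsub>D\<^esub> \<one>\<^bsub>D\<^esub>) \<otimes>\<^bsub>D\<^esub> f = a \<odot>\<^bsub>D\<^esub> f"
    and "f \<otimes>\<^bsub>D\<^esub> (a \<odot>\<^bsub>D\<^esub> \<one>\<^bsub>D\<^esub>) = a \<odot>\<^bsub>D\<^esub> f"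
proof -
  interpret CC: module_pair A C C by (rule pair)
  note lf = dual_linear[OF assms(2)]
  have a1: "a \<odot>\<^bsub>D\<^esub> \<one>\<^bsub>D\<^esub> \<in> linear_maps A C (base_module A)"
    using dual_linear[OF dual_smult_closed[OF assms(1) dual_one_closed]] .
  have one: "\<one>\<^bsub>D\<^esub> \<in> linear_maps A C (base_module A)" by (rule dual_linear[OF dual_one_closed])
  show "(a \<odot>\<^bsub>D\<^esub> \<one>\<^bsub>D\<^esub>) \<otimes>\<^bsub>D\<^esub> f = a \<odot>\<^bsub>D\<^esub> f"
    by (intro dual_eqI dual_extensional)
      (simp add: dual_mult_act[OF a1 lf] dual_smult dual_one act_closed[OF lf] counit_act[OF lf])
  have s: "slice A C C (a \<odot>\<^bsub>D\<^esub> \<one>\<^bsub>D\<^esub>) t = a \<odot>\<^bsub>C\<^esub> slice A C C \<one>\<^bsub>D\<^esub> t" if "t \<in> carrier (tensor A C C)" for t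
    using that
  proof (induction t rule: CC.tensor_induct)
    case (pure x y)
    then show ?case using assms linear_maps_closed[OF one]
      by (simp add: CC.slice_pure[OF a1] CC.slice_pure[OF one] dual_smult smult_assoc1)
  next
    case (add s t)
    then show ?case using assms linear_maps_closed[OF CC.slice_linear[OF one]]
      by (simp add: linear_maps_add[OF CC.slice_linear[OF a1]] linear_maps_add[OF CC.slice_linear[OF one]] smult_r_distr)
  qed
  show "f \<otimes>\<^bsub>D\<^esub> (a \<odot>\<^bsub>D\<^esub> \<one>\<^bsub>D\<^esub>) = a \<odot>\<^bsub>D\<^esub> f"
    by (intro dual_eqI dual_extensional)
      (simp add: dual_mult_act[OF lf a1] s[OF linear_maps_closed[OF comult_lin]] act_one
        linear_maps_smult[OF lf] dual_smult assms)
qed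

lemma
  assumes "module A N" "t \<in> carrier (tensor A N C)"
  shows slice_hom: "(\<lambda>f. slice A N C f t) \<in> hom (add_monoid D) (add_monoid N)"
    and slice_smult: "a \<in> carrier A \<Longrightarrow> f \<in> carrier D \<Longrightarrow> slice A N C (a \<odot>\<^bsub>D\<^esub> f) t = a \<odot>\<^bsub>N\<^esub> slice A N C f t"
proof -
  interpret D: abelian_group D by (rule abelian_group_dual)
  interpret N: module A N by fact
  interpret NC: module_pair A N C by (intro module_pair.intro assms module_axioms)
  note sl = NC.slice_linear[OF dual_linear] and sp = NC.slice_pure[OF dual_linear]
  have "slice A N C (f \<oplus>\<^bsub>D\<^esub> g) t = slice A N C f t \<oplus>\<^bsub>N\<^esub> slice A N C g t"
    if fg: "f \<in> carrier D" "g \<in> carrier D" for f g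
    using assms(2)
  proof (induction t rule: NC.tensor_induct)
    case (pure x y)
    then show ?case using fg by (simp add: sp dual_add N.smult_l_distr dual_closed)
  next
    case (add s t)
    then show ?case using fg linear_maps_closed[OF sl]
      by (simp add: linear_maps_add[OF sl] N.M.a_ac)
  qed
  then show "(\<lambda>f. slice A N C f t) \<in> hom (add_monoid D) (add_monoid N)"
    using linear_maps_closed[OF sl assms(2)] by (simp add: hom_def)
  assume af: "a \<in> carrier A" "f \<in> carrier D"
  show "slice A N C (a \<odot>\<^bsub>D\<^esub> f) t = a \<odot>\<^bsub>N\<^esub> slice A N C f t"
    using assms(2)
  proof (induction t rule: NC.tensor_induct)
    case (pure x y)
    then show ?case using af by (simp add: sp dual_smult N.smult_assoc1 dual_closed dual_smult_closed)
  next
    case (add s t)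
    then show ?case using af linear_maps_closed[OF sl]
      by (simp add: linear_maps_add[OF sl] N.smult_r_distr dual_smult_closed)
  qed
qed

end

section \<open>Annihilators of homogeneous elements\<close>

context graded_coalgebra
begin

lemma dual_eval_hom: "c \<in> carrier C \<Longrightarrow> (\<lambda>f. f c) \<in> hom (add_monoid D) (add_monoid A)"
  by (simp add: hom_def dual_closed dual_add)

text \<open>
  The restriction of \<open>f\<close> to degree \<open>m\<close>, extended by zero; it has degree \<open>- m\<close> in the dual algebra.
\<close>

definition project :: "('c \<Rightarrow> 'a) \<Rightarrow> int \<Rightarrow> 'c \<Rightarrow> 'a" where
  "project f m = (\<lambda>x \<in> carrier C. f (component C (grade C) x m))"

lemma project_linear:
  assumes "f \<in> linear_maps A C (base_module A)"
  shows "project f m \<in> linear_maps A C (base_module A)"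
  by (rule linear_maps_cong[OF module_axioms linear_maps_compose[OF component_linear assms]])
    (simp add: project_def)

lemma project_homogeneous:
  assumes f: "f \<in> linear_maps A C (base_module A)" and x: "x \<in> grade C k"
  shows "project f m x = (if m = k then f x else \<zero>\<^bsub>A\<^esub>)"
proof -
  interpret B: module A "base_module A" by (rule module_base_module[OF R.is_cring])
  show ?thesis
    using linear_maps_zero[OF M.abelian_group_axioms B.M.abelian_group_axioms f] gr.D_carrier[OF x]
      gr.component_homogeneous[OF x] by (simp add: project_def)
qed

lemma project_grade:
  assumes "f \<in> linear_maps A C (base_module A)"
  shows "project f m \<in> grade D (- m)"
  using project_homogeneous[OF assms]
  by (intro grade_dualI project_linear[OF assms]) (auto simp: project_def)

lemma sum_project:
  assumes f: "f \<in> carrier D"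
  shows "finsum D (project f) {n. \<exists>x \<in> grade C n. f x \<noteq> \<zero>\<^bsub>A\<^esub>} = f" (is "finsum D _ ?S = f")
proof (rule dual_eqI)
  interpret D: abelian_group D by (rule abelian_group_dual)
  interpret B: module A "base_module A" by (rule module_base_module[OF R.is_cring])
  note lf = dual_linear[OF f]
  have pD: "project f m \<in> carrier D" for m using project_grade[OF lf, of m] by (simp add: grade_dual)
  then show "finsum D (project f) ?S \<in> extensional (carrier C)"
    by (intro dual_extensional D.finsum_closed) auto
  show "f \<in> extensional (carrier C)" using f by (rule dual_extensional)
  fix x assume x: "x \<in> carrier C"
  let ?T = "{n. component C (grade C) x n \<noteq> \<zero>\<^bsub>C\<^esub>}"
  have T: "finite ?T" by (rule gr.finite_support[OF x])
  have f0: "f \<zero>\<^bsub>C\<^esub> = \<zero>\<^bsub>A\<^esub>"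
    using linear_maps_zero[OF M.abelian_group_axioms B.M.abelian_group_axioms lf] by simp
  have "finsum D (project f) ?S x = finsum A (\<lambda>m. project f m x) ?S"
    by (rule hom_finsum[OF D.abelian_group_axioms R.abelian_group_axioms dual_eval_hom[OF x] dual_support[OF f] pD])
  also have "\<dots> = finsum A (\<lambda>m. project f m x) (?S \<union> ?T)"
    using dual_support[OF f] T dual_closed[OF pD x] gr.component_in[OF x] x
    by (intro R.add.finprod_mono_neutral_cong_left) (auto simp: project_def)
  also have "\<dots> = finsum A (\<lambda>m. project f m x) ?T"
    using dual_support[OF f] T dual_closed[OF pD x] x f0
    by (intro R.add.finprod_mono_neutral_cong_right) (auto simp: project_def)
  also have "\<dots> = finsum A (\<lambda>m. f (component C (grade C) x m)) ?T"
    using x by (simp add: project_def)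
  also have "\<dots> = finsum (base_module A) (\<lambda>m. f (component C (grade C) x m)) ?T"
    by (simp add: finsum_def finprod_def)
  also have "\<dots> = f (finsum C (component C (grade C) x) ?T)"
    using x by (intro hom_finsum[symmetric] M.abelian_group_axioms B.M.abelian_group_axioms linear_maps_hom[OF lf] T) auto
  also have "\<dots> = f x" using gr.sum_components[OF x] by simp
  finally show "finsum D (project f) ?S x = f x" .
qed

text \<open>
  The action respects degrees, so the degree \<open>- m\<close> part of \<open>f\<close> produces the degree \<open>n - m\<close> part
  of the result.
\<close>

lemma act_project:
  assumes f: "f \<in> linear_maps A C (base_module A)" and c: "c \<in> grade C n"
  shows "act (project f m) c = component C (grade C) (act f c) (n - m)"
proof -
  interpret CC: module_pair A C C by (rule pair)
  note pf = project_linear[OF f]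
  show ?thesis
  proof (rule CC.hom_eq_on_tensor_grade[OF M.abelian_group_axioms _ _ _ _ comult_grade[OF c]])
    show "slice A C C (project f m) \<in> hom (add_monoid (tensor A C C)) (add_monoid C)"
      by (rule linear_maps_hom[OF CC.slice_linear[OF pf]])
    show "(\<lambda>t. component C (grade C) (slice A C C f t) (n - m)) \<in> hom (add_monoid (tensor A C C)) (add_monoid C)"
      by (rule linear_maps_hom[OF linear_maps_compose[OF CC.slice_linear[OF f] component_linear]])
    fix i x y assume x: "x \<in> grade C i" and y: "y \<in> grade C (n - i)"
    have "f y \<in> carrier A" using linear_maps_closed[OF f gr.D_carrier[OF y]] by simp
    then have "component C (grade C) (f y \<odot>\<^bsub>C\<^esub> x) (n - m) = (if n - m = i then f y \<odot>\<^bsub>C\<^esub> x else \<zero>\<^bsub>C\<^esub>)"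
      by (intro gr.component_homogeneous smult_grade x)
    with x y show "slice A C C (project f m) (pure_tensor A C C x y) =
        component C (grade C) (slice A C C f (pure_tensor A C C x y)) (n - m)"
      using gr.D_carrier[OF x] gr.D_carrier[OF y]
      by (auto simp: CC.slice_pure[OF f] CC.slice_pure[OF pf] project_homogeneous[OF f y])
  qed (use gr.D_carrier in auto)
qed

text \<open>
  The annihilator of a homogeneous element is homogeneous: if \<open>f\<close> annihilates \<open>c\<close>, then each graded
  piece of \<open>f\<close> sends \<open>c\<close> to a homogeneous component of \<open>0\<close>.
\<close>

lemma annihilator_strongly_distinguished:
  assumes c: "c \<in> grade C n" "c \<noteq> \<zero>\<^bsub>C\<^esub>"
  shows "strongly_distinguished A C {f \<in> carrier D. act f c = \<zero>\<^bsub>C\<^esub>}" (is "strongly_distinguished A C ?I")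
proof -
  interpret CC: module_pair A C C by (rule pair)
  interpret D: abelian_group D by (rule abelian_group_dual)
  have cC: "c \<in> carrier C" using c(1) by (rule gr.D_carrier)
  note t = linear_maps_closed[OF comult_lin cC]
  have "additive_subgroup {f \<in> carrier D. act f c \<in> {\<zero>\<^bsub>C\<^esub>}} D"
    by (rule additive_subgroup_preimage[OF D.abelian_group_axioms M.abelian_group_axioms
          slice_hom[OF module_axioms t] additive_subgroup_zero[OF M.abelian_group_axioms]])
  then have sub: "additive_subgroup ?I D" by simp
  let ?G = "?I \<inter> (\<Union>n. grade D n)"
  have G: "additive_subgroup (generate (add_monoid D) ?G) D"
    by (rule additive_subgroup_generate[OF D.abelian_group_axioms]) auto
  have "?I \<subseteq> generate (add_monoid D) ?G"
  proof
    fix f assume "f \<in> ?I"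
    then have f: "f \<in> carrier D" and fc: "act f c = \<zero>\<^bsub>C\<^esub>" by auto
    have "project f m \<in> generate (add_monoid D) ?G" for m
    proof (rule generate.incl)
      have "act (project f m) c = \<zero>\<^bsub>C\<^esub>"
        using act_project[OF dual_linear[OF f] c(1)] fc gr.component_homogeneous[OF gr.D_zero] by simp
      moreover have "project f m \<in> grade D (- m)" by (rule project_grade[OF dual_linear[OF f]])
      moreover from this have "project f m \<in> carrier D" by (simp add: grade_dual)
      ultimately show "project f m \<in> ?G" by blast
    qed
    then have "finsum D (project f) {n. \<exists>x \<in> grade C n. f x \<noteq> \<zero>\<^bsub>A\<^esub>} \<in> generate (add_monoid D) ?G"
      by (intro additive_subgroup_finsum[OF D.abelian_group_axioms G dual_support[OF f]])
    then show "f \<in> generate (add_monoid D) ?G" by (simp add: sum_project[OF f])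
  qed
  moreover have "generate (add_monoid D) ?G \<subseteq> ?I"
    by (rule generate_subset_additive_subgroup[OF D.abelian_group_axioms sub]) auto
  moreover have "r \<otimes>\<^bsub>D\<^esub> f \<in> ?I" if r: "r \<in> carrier D" and f: "f \<in> ?I" for r f
  proof -
    have f': "f \<in> carrier D" "act f c = \<zero>\<^bsub>C\<^esub>" using f by auto
    have "act (r \<otimes>\<^bsub>D\<^esub> f) c = act r \<zero>\<^bsub>C\<^esub>"
      using act_mult[OF dual_linear[OF r] dual_linear[OF f'(1)] cC] f' by simp
    also have "\<dots> = \<zero>\<^bsub>C\<^esub>"
      using linear_maps_zero[OF M.abelian_group_axioms M.abelian_group_axioms act_linear[OF dual_linear[OF r]]] .
    finally show ?thesis using dual_mult_closed[OF r f'(1)] by simp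
  qed
  ultimately have "homogeneous_left_ideal D ?I"
    using sub by (auto simp: homogeneous_left_ideal_def homogeneous_subgroup_def)
  moreover have "\<zero>\<^bsub>adjoint_module A C (regular_comodule C)\<^esub> = \<zero>\<^bsub>C\<^esub>"
    by (simp add: adjoint_module_def regular_comodule_def)
  then have "?I = left_annihilator D (adjoint_module A C (regular_comodule C)) c"
    by (simp add: left_annihilator_def smult_adjoint_regular)
  ultimately show ?thesis
    using c unfolding strongly_distinguished_def by metis
qed

end

section \<open>Rational modules are distinguished-torsion\<close>

context graded_coalgebra
begin

text \<open>
  For a sum of tensors \<open>x\<^sub>i \<otimes> c\<^sub>i\<close> the set \<open>S\<close> consists of the nonzero homogeneous components of
  the \<open>c\<^sub>i\<close>.
\<close>

lemma slice_vanishes: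
  assumes N: "module A N" and t: "t \<in> carrier (tensor A N C)"
  shows "\<exists>S. finite S \<and> S \<subseteq> (\<Union>n. grade C n) - {\<zero>\<^bsub>C\<^esub>} \<and>
    (\<forall>f \<in> carrier D. (\<forall>c \<in> S. f c = \<zero>\<^bsub>A\<^esub>) \<longrightarrow> slice A N C f t = \<zero>\<^bsub>N\<^esub>)"
proof -
  interpret N: module A N by fact
  interpret NC: module_pair A N C by (intro module_pair.intro N module_axioms)
  interpret B: module A "base_module A" by (rule module_base_module[OF R.is_cring])
  show ?thesis
    using t
  proof (induction t rule: NC.tensor_induct)
    case (pure x c)
    let ?T = "{n. component C (grade C) c n \<noteq> \<zero>\<^bsub>C\<^esub>}"
    let ?S = "component C (grade C) c ` ?T"
    have "slice A N C f (pure_tensor A N C x c) = \<zero>\<^bsub>N\<^esub>"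
      if f: "f \<in> carrier D" and z: "\<forall>c \<in> ?S. f c = \<zero>\<^bsub>A\<^esub>" for f
    proof -
      note lf = dual_linear[OF f]
      have "f c = f (finsum C (component C (grade C) c) ?T)"
        using gr.sum_components[OF pure(2)] by simp
      also have "\<dots> = finsum (base_module A) (\<lambda>n. f (component C (grade C) c n)) ?T"
        using pure(2) by (intro hom_finsum M.abelian_group_axioms B.M.abelian_group_axioms linear_maps_hom[OF lf]
            gr.finite_support) auto
      also have "\<dots> = \<zero>\<^bsub>A\<^esub>" using z B.M.add.finprod_one_eqI[of ?T "\<lambda>n. f (component C (grade C) c n)"] by simp
      finally show ?thesis using pure by (simp add: NC.slice_pure[OF lf])
    qed
    moreover have "finite ?S" using gr.finite_support[OF pure(2)] by (rule finite_imageI)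
    moreover have "?S \<subseteq> (\<Union>n. grade C n) - {\<zero>\<^bsub>C\<^esub>}" using gr.component_in[OF pure(2)] by auto
    ultimately show ?case by (intro exI[of _ ?S] conjI ballI impI)
  next
    case (add s t)
    from add.IH(1) obtain S where
      S: "finite S" "S \<subseteq> (\<Union>n. grade C n) - {\<zero>\<^bsub>C\<^esub>}"
        "\<And>f. f \<in> carrier D \<Longrightarrow> \<forall>c \<in> S. f c = \<zero>\<^bsub>A\<^esub> \<Longrightarrow> slice A N C f s = \<zero>\<^bsub>N\<^esub>"
      by (elim exE conjE) blast
    from add.IH(2) obtain T where
      T: "finite T" "T \<subseteq> (\<Union>n. grade C n) - {\<zero>\<^bsub>C\<^esub>}"
        "\<And>f. f \<in> carrier D \<Longrightarrow> \<forall>c \<in> T. f c = \<zero>\<^bsub>A\<^esub> \<Longrightarrow> slice A N C f t = \<zero>\<^bsub>N\<^esub>"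
      by (elim exE conjE) blast
    have "slice A N C f (s \<oplus>\<^bsub>tensor A N C\<^esub> t) = \<zero>\<^bsub>N\<^esub>"
      if "f \<in> carrier D" "\<forall>c \<in> S \<union> T. f c = \<zero>\<^bsub>A\<^esub>" for f
      using that S(3)[of f] T(3)[of f] add.hyps
      by (simp add: linear_maps_add[OF NC.slice_linear[OF dual_linear[OF that(1)]]])
    with S(1,2) T(1,2) show ?case by (intro exI[of _ "S \<union> T"] conjI ballI impI) simp_all
  qed
qed

text \<open>
  The ideals are the annihilators of the elements \<open>c\<close> provided by \<open>slice_vanishes\<close> for the
  coaction of \<open>x\<close>; if \<open>f\<close> annihilates \<open>c\<close>, then \<open>f c = \<epsilon> (f \<cdot> c) = 0\<close>.
\<close>

lemma coaction_element_torsion: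
  assumes N: "graded_comodule A C N" and x: "x \<in> carrier N"
  obtains F where "finite F" "\<And>I. I \<in> F \<Longrightarrow> strongly_distinguished A C I"
    "\<And>f. f \<in> carrier D \<inter> \<Inter>F \<Longrightarrow> f \<odot>\<^bsub>adjoint_module A C N\<^esub> x = \<zero>\<^bsub>N\<^esub>"
proof -
  interpret N: graded_comodule A C N by fact
  have "coact N x \<in> carrier (tensor A N C)"
    using N.coact_linear x linear_maps_closed[of "coact N" A N "tensor A N C" x] by (simp add: graded_linear_maps_def)
  from slice_vanishes[OF N.module_axioms this] obtain S where
    S: "finite S" "S \<subseteq> (\<Union>n. grade C n) - {\<zero>\<^bsub>C\<^esub>}"
      "\<And>f. f \<in> carrier D \<Longrightarrow> \<forall>c \<in> S. f c = \<zero>\<^bsub>A\<^esub> \<Longrightarrow> slice A N C f (coact N x) = \<zero>\<^bsub>N\<^esub>"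
    by (elim exE conjE) blast
  interpret B: module A "base_module A" by (rule module_base_module[OF R.is_cring])
  show ?thesis
  proof (rule that[of "(\<lambda>c. {f \<in> carrier D. act f c = \<zero>\<^bsub>C\<^esub>}) ` S"])
    show "finite ((\<lambda>c. {f \<in> carrier D. act f c = \<zero>\<^bsub>C\<^esub>}) ` S)" using S by simp
    show "strongly_distinguished A C I" if "I \<in> (\<lambda>c. {f \<in> carrier D. act f c = \<zero>\<^bsub>C\<^esub>}) ` S" for I
      using that S(2) annihilator_strongly_distinguished by blast
    fix f assume f: "f \<in> carrier D \<inter> \<Inter>((\<lambda>c. {f \<in> carrier D. act f c = \<zero>\<^bsub>C\<^esub>}) ` S)"
    then have fD: "f \<in> carrier D" by simp
    have "f c = \<zero>\<^bsub>A\<^esub>" if "c \<in> S" for c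
    proof -
      have c: "c \<in> carrier C" "act f c = \<zero>\<^bsub>C\<^esub>" using f S(2) that gr.D_carrier by auto
      have "f c = counit C \<zero>\<^bsub>C\<^esub>" using counit_act[OF dual_linear[OF fD] c(1)] c(2) by simp
      also have "\<dots> = \<zero>\<^bsub>A\<^esub>"
        using linear_maps_zero[OF M.abelian_group_axioms B.M.abelian_group_axioms counit_lin] by simp
      finally show ?thesis .
    qed
    with S(3)[OF fD] show "f \<odot>\<^bsub>adjoint_module A C N\<^esub> x = \<zero>\<^bsub>N\<^esub>"
      by (simp add: smult_adjoint_module)
  qed
qed

text \<open>
  The image of a homogeneous element of the comodule is homogeneous and killed by the same elements
  of the dual algebra.  These images generate \<open>M\<close>, so \<open>h\<^sup>0\<close> is already everything.
\<close>

lemma rational_imp_distinguished_torsion: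
  fixes M :: "('c \<Rightarrow> 'a, 'm, 'y) gmodule_scheme"
  assumes M: "graded_left_module D M" and "rational A C M"
  shows "distinguished_torsion A C M"
proof -
  interpret L: graded_left_module D M by fact
  interpret LM: direct_sum M "grade M"
    by (intro direct_sum.intro direct_sum_axioms.intro L.direct_sum L.abelian_group_axioms)
  obtain N :: "('a, 'c, 'm) gcomodule" and \<theta> where N: "graded_comodule A C N"
    and \<theta>: "\<theta> \<in> graded_isos D (adjoint_module A C N) M"
    using assms(2) unfolding rational_def by blast
  interpret N: graded_comodule A C N by fact
  have \<theta>bij: "\<theta> ` carrier N = carrier M"
    using \<theta> by (auto simp: graded_isos_def bij_betw_def adjoint_module_def)
  have \<theta>add: "\<theta> (x \<oplus>\<^bsub>N\<^esub> y) = \<theta> x \<oplus>\<^bsub>M\<^esub> \<theta> y" if "x \<in> carrier N" "y \<in> carrier N" for x y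
    using \<theta> that by (auto simp: graded_isos_def graded_linear_maps_def linear_maps_def adjoint_module_def)
  have \<theta>grade: "\<theta> x \<in> grade M n" if "x \<in> grade N n" for x n
    using \<theta> that by (auto simp: graded_isos_def graded_linear_maps_def adjoint_module_def)
  have \<theta>smult: "\<theta> (f \<odot>\<^bsub>adjoint_module A C N\<^esub> x) = f \<odot>\<^bsub>M\<^esub> \<theta> x" if "f \<in> carrier D" "x \<in> carrier N" for f x
    using \<theta> that by (simp add: graded_isos_def graded_linear_maps_def linear_maps_def) (simp add: adjoint_module_def)
  have "\<theta> \<in> hom (add_monoid N) (add_monoid M)"
    using \<theta>bij \<theta>add by (auto simp: hom_def)
  from hom_one[OF this N.M.a_group L.a_group] have \<theta>0: "\<theta> \<zero>\<^bsub>N\<^esub> = \<zero>\<^bsub>M\<^esub>" by simp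
  let ?G = "{m. (\<exists>n. m \<in> grade M n) \<and>
         (\<exists>F. finite F \<and> (\<forall>I \<in> F. strongly_distinguished A C I) \<and>
            (\<forall>f \<in> carrier D \<inter> \<Inter>F. f \<odot>\<^bsub>M\<^esub> m = \<zero>\<^bsub>M\<^esub>))}"
  have h0: "additive_subgroup (h0_dist A C M) M"
    unfolding h0_dist_def by (rule additive_subgroup_generate[OF L.abelian_group_axioms]) (auto simp: LM.D_carrier)
  have "\<theta> x \<in> h0_dist A C M" if "x \<in> carrier N" for x
    using that
  proof (induction x rule: N.gr.homogeneous_induct)
    case (homogeneous n x)
    have x: "x \<in> carrier N" by (rule N.gr.D_carrier[OF homogeneous])
    obtain F where F: "finite F" "\<And>I. I \<in> F \<Longrightarrow> strongly_distinguished A C I"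
      "\<And>f. f \<in> carrier D \<inter> \<Inter>F \<Longrightarrow> f \<odot>\<^bsub>adjoint_module A C N\<^esub> x = \<zero>\<^bsub>N\<^esub>"
      by (rule coaction_element_torsion[OF N x]) blast
    have "f \<odot>\<^bsub>M\<^esub> \<theta> x = \<zero>\<^bsub>M\<^esub>" if "f \<in> carrier D \<inter> \<Inter>F" for f
      using \<theta>smult[of f x] F(3)[OF that] that x \<theta>0 by simp
    with F(1,2) \<theta>grade[OF homogeneous] have "\<theta> x \<in> ?G" by blast
    then show ?case unfolding h0_dist_def by (rule generate.incl)
  next
    case (add x y)
    then show ?case using \<theta>add additive_subgroup.a_closed[OF h0] by simp
  qed
  then have all: "carrier M \<subseteq> h0_dist A C M" unfolding \<theta>bij [symmetric] by (rule image_subsetI)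
  have "homogeneous_subgroup M (carrier M)"
  proof -
    have "carrier M \<inter> (\<Union>n. grade M n) = (\<Union>n. grade M n)" using LM.D_carrier by blast
    then show ?thesis
      using LM.generate_homogeneous group.subgroup_self[OF L.a_group]
      by (simp add: homogeneous_subgroup_def additive_subgroup_def)
  qed
  then have "graded_submodule D M (carrier M)"
    by (simp add: graded_submodule_def L.smult_closed)
  moreover have "h0_dist A C M \<subseteq> carrier M" by (rule additive_subgroup.a_subset[OF h0])
  ultimately show ?thesis
    using all unfolding distinguished_torsion_def H0_dist_def by (intro equalityI Inf_greatest Inf_lower) auto
qed

end

section \<open>Tensors and their slices\<close>

locale coalgebra_dual_basis = graded_coalgebra A C
  for A :: "('a, 'r) ring_scheme" and C :: "('a, 'c, 'z) gcoalgebra_scheme" +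
  fixes \<phi> :: "'j \<Rightarrow> 'c \<Rightarrow> 'a" and e :: "'j \<Rightarrow> 'c" and deg :: "'j \<Rightarrow> int"
  assumes \<phi>_grade: "\<phi> j \<in> grade (dual_algebra A C) (- deg j)"
    and e_grade: "e j \<in> grade C (deg j)"
    and expansion: "x \<in> carrier C \<Longrightarrow>
       \<forall>\<^sub>F J in finite_subsets_at_top UNIV. finsum C (\<lambda>j. \<phi> j x \<odot>\<^bsub>C\<^esub> e j) J = x"
begin

lemma \<phi>_dual: "\<phi> j \<in> carrier D"
  using \<phi>_grade by (simp add: grade_dual)

lemmas \<phi>_linear = dual_linear[OF \<phi>_dual]

lemma e_carrier: "e j \<in> carrier C"
  using e_grade by (rule gr.D_carrier)

lemma eventually_finite: "\<forall>\<^sub>F J in finite_subsets_at_top (UNIV :: 'j set). finite J"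
  by (rule eventually_finite_subsets_at_top_weakI)

lemma pure_expansion:
  assumes N: "module A N" and x: "x \<in> carrier N" and c: "c \<in> carrier C"
  shows "\<forall>\<^sub>F J in finite_subsets_at_top UNIV.
    finsum (tensor A N C) (\<lambda>j. pure_tensor A N C (\<phi> j c \<odot>\<^bsub>N\<^esub> x) (e j)) J = pure_tensor A N C x c"
  using expansion[OF c] eventually_finite
proof eventually_elim
  case (elim J)
  interpret N: module A N by fact
  interpret NC: module_pair A N C by (intro module_pair.intro N module_axioms)
  interpret T: module A "tensor A N C" by (rule NC.module_tensor)
  have \<phi>c: "\<phi> j c \<in> carrier A" for j by (rule dual_closed[OF \<phi>_dual c])
  have p: "pure_tensor A N C x \<in> linear_maps A C (tensor A N C)"
    using NC.pure_bilinear x by (simp add: bilinear_maps_def)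
  have "pure_tensor A N C x c = finsum (tensor A N C) (\<lambda>j. pure_tensor A N C x (\<phi> j c \<odot>\<^bsub>C\<^esub> e j)) J"
    using elim hom_finsum[OF M.abelian_group_axioms T.M.abelian_group_axioms linear_maps_hom[OF p] elim(2),
        of "\<lambda>j. \<phi> j c \<odot>\<^bsub>C\<^esub> e j"] \<phi>c e_carrier by simp
  then show ?case using \<phi>c e_carrier x by (simp add: NC.pure_balanced)
qed

text \<open>
  Both sides are additive in \<open>t\<close>, and for a pure tensor \<open>x \<otimes> c\<close> this is the expansion of \<open>c\<close> moved
  across the tensor sign.
\<close>

lemma tensor_expansion:
  assumes N: "module A N" and t: "t \<in> carrier (tensor A N C)"
  shows "\<forall>\<^sub>F J in finite_subsets_at_top UNIV.
    finsum (tensor A N C) (\<lambda>j. pure_tensor A N C (slice A N C (\<phi> j) t) (e j)) J = t"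
proof -
  interpret N: module A N by fact
  interpret NC: module_pair A N C by (intro module_pair.intro N module_axioms)
  interpret T: module A "tensor A N C" by (rule NC.module_tensor)
  note sl = NC.slice_linear[OF \<phi>_linear]
  show ?thesis
    using t
  proof (induction t rule: NC.tensor_induct)
    case (pure x c)
    then show ?case using pure_expansion[OF N pure] by (simp add: NC.slice_pure[OF \<phi>_linear])
  next
    case (add s t)
    from add.IH show ?case
    proof eventually_elim
      case (elim J)
      have "finsum (tensor A N C) (\<lambda>j. pure_tensor A N C (slice A N C (\<phi> j) (s \<oplus>\<^bsub>tensor A N C\<^esub> t)) (e j)) J =
        finsum (tensor A N C) (\<lambda>j. pure_tensor A N C (slice A N C (\<phi> j) s) (e j) \<oplus>\<^bsub>tensor A N C\<^esub>
          pure_tensor A N C (slice A N C (\<phi> j) t) (e j)) J"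
        using add.hyps linear_maps_closed[OF sl] e_carrier
        by (simp add: linear_maps_add[OF sl] NC.pure_add_left)
      also have "\<dots> = s \<oplus>\<^bsub>tensor A N C\<^esub> t"
        using add.hyps linear_maps_closed[OF sl] e_carrier elim
        by (subst T.M.finsum_addf) auto
      finally show ?case .
    qed
  qed
qed

text \<open>
  This is where projectivity enters the uniqueness of coactions: without it a tensor need not be
  determined by its slices.
\<close>

lemma tensor_eqI:
  assumes N: "module A N" and s: "s \<in> carrier (tensor A N C)" and t: "t \<in> carrier (tensor A N C)"
    and eq: "\<And>f. f \<in> carrier D \<Longrightarrow> slice A N C f s = slice A N C f t"
  shows "s = t"
proof -
  have "\<forall>\<^sub>F J in finite_subsets_at_top (UNIV :: 'j set). s = t"
    using tensor_expansion[OF N s] tensor_expansion[OF N t]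
  proof eventually_elim
    case (elim J)
    from elim(1) have "s = finsum (tensor A N C) (\<lambda>j. pure_tensor A N C (slice A N C (\<phi> j) s) (e j)) J"
      by (rule sym)
    also have "\<dots> = t" unfolding eq[OF \<phi>_dual] by (rule elim(2))
    finally show ?case .
  qed
  then show ?thesis by simp
qed

text \<open>
  The expansion of \<open>\<Delta> c\<close> reads \<open>\<Delta> c = (\<Sum>j. \<phi>\<^sub>j c \<otimes> e\<^sub>j)\<close>, with \<open>\<phi>\<^sub>j c\<close> the action on \<open>c\<close>.  Slicing by
  \<open>f\<close> shows that \<open>f\<close> and the finite combination of the \<open>\<phi>\<^sub>j\<close> with coefficients \<open>f (e\<^sub>j)\<close> act on \<open>c\<close>
  in the same way.  The index set depends on \<open>c\<close> alone and serves all \<open>f\<close> at once.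
\<close>

lemma act_expansion:
  assumes c: "c \<in> carrier C"
  shows "\<forall>\<^sub>F J in finite_subsets_at_top UNIV. \<forall>f \<in> carrier D.
    act (finsum D (\<lambda>j. f (e j) \<odot>\<^bsub>D\<^esub> \<phi> j) J) c = act f c"
  using tensor_expansion[OF module_axioms linear_maps_closed[OF comult_lin c]] eventually_finite
proof eventually_elim
  case (elim J)
  interpret CC: module_pair A C C by (rule pair)
  interpret T: module A "tensor A C C" by (rule CC.module_tensor)
  interpret D: abelian_group D by (rule abelian_group_dual)
  note t = linear_maps_closed[OF comult_lin c]
  show ?case
  proof
    fix f assume f: "f \<in> carrier D"
    note lf = dual_linear[OF f]
    have "act f c = slice A C C f (finsum (tensor A C C) (\<lambda>j. pure_tensor A C C (act (\<phi> j) c) (e j)) J)"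
      by (simp only: elim)
    also have "\<dots> = finsum C (\<lambda>j. slice A C C f (pure_tensor A C C (act (\<phi> j) c) (e j))) J"
      using elim(2) act_closed[OF \<phi>_linear c] e_carrier
      by (intro hom_finsum T.M.abelian_group_axioms M.abelian_group_axioms linear_maps_hom[OF CC.slice_linear[OF lf]]) simp_all
    also have "\<dots> = finsum C (\<lambda>j. f (e j) \<odot>\<^bsub>C\<^esub> act (\<phi> j) c) J"
      using act_closed[OF \<phi>_linear c] e_carrier by (simp add: CC.slice_pure[OF lf])
    also have "\<dots> = finsum C (\<lambda>j. act (f (e j) \<odot>\<^bsub>D\<^esub> \<phi> j) c) J"
      using dual_closed[OF f e_carrier] \<phi>_dual by (simp add: slice_smult[OF module_axioms t])
    also have "\<dots> = act (finsum D (\<lambda>j. f (e j) \<odot>\<^bsub>D\<^esub> \<phi> j) J) c"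
      using dual_closed[OF f e_carrier] \<phi>_dual
      by (intro hom_finsum[OF D.abelian_group_axioms M.abelian_group_axioms slice_hom[OF module_axioms t] elim(2), symmetric]
          dual_smult_closed)
    finally show "act (finsum D (\<lambda>j. f (e j) \<odot>\<^bsub>D\<^esub> \<phi> j) J) c = act f c" by simp
  qed
qed

end

section \<open>The comodule structure of a rational action\<close>

text \<open>
  An action of the dual algebra each of whose orbit maps \<open>f \<mapsto> f x\<close> is given by slicing some tensor
  \<open>\<rho> x\<close>.  Uniqueness of that tensor turns every comodule axiom for \<open>\<rho>\<close> into a property of the
  action.
\<close>

locale rational_action = coalgebra_dual_basis A C \<phi> e deg + N: graded_module A N
  for A :: "('a, 'r) ring_scheme" and C :: "('a, 'c, 'z) gcoalgebra_scheme"
    and \<phi> :: "'j \<Rightarrow> 'c \<Rightarrow> 'a" and e :: "'j \<Rightarrow> 'c" and deg :: "'j \<Rightarrow> int"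
    and N :: "('a, 'c, 'm, 'w) gcomodule_scheme" +
  fixes action :: "('c \<Rightarrow> 'a) \<Rightarrow> 'm \<Rightarrow> 'm"
  assumes action_mult: "f \<in> carrier D \<Longrightarrow> g \<in> carrier D \<Longrightarrow> x \<in> carrier N \<Longrightarrow>
      action (f \<otimes>\<^bsub>D\<^esub> g) x = action f (action g x)"
    and action_one: "x \<in> carrier N \<Longrightarrow> action \<one>\<^bsub>D\<^esub> x = x"
    and action_linear: "f \<in> carrier D \<Longrightarrow> action f \<in> linear_maps A N N"
    and action_grade: "f \<in> grade D i \<Longrightarrow> x \<in> grade N k \<Longrightarrow> action f x \<in> grade N (i + k)"
    and coact_closed: "x \<in> carrier N \<Longrightarrow> coact N x \<in> carrier (tensor A N C)"
    and slice_coact: "f \<in> carrier D \<Longrightarrow> x \<in> carrier N \<Longrightarrow> slice A N C f (coact N x) = action f x"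
begin

lemma pair_N: "module_pair A N C"
  by (intro module_pair.intro N.module_axioms module_axioms)

sublocale NC: module_pair A N C by (rule pair_N)
sublocale T: module A "tensor A N C" by (rule NC.module_tensor)

lemma coact_expansion:
  assumes "x \<in> carrier N"
  shows "\<forall>\<^sub>F J in finite_subsets_at_top UNIV.
    finsum (tensor A N C) (\<lambda>j. pure_tensor A N C (action (\<phi> j) x) (e j)) J = coact N x"
  using tensor_expansion[OF N.module_axioms coact_closed[OF assms]] assms
  by (simp add: slice_coact \<phi>_dual)

lemma coact_in_linear_maps: "coact N \<in> linear_maps A N (tensor A N C)"
proof (rule linear_mapsI)
  fix x y assume "x \<in> carrier N" "y \<in> carrier N"
  then show "coact N (x \<oplus>\<^bsub>N\<^esub> y) = coact N x \<oplus>\<^bsub>tensor A N C\<^esub> coact N y"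
    by (intro tensor_eqI[OF N.module_axioms])
      (simp_all add: coact_closed slice_coact linear_maps_add[OF NC.slice_linear[OF dual_linear]]
        linear_maps_add[OF action_linear])
next
  fix a x assume "a \<in> carrier A" "x \<in> carrier N"
  then show "coact N (a \<odot>\<^bsub>N\<^esub> x) = a \<odot>\<^bsub>tensor A N C\<^esub> coact N x"
    by (intro tensor_eqI[OF N.module_axioms])
      (simp_all add: coact_closed slice_coact linear_maps_smult[OF NC.slice_linear[OF dual_linear]]
        linear_maps_smult[OF action_linear])
qed (rule coact_closed)

text \<open>
  In the expansion \<open>\<rho> x = (\<Sum>j. \<phi>\<^sub>j x \<otimes> e\<^sub>j)\<close> the degrees of \<open>\<phi>\<^sub>j x\<close> and \<open>e\<^sub>j\<close> add up to that of \<open>x\<close>,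
  since \<open>\<phi>\<^sub>j\<close> lowers the degree by \<open>deg j\<close>.
\<close>

lemma coact_grade:
  assumes x: "x \<in> grade N n"
  shows "coact N x \<in> grade (tensor A N C) n"
proof -
  have sub: "additive_subgroup (grade (tensor A N C) n) (tensor A N C)"
    unfolding NC.grade_tensor
    by (rule additive_subgroup_generate[OF T.M.abelian_group_axioms])
      (use N.gr.D_carrier gr.D_carrier in auto)
  have "\<forall>\<^sub>F J in finite_subsets_at_top (UNIV :: 'j set). coact N x \<in> grade (tensor A N C) n"
    using coact_expansion[OF N.gr.D_carrier[OF x]] eventually_finite
  proof eventually_elim
    case (elim J)
    have "pure_tensor A N C (action (\<phi> j) x) (e j) \<in> grade (tensor A N C) n" for j
      by (rule NC.pure_in_grade[OF action_grade[OF \<phi>_grade x] e_grade]) simp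
    then have "finsum (tensor A N C) (\<lambda>j. pure_tensor A N C (action (\<phi> j) x) (e j)) J \<in> grade (tensor A N C) n"
      by (intro additive_subgroup_finsum[OF T.M.abelian_group_axioms sub elim(2)])
    with elim(1) show ?case by simp
  qed
  then show ?thesis by simp
qed

text \<open>
  Slicing the right-hand side by \<open>f\<close> amounts to slicing \<open>\<rho> x\<close> by the product of \<open>f\<close> and \<open>g\<close>.
\<close>

lemma coact_action:
  assumes g: "g \<in> carrier D" and x: "x \<in> carrier N"
  shows "coact N (action g x) = tensor_map A N C N C id (\<lambda>c. act g c) (coact N x)"
proof (rule tensor_eqI[OF N.module_axioms])
  note ag = act_linear[OF dual_linear[OF g]]
  note tm = NC.tensor_map_linear[OF pair_N linear_maps_id ag]
  show "coact N (action g x) \<in> carrier (tensor A N C)"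
    by (intro coact_closed linear_maps_closed[OF action_linear[OF g] x])
  show "tensor_map A N C N C id (\<lambda>c. act g c) (coact N x) \<in> carrier (tensor A N C)"
    by (rule linear_maps_closed[OF tm coact_closed[OF x]])
  fix f assume f: "f \<in> carrier D"
  note lf = dual_linear[OF f] and lfg = dual_mult_linear[OF dual_linear[OF f] dual_linear[OF g]]
  have "slice A N C f (tensor_map A N C N C id (\<lambda>c. act g c) (coact N x)) = slice A N C (f \<otimes>\<^bsub>D\<^esub> g) (coact N x)"
    by (rule NC.linear_eq_on_tensor[OF coact_closed[OF x] linear_maps_compose[OF tm NC.slice_linear[OF lf]] NC.slice_linear[OF lfg]])
      (simp add: NC.tensor_map_pure[OF pair_N linear_maps_id ag] NC.slice_pure[OF lf] NC.slice_pure[OF lfg]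
        act_closed[OF dual_linear[OF g]] dual_mult_act[OF lf dual_linear[OF g]])
  also have "\<dots> = action f (action g x)"
    using f g x by (simp add: slice_coact dual_mult_closed action_mult)
  also have "\<dots> = slice A N C f (coact N (action g x))"
    using f g x linear_maps_closed[OF action_linear[OF g] x] by (simp add: slice_coact)
  finally show "slice A N C f (coact N (action g x)) =
      slice A N C f (tensor_map A N C N C id (\<lambda>c. act g c) (coact N x))" by simp
qed

lemma pair_NT: "module_pair A N (tensor A C C)"
  by (intro module_pair.intro N.module_axioms module_pair.module_tensor[OF pair])

lemma pair_TC: "module_pair A (tensor A N C) C"
  by (intro module_pair.intro T.module_axioms module_axioms)

text \<open>
  The expansion of \<open>\<Delta> c\<close>, inserted into the second factor of a tensor.
\<close>

lemma comult_expansion: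
  assumes t: "t \<in> carrier (tensor A N C)"
  shows "\<forall>\<^sub>F J in finite_subsets_at_top UNIV.
    finsum (tensor A N (tensor A C C)) (\<lambda>j. tensor_assoc A N C C
      (pure_tensor A (tensor A N C) C (tensor_map A N C N C id (\<lambda>c. act (\<phi> j) c) t) (e j))) J =
    tensor_map A N C N (tensor A C C) id (comult C) t"
proof -
  interpret CC: module_pair A C C by (rule pair)
  interpret CCm: module A "tensor A C C" by (rule CC.module_tensor)
  interpret NT: module_pair A N "tensor A C C" by (rule pair_NT)
  interpret TC: module_pair A "tensor A N C" C by (rule pair_TC)
  interpret R: module A "tensor A N (tensor A C C)" by (rule NT.module_tensor)
  note as = tensor_assoc_linear[OF N.module_axioms module_axioms module_axioms]
  note tc = NC.tensor_map_linear[OF pair_NT linear_maps_id comult_lin]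
  note ag = act_linear[OF \<phi>_linear]
  note ta = NC.tensor_map_linear[OF pair_N linear_maps_id ag]
  show ?thesis
    using t
  proof (induction t rule: NC.tensor_induct)
    case (pure y c)
    note \<Delta>c = linear_maps_closed[OF comult_lin pure(2)]
    show ?case
      using tensor_expansion[OF module_axioms \<Delta>c] eventually_finite
    proof eventually_elim
      case (elim J)
      have p: "pure_tensor A N (tensor A C C) y \<in> linear_maps A (tensor A C C) (tensor A N (tensor A C C))"
        using NT.pure_bilinear pure by (simp add: bilinear_maps_def)
      have "finsum (tensor A N (tensor A C C)) (\<lambda>j. tensor_assoc A N C C
          (pure_tensor A (tensor A N C) C (tensor_map A N C N C id (\<lambda>c. act (\<phi> j) c) (pure_tensor A N C y c)) (e j))) J =
        finsum (tensor A N (tensor A C C)) (\<lambda>j. pure_tensor A N (tensor A C C) y (pure_tensor A C C (act (\<phi> j) c) (e j))) J"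
        using pure act_closed[OF \<phi>_linear] e_carrier
        by (simp add: NC.tensor_map_pure[OF pair_N linear_maps_id ag]
            tensor_assoc_pure[OF N.module_axioms module_axioms module_axioms])
      also have "\<dots> = pure_tensor A N (tensor A C C) y (finsum (tensor A C C) (\<lambda>j. pure_tensor A C C (act (\<phi> j) c) (e j)) J)"
        using pure act_closed[OF \<phi>_linear] e_carrier elim(2)
        by (intro hom_finsum[symmetric] CCm.M.abelian_group_axioms R.M.abelian_group_axioms linear_maps_hom[OF p]) simp_all
      also have "\<dots> = tensor_map A N C N (tensor A C C) id (comult C) (pure_tensor A N C y c)"
        using pure by (simp add: elim(1) NC.tensor_map_pure[OF pair_NT linear_maps_id comult_lin])
      finally show ?case .
    qed
  next
    case (add s t)
    from add.IH show ?case
    proof eventually_elim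
      case (elim J)
      let ?h = "\<lambda>j t. tensor_assoc A N C C
        (pure_tensor A (tensor A N C) C (tensor_map A N C N C id (\<lambda>c. act (\<phi> j) c) t) (e j))"
      have h: "?h j \<in> linear_maps A (tensor A N C) (tensor A N (tensor A C C))" for j
      proof -
        have "(\<lambda>u. pure_tensor A (tensor A N C) C u (e j)) \<in> linear_maps A (tensor A N C) (tensor A (tensor A N C) C)"
          using TC.pure_bilinear e_carrier by (simp add: bilinear_maps_def)
        from linear_maps_compose[OF linear_maps_compose[OF ta this] as] show ?thesis .
      qed
      have "finsum (tensor A N (tensor A C C)) (\<lambda>j. ?h j (s \<oplus>\<^bsub>tensor A N C\<^esub> t)) J =
        finsum (tensor A N (tensor A C C)) (\<lambda>j. ?h j s \<oplus>\<^bsub>tensor A N (tensor A C C)\<^esub> ?h j t) J"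
        using add.hyps by (simp add: linear_maps_add[OF h])
      also have "\<dots> = finsum (tensor A N (tensor A C C)) (\<lambda>j. ?h j s) J \<oplus>\<^bsub>tensor A N (tensor A C C)\<^esub>
          finsum (tensor A N (tensor A C C)) (\<lambda>j. ?h j t) J"
        using add.hyps linear_maps_closed[OF h] by (intro R.M.finsum_addf) auto
      also have "\<dots> = tensor_map A N C N (tensor A C C) id (comult C) (s \<oplus>\<^bsub>tensor A N C\<^esub> t)"
        by (simp only: elim linear_maps_add[OF tc add.hyps])
      finally show ?case .
    qed
  qed
qed

text \<open>
  Apply \<open>\<rho> \<otimes> id\<close> to \<open>\<rho> x = (\<Sum>j. \<phi>\<^sub>j x \<otimes> e\<^sub>j)\<close>.  By \<open>coact_action\<close> the first factors become
  \<open>\<rho> (\<phi>\<^sub>j x) = (id \<otimes> \<phi>\<^sub>j) (\<rho> x)\<close>, with \<open>\<phi>\<^sub>j\<close> acting on \<open>C\<close>, and the sum is the one that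
  \<open>comult_expansion\<close> identifies with \<open>(id \<otimes> \<Delta>) (\<rho> x)\<close>.
\<close>

lemma coact_coassociative:
  assumes x: "x \<in> carrier N"
  shows "tensor_assoc A N C C (tensor_map A N C (tensor A N C) C (coact N) id (coact N x)) =
      tensor_map A N C N (tensor A C C) id (comult C) (coact N x)"
proof -
  interpret NT: module_pair A N "tensor A C C" by (rule pair_NT)
  interpret TC: module_pair A "tensor A N C" C by (rule pair_TC)
  interpret R: module A "tensor A N (tensor A C C)" by (rule NT.module_tensor)
  note as = tensor_assoc_linear[OF N.module_axioms module_axioms module_axioms]
  note tm = NC.tensor_map_linear[OF pair_TC coact_in_linear_maps linear_maps_id]
  have "\<forall>\<^sub>F J in finite_subsets_at_top (UNIV :: 'j set).
    tensor_assoc A N C C (tensor_map A N C (tensor A N C) C (coact N) id (coact N x)) =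
      tensor_map A N C N (tensor A C C) id (comult C) (coact N x)"
    using comult_expansion[OF coact_closed[OF x]] coact_expansion[OF x] eventually_finite
  proof eventually_elim
    case (elim J)
    have a: "action (\<phi> j) x \<in> carrier N" for j
      by (rule linear_maps_closed[OF action_linear[OF \<phi>_dual] x])
    have "tensor_assoc A N C C (tensor_map A N C (tensor A N C) C (coact N) id (coact N x)) =
      tensor_assoc A N C C (tensor_map A N C (tensor A N C) C (coact N) id
        (finsum (tensor A N C) (\<lambda>j. pure_tensor A N C (action (\<phi> j) x) (e j)) J))"
      by (simp only: elim)
    also have "\<dots> = finsum (tensor A N (tensor A C C)) (\<lambda>j. tensor_assoc A N C C
        (tensor_map A N C (tensor A N C) C (coact N) id (pure_tensor A N C (action (\<phi> j) x) (e j)))) J"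
      using a e_carrier elim(3)
      by (intro hom_finsum[OF T.M.abelian_group_axioms R.M.abelian_group_axioms
            linear_maps_hom[OF linear_maps_compose[OF tm as]]]) simp_all
    also have "\<dots> = finsum (tensor A N (tensor A C C)) (\<lambda>j. tensor_assoc A N C C
      (pure_tensor A (tensor A N C) C (tensor_map A N C N C id (\<lambda>c. act (\<phi> j) c) (coact N x)) (e j))) J"
      using a e_carrier
      by (simp add: NC.tensor_map_pure[OF pair_TC coact_in_linear_maps linear_maps_id] coact_action[OF \<phi>_dual x])
    also have "\<dots> = tensor_map A N C N (tensor A C C) id (comult C) (coact N x)" by (rule elim(1))
    finally show ?case .
  qed
  then show ?thesis by simp
qed

lemma graded_comodule: "graded_comodule A C N"
proof (intro graded_comodule.intro graded_comodule_axioms.intro)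
  show "graded_module A N" by (rule N.graded_module_axioms)
  show "coact N \<in> graded_linear_maps A N (tensor A N C)"
    using coact_in_linear_maps coact_grade by (auto simp: graded_linear_maps_def)
  fix x assume x: "x \<in> carrier N"
  show "tensor_assoc A N C C (tensor_map A N C (tensor A N C) C (coact N) id (coact N x)) =
      tensor_map A N C N (tensor A C C) id (comult C) (coact N x)"
    by (rule coact_coassociative[OF x])
  have "slice A N C (counit C) (coact N x) = slice A N C \<one>\<^bsub>D\<^esub> (coact N x)"
    by (rule NC.slice_cong[OF dual_linear[OF dual_one_closed] _ coact_closed[OF x]]) (simp add: dual_one)
  then show "tensor_right_unit A N (tensor_map A N C N (base_module A) id (counit C) (coact N x)) = x"
    using x by (simp add: slice_def[symmetric] slice_coact dual_one_closed action_one)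
qed

end

section \<open>Distinguished-torsion modules are rational\<close>

text \<open>
  The ring \<open>A\<close> acts on \<open>M\<close> through the scalars \<open>a \<epsilon>\<close> of the dual algebra.  The coaction \<open>\<rho>\<close> is a
  parameter because the tensor product in which it takes its values is formed from this module
  structure; with \<open>\<rho>\<close> undefined the record serves as the underlying module.
\<close>

definition comodule_of_coaction ::
  "('a, 'r) ring_scheme \<Rightarrow> ('a, 'c, 'z) gcoalgebra_scheme \<Rightarrow> ('c \<Rightarrow> 'a, 'm, 'y) gmodule_scheme \<Rightarrow>
     ('m \<Rightarrow> ('m \<times> 'c \<Rightarrow>\<^sub>0 int) set) \<Rightarrow> ('a, 'c, 'm) gcomodule" where
  "comodule_of_coaction A C M \<rho> =
     \<lparr>carrier = carrier M, monoid.mult = undefined, monoid.one = undefined,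
      ring.zero = \<zero>\<^bsub>M\<^esub>, ring.add = add M,
      smult = (\<lambda>a x. (a \<odot>\<^bsub>dual_algebra A C\<^esub> \<one>\<^bsub>dual_algebra A C\<^esub>) \<odot>\<^bsub>M\<^esub> x),
      grade = grade M, coact = \<rho>\<rparr>"

locale module_over_dual = coalgebra_dual_basis A C \<phi> e deg + L: graded_left_module "dual_algebra A C" M
  for A :: "('a, 'r) ring_scheme" and C :: "('a, 'c, 'z) gcoalgebra_scheme"
    and \<phi> :: "'j \<Rightarrow> 'c \<Rightarrow> 'a" and e :: "'j \<Rightarrow> 'c" and deg :: "'j \<Rightarrow> int"
    and M :: "('c \<Rightarrow> 'a, 'm, 'y) gmodule_scheme"
begin

abbreviation "com \<equiv> comodule_of_coaction A C M"

abbreviation "N0 \<equiv> com undefined"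

lemma com_simps [simp]:
  "carrier (com \<rho>) = carrier M" "\<zero>\<^bsub>com \<rho>\<^esub> = \<zero>\<^bsub>M\<^esub>" "x \<oplus>\<^bsub>com \<rho>\<^esub> y = x \<oplus>\<^bsub>M\<^esub> y"
  "a \<odot>\<^bsub>com \<rho>\<^esub> x = (a \<odot>\<^bsub>D\<^esub> \<one>\<^bsub>D\<^esub>) \<odot>\<^bsub>M\<^esub> x" "grade (com \<rho>) = grade M" "coact (com \<rho>) = \<rho>"
  by (simp_all add: comodule_of_coaction_def)

lemma smult_dual_smult:
  assumes "a \<in> carrier A" "f \<in> carrier D" "x \<in> carrier M"
  shows "(a \<odot>\<^bsub>D\<^esub> f) \<odot>\<^bsub>M\<^esub> x = a \<odot>\<^bsub>com \<rho>\<^esub> (f \<odot>\<^bsub>M\<^esub> x)"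
    and "f \<odot>\<^bsub>M\<^esub> (a \<odot>\<^bsub>com \<rho>\<^esub> x) = (a \<odot>\<^bsub>D\<^esub> f) \<odot>\<^bsub>M\<^esub> x"
  using assms dual_smult_one_mult[OF assms(1,2)] dual_smult_closed[OF assms(1) dual_one_closed]
  by (simp_all flip: L.smult_assoc)

lemma scalar_add:
  assumes "a \<in> carrier A" "b \<in> carrier A"
  shows "(a \<oplus>\<^bsub>A\<^esub> b) \<odot>\<^bsub>D\<^esub> \<one>\<^bsub>D\<^esub> = a \<odot>\<^bsub>D\<^esub> \<one>\<^bsub>D\<^esub> \<oplus>\<^bsub>D\<^esub> b \<odot>\<^bsub>D\<^esub> \<one>\<^bsub>D\<^esub>"
  by (intro dual_eqI dual_extensional)
    (simp add: dual_smult dual_add assms R.l_distr dual_closed[OF dual_one_closed])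

lemma scalar_mult:
  assumes "a \<in> carrier A" "b \<in> carrier A"
  shows "(a \<otimes>\<^bsub>A\<^esub> b) \<odot>\<^bsub>D\<^esub> \<one>\<^bsub>D\<^esub> = a \<odot>\<^bsub>D\<^esub> (b \<odot>\<^bsub>D\<^esub> \<one>\<^bsub>D\<^esub>)"
  by (intro dual_eqI dual_extensional)
    (simp add: dual_smult assms R.m_assoc dual_closed[OF dual_one_closed])

lemma scalar_one: "\<one>\<^bsub>A\<^esub> \<odot>\<^bsub>D\<^esub> \<one>\<^bsub>D\<^esub> = \<one>\<^bsub>D\<^esub>"
  by (intro dual_eqI dual_extensional)
    (simp add: dual_smult dual_closed[OF dual_one_closed])

lemma graded_module_com: "graded_module A (com \<rho>)"
proof -
  have "abelian_group (com \<rho>)"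
    by (rule abelian_groupI) (auto simp: L.a_ac intro: L.r_neg)
  then have "module A (com \<rho>)"
    using dual_smult_closed[OF _ dual_one_closed]
    by (intro moduleI R.is_cring)
      (simp_all add: L.smult_closed scalar_add L.smult_l_distr L.smult_r_distr scalar_mult
        smult_dual_smult(1)[where \<rho> = undefined] scalar_one L.smult_one)
  moreover have "internal_direct_sum (com \<rho>) (grade (com \<rho>))"
  proof -
    have "finsum (com \<rho>) c J = finsum M c J" for c :: "int \<Rightarrow> 'm" and J
      by (simp add: finsum_def finprod_def comodule_of_coaction_def)
    moreover have "additive_subgroup H (com \<rho>) \<longleftrightarrow> additive_subgroup H M" for H
      by (simp add: additive_subgroup_def subgroup_def a_inv_def m_inv_def comodule_of_coaction_def)
    ultimately show ?thesis
      using L.direct_sum by (simp add: internal_direct_sum_def)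
  qed
  moreover have "a \<odot>\<^bsub>com \<rho>\<^esub> x \<in> grade (com \<rho>) n" if "a \<in> carrier A" "x \<in> grade (com \<rho>) n" for a x n
    using L.smult_grade[OF dual_smult_grade[OF that(1) dual_one_grade], of x n] that by simp
  ultimately show ?thesis
    by (simp add: graded_module_def graded_module_axioms_def)
qed

lemma tensor_com: "tensor A (com \<rho>) C = tensor A N0 C"
  by (rule tensor_cong) simp_all

lemma slice_com: "slice A (com \<rho>) C = slice A N0 C"
  by (rule ext, rule slice_module_cong) simp_all

sublocale N0: graded_module A N0 by (rule graded_module_com)
sublocale NC: module_pair A N0 C by (intro module_pair.intro N0.module_axioms module_axioms)
sublocale T: module A "tensor A N0 C" by (rule NC.module_tensor)
sublocale gM: direct_sum M "grade M"
  by (intro direct_sum.intro direct_sum_axioms.intro L.direct_sum L.abelian_group_axioms)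

text \<open>
  The tensor \<open>t\<close> is the only possible value at \<open>x\<close> of a coaction inducing the given module
  structure.
\<close>

definition represents :: "('m \<times> 'c \<Rightarrow>\<^sub>0 int) set \<Rightarrow> 'm \<Rightarrow> bool" where
  "represents t x \<longleftrightarrow> t \<in> carrier (tensor A N0 C) \<and> (\<forall>f \<in> carrier D. slice A N0 C f t = f \<odot>\<^bsub>M\<^esub> x)"

definition rational_part :: "'m set" where
  "rational_part = {x \<in> carrier M. \<exists>t. represents t x}"

lemma smult_hom:
  "f \<in> carrier D \<Longrightarrow> (\<lambda>x. f \<odot>\<^bsub>M\<^esub> x) \<in> hom (add_monoid M) (add_monoid M)"
  "x \<in> carrier M \<Longrightarrow> (\<lambda>f. f \<odot>\<^bsub>M\<^esub> x) \<in> hom (add_monoid D) (add_monoid M)"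
  by (simp_all add: hom_def L.smult_closed L.smult_l_distr L.smult_r_distr)

text \<open>
  If \<open>t = (\<Sum>i. x\<^sub>i \<otimes> c\<^sub>i)\<close> represents \<open>x\<close>, then \<open>(\<Sum>i. x\<^sub>i \<otimes> g c\<^sub>i)\<close> represents \<open>g x\<close>, where \<open>g c\<^sub>i\<close>
  is the action of \<open>g\<close> on \<open>C\<close>.
\<close>

lemma rational_part_smult:
  assumes g: "g \<in> carrier D" and "x \<in> rational_part"
  shows "g \<odot>\<^bsub>M\<^esub> x \<in> rational_part"
proof -
  from assms obtain t where x: "x \<in> carrier M" and t: "t \<in> carrier (tensor A N0 C)"
    and tx: "\<And>f. f \<in> carrier D \<Longrightarrow> slice A N0 C f t = f \<odot>\<^bsub>M\<^esub> x"
    by (auto simp: rational_part_def represents_def)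
  note ag = act_linear[OF dual_linear[OF g]]
  note tm = NC.tensor_map_linear[OF NC.module_pair_axioms linear_maps_id ag]
  have "slice A N0 C f (tensor_map A N0 C N0 C id (\<lambda>c. act g c) t) = f \<odot>\<^bsub>M\<^esub> (g \<odot>\<^bsub>M\<^esub> x)" if f: "f \<in> carrier D" for f
  proof -
    note lf = dual_linear[OF f] and lfg = dual_mult_linear[OF dual_linear[OF f] dual_linear[OF g]]
    have "slice A N0 C f (tensor_map A N0 C N0 C id (\<lambda>c. act g c) t) = slice A N0 C (f \<otimes>\<^bsub>D\<^esub> g) t"
      by (rule NC.linear_eq_on_tensor[OF t linear_maps_compose[OF tm NC.slice_linear[OF lf]] NC.slice_linear[OF lfg]])
        (simp add: NC.tensor_map_pure[OF NC.module_pair_axioms linear_maps_id ag] NC.slice_pure[OF lf] NC.slice_pure[OF lfg]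
          act_closed[OF dual_linear[OF g]] dual_mult_act[OF lf dual_linear[OF g]] del: com_simps(4))
    also have "\<dots> = f \<odot>\<^bsub>M\<^esub> (g \<odot>\<^bsub>M\<^esub> x)"
      using f g x by (simp add: tx dual_mult_closed L.smult_assoc)
    finally show ?thesis .
  qed
  then have "represents (tensor_map A N0 C N0 C id (\<lambda>c. act g c) t) (g \<odot>\<^bsub>M\<^esub> x)"
    using linear_maps_closed[OF tm t] by (simp add: represents_def)
  with g x show ?thesis by (auto simp: rational_part_def L.smult_closed)
qed

lemma additive_subgroup_rational_part: "additive_subgroup rational_part M"
proof (rule additive_subgroupI, rule L.add.subgroupI)
  interpret D: abelian_group D by (rule abelian_group_dual)
  have "represents \<zero>\<^bsub>tensor A N0 C\<^esub> \<zero>\<^bsub>M\<^esub>"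
    unfolding represents_def
  proof (intro conjI ballI)
    fix f assume f: "f \<in> carrier D"
    have "slice A N0 C f \<zero>\<^bsub>tensor A N0 C\<^esub> = \<zero>\<^bsub>M\<^esub>"
      using linear_maps_zero[OF T.M.abelian_group_axioms N0.M.abelian_group_axioms NC.slice_linear[OF dual_linear[OF f]]] by simp
    moreover have "f \<odot>\<^bsub>M\<^esub> \<zero>\<^bsub>M\<^esub> = \<zero>\<^bsub>M\<^esub>"
      using hom_one[OF smult_hom(1)[OF f] L.a_group L.a_group] by simp
    ultimately show "slice A N0 C f \<zero>\<^bsub>tensor A N0 C\<^esub> = f \<odot>\<^bsub>M\<^esub> \<zero>\<^bsub>M\<^esub>" by simp
  qed simp
  then show "rational_part \<noteq> {}" unfolding rational_part_def using L.zero_closed by blast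
  show "rational_part \<subseteq> carrier M" by (auto simp: rational_part_def)
  fix x assume x: "x \<in> rational_part"
  then have xM: "x \<in> carrier M" by (simp add: rational_part_def)
  interpret h: group_hom "add_monoid D" "add_monoid M" "\<lambda>f. f \<odot>\<^bsub>M\<^esub> x"
    by (simp add: group_hom_def group_hom_axioms_def smult_hom(2)[OF xM] D.a_group L.a_group)
  \<comment> \<open>Negatives come from the closure under the action of \<open>- \<epsilon>\<close>.\<close>
  have "(\<ominus>\<^bsub>D\<^esub> \<one>\<^bsub>D\<^esub>) \<odot>\<^bsub>M\<^esub> x = \<ominus>\<^bsub>M\<^esub> x"
    using h.hom_inv[of "\<one>\<^bsub>D\<^esub>"] dual_one_closed L.smult_one[OF xM] by (simp flip: a_inv_def)
  then show "\<ominus>\<^bsub>M\<^esub> x \<in> rational_part"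
    using rational_part_smult[OF _ x, of "\<ominus>\<^bsub>D\<^esub> \<one>\<^bsub>D\<^esub>"] dual_one_closed by simp
  fix y assume y: "y \<in> rational_part"
  from x y obtain s t where "represents s x" "represents t y" by (auto simp: rational_part_def)
  then have "represents (s \<oplus>\<^bsub>tensor A N0 C\<^esub> t) (x \<oplus>\<^bsub>M\<^esub> y)"
    using xM y by (auto simp: represents_def rational_part_def L.smult_r_distr
        linear_maps_add[OF NC.slice_linear[OF dual_linear]])
  then show "x \<oplus>\<^bsub>M\<^esub> y \<in> rational_part"
    using xM y by (auto simp: rational_part_def)
qed

text \<open>
  Choose \<open>J\<close> so large that, by \<open>act_expansion\<close>, the elements \<open>f\<close> and \<open>\<Sum>j\<in>J. f (e\<^sub>j) \<phi>\<^sub>j\<close> act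
  alike on the finitely many \<open>c\<close> whose annihilators lie in \<open>F\<close>.  Their difference lies in the
  intersection and so kills \<open>m\<close>.  Hence \<open>f m = (\<Sum>j\<in>J. f (e\<^sub>j) (\<phi>\<^sub>j m))\<close>, which is the slice by \<open>f\<close>
  of \<open>\<Sum>j\<in>J. \<phi>\<^sub>j m \<otimes> e\<^sub>j\<close>.
\<close>

lemma torsion_in_rational_part:
  assumes m: "m \<in> carrier M" and F: "finite F" "\<And>I. I \<in> F \<Longrightarrow> strongly_distinguished A C I"
    and kill: "\<And>f. f \<in> carrier D \<inter> \<Inter>F \<Longrightarrow> f \<odot>\<^bsub>M\<^esub> m = \<zero>\<^bsub>M\<^esub>"
  shows "m \<in> rational_part"
proof -
  interpret D: abelian_group D by (rule abelian_group_dual)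
  have "\<exists>c. c \<in> carrier C \<and> I = {f \<in> carrier D. act f c = \<zero>\<^bsub>C\<^esub>}" if I: "I \<in> F" for I
  proof -
    obtain n c where "c \<in> grade C n" "I = left_annihilator D (adjoint_module A C (regular_comodule C)) c"
      using F(2)[OF I] unfolding strongly_distinguished_def by blast
    moreover have "\<zero>\<^bsub>adjoint_module A C (regular_comodule C)\<^esub> = \<zero>\<^bsub>C\<^esub>"
      by (simp add: adjoint_module_def regular_comodule_def)
    ultimately show ?thesis
      by (intro exI[of _ c]) (simp add: left_annihilator_def smult_adjoint_regular gr.D_carrier)
  qed
  then have "\<forall>I \<in> F. \<exists>c. c \<in> carrier C \<and> I = {f \<in> carrier D. act f c = \<zero>\<^bsub>C\<^esub>}"
    by (rule ballI)
  then obtain c where cI: "\<forall>I \<in> F. c I \<in> carrier C \<and> I = {f \<in> carrier D. act f (c I) = \<zero>\<^bsub>C\<^esub>}"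
    by (rule bchoice[THEN exE])
  have c: "\<And>I. I \<in> F \<Longrightarrow> c I \<in> carrier C"
    and I: "\<And>I. I \<in> F \<Longrightarrow> I = {f \<in> carrier D. act f (c I) = \<zero>\<^bsub>C\<^esub>}"
    by (drule bspec[OF cI], erule conjunct1) (drule bspec[OF cI], erule conjunct2)
  have "\<forall>\<^sub>F J in finite_subsets_at_top (UNIV :: 'j set). \<forall>I \<in> F. \<forall>f \<in> carrier D.
      act (finsum D (\<lambda>j. f (e j) \<odot>\<^bsub>D\<^esub> \<phi> j) J) (c I) = act f (c I)"
    using F(1) act_expansion c by (simp add: eventually_ball_finite_distrib)
  with eventually_finite have "\<forall>\<^sub>F J in finite_subsets_at_top (UNIV :: 'j set). finite J \<and> (\<forall>I \<in> F. \<forall>f \<in> carrier D.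
      act (finsum D (\<lambda>j. f (e j) \<odot>\<^bsub>D\<^esub> \<phi> j) J) (c I) = act f (c I))"
    by (rule eventually_conj)
  from eventually_happens'[OF finite_subsets_at_top_neq_bot this]
  obtain J where J_exp: "finite J \<and> (\<forall>I \<in> F. \<forall>f \<in> carrier D.
      act (finsum D (\<lambda>j. f (e j) \<odot>\<^bsub>D\<^esub> \<phi> j) J) (c I) = act f (c I))"
    by (rule exE)
  note J = J_exp[THEN conjunct1]
  note exp = J_exp[THEN conjunct2, THEN bspec, THEN bspec]
  define t where "t = finsum (tensor A N0 C) (\<lambda>j. pure_tensor A N0 C (\<phi> j \<odot>\<^bsub>M\<^esub> m) (e j)) J"
  have \<phi>m: "\<phi> j \<odot>\<^bsub>M\<^esub> m \<in> carrier M" for j using L.smult_closed[OF \<phi>_dual m] .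
  have "slice A N0 C f t = f \<odot>\<^bsub>M\<^esub> m" if f: "f \<in> carrier D" for f
  proof -
    note lf = dual_linear[OF f]
    let ?g = "finsum D (\<lambda>j. f (e j) \<odot>\<^bsub>D\<^esub> \<phi> j) J"
    have s: "f (e j) \<odot>\<^bsub>D\<^esub> \<phi> j \<in> carrier D" for j
      by (intro dual_smult_closed dual_closed[OF f] e_carrier \<phi>_dual)
    then have g: "?g \<in> carrier D" by (intro D.finsum_closed) auto
    have "f \<ominus>\<^bsub>D\<^esub> ?g \<in> carrier D \<inter> \<Inter>F"
    proof (intro IntI InterI)
      show "f \<ominus>\<^bsub>D\<^esub> ?g \<in> carrier D" using f g by simp
      fix I assume "I \<in> F"
      note cI = c[OF this] and eI = exp[OF this f] and II = I[OF this]
      note h = slice_hom[OF module_axioms linear_maps_closed[OF comult_lin cI]]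
      interpret h: group_hom "add_monoid D" "add_monoid C" "\<lambda>f. act f (c I)"
        by (simp add: group_hom_def group_hom_axioms_def h D.a_group M.a_group)
      have "act (f \<ominus>\<^bsub>D\<^esub> ?g) (c I) = act f (c I) \<ominus>\<^bsub>C\<^esub> act ?g (c I)"
        using h.hom_mult[of f "\<ominus>\<^bsub>D\<^esub> ?g"] h.hom_inv[of ?g] f g
        by (simp add: a_minus_def flip: a_inv_def)
      also have "\<dots> = \<zero>\<^bsub>C\<^esub>"
        unfolding eI using act_closed[OF lf cI] by (simp add: M.r_neg a_minus_def)
      finally show "f \<ominus>\<^bsub>D\<^esub> ?g \<in> I" using f g by (subst II) simp
    qed
    from kill[OF this] have z: "(f \<ominus>\<^bsub>D\<^esub> ?g) \<odot>\<^bsub>M\<^esub> m = \<zero>\<^bsub>M\<^esub>" .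
    have "f = (f \<ominus>\<^bsub>D\<^esub> ?g) \<oplus>\<^bsub>D\<^esub> ?g"
      using f g by (simp add: a_minus_def D.a_assoc D.l_neg)
    then have "f \<odot>\<^bsub>M\<^esub> m = ((f \<ominus>\<^bsub>D\<^esub> ?g) \<oplus>\<^bsub>D\<^esub> ?g) \<odot>\<^bsub>M\<^esub> m" by simp
    also have "\<dots> = ?g \<odot>\<^bsub>M\<^esub> m"
      using f g m z by (simp add: L.smult_l_distr L.smult_closed)
    also have "\<dots> = finsum M (\<lambda>j. (f (e j) \<odot>\<^bsub>D\<^esub> \<phi> j) \<odot>\<^bsub>M\<^esub> m) J"
      by (rule hom_finsum[OF D.abelian_group_axioms L.abelian_group_axioms smult_hom(2)[OF m] J s])
    also have "\<dots> = finsum N0 (\<lambda>j. slice A N0 C f (pure_tensor A N0 C (\<phi> j \<odot>\<^bsub>M\<^esub> m) (e j))) J"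
      using \<phi>m e_carrier dual_closed[OF f e_carrier] \<phi>_dual m
      by (simp add: NC.slice_pure[OF lf] smult_dual_smult(1)[where \<rho> = undefined] finsum_def finprod_def)
         (simp add: comodule_of_coaction_def)
    also have "\<dots> = slice A N0 C f t"
      unfolding t_def using \<phi>m e_carrier
      by (intro hom_finsum[OF T.M.abelian_group_axioms N0.M.abelian_group_axioms linear_maps_hom[OF NC.slice_linear[OF lf]] J, symmetric])
        simp
    finally show ?thesis by simp
  qed
  moreover have "t \<in> carrier (tensor A N0 C)"
    unfolding t_def using \<phi>m e_carrier by (intro T.M.finsum_closed) auto
  ultimately have "represents t m" by (simp add: represents_def)
  with m show ?thesis by (auto simp: rational_part_def)
qed

text \<open>
  The homogeneous elements of the rational part generate a graded submodule, and this submodule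
  contains the generators of \<open>h\<^sup>0\<close>.
\<close>

lemma H0_dist_in_rational_part: "H0_dist A C M \<subseteq> rational_part"
proof -
  interpret D: abelian_group D by (rule abelian_group_dual)
  interpret RP: additive_subgroup rational_part M by (rule additive_subgroup_rational_part)
  let ?S = "rational_part \<inter> (\<Union>n. grade M n)"
  let ?H = "generate (add_monoid M) ?S"
  have SM: "?S \<subseteq> carrier M" using RP.a_subset by blast
  have H: "additive_subgroup ?H M" by (rule additive_subgroup_generate[OF L.abelian_group_axioms SM])
  have HR: "?H \<subseteq> rational_part"
    by (rule generate_subset_additive_subgroup[OF L.abelian_group_axioms RP.additive_subgroup_axioms]) simp
  have hom: "r \<odot>\<^bsub>M\<^esub> x \<in> ?H" if r: "r \<in> carrier D" and x: "x \<in> ?S" for r x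
  proof -
    from x obtain k where k: "x \<in> grade M k" and xR: "x \<in> rational_part" by blast
    have p: "project r m \<in> grade D (- m)" for m by (rule project_grade[OF dual_linear[OF r]])
    then have pD: "project r m \<in> carrier D" for m by (simp add: grade_dual)
    have "project r m \<odot>\<^bsub>M\<^esub> x \<in> ?H" for m
      using L.smult_grade[OF p k] rational_part_smult[OF pD xR] by (intro generate.incl) blast
    then have "finsum M (\<lambda>m. project r m \<odot>\<^bsub>M\<^esub> x) {n. \<exists>x \<in> grade C n. r x \<noteq> \<zero>\<^bsub>A\<^esub>} \<in> ?H"
      by (intro additive_subgroup_finsum[OF L.abelian_group_axioms H dual_support[OF r]])
    moreover have "finsum M (\<lambda>m. project r m \<odot>\<^bsub>M\<^esub> x) {n. \<exists>x \<in> grade C n. r x \<noteq> \<zero>\<^bsub>A\<^esub>} = r \<odot>\<^bsub>M\<^esub> x"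
      using hom_finsum[OF D.abelian_group_axioms L.abelian_group_axioms smult_hom(2)[OF gM.D_carrier[OF k]] dual_support[OF r], of "project r"] pD
      by (simp add: sum_project[OF r])
    ultimately show ?thesis by simp
  qed
  have "r \<odot>\<^bsub>M\<^esub> x \<in> ?H" if r: "r \<in> carrier D" and x: "x \<in> ?H" for r x
  proof -
    have "?H \<subseteq> {x \<in> carrier M. r \<odot>\<^bsub>M\<^esub> x \<in> ?H}"
      by (rule generate_subset_additive_subgroup[OF L.abelian_group_axioms
            additive_subgroup_preimage[OF L.abelian_group_axioms L.abelian_group_axioms smult_hom(1)[OF r] H]])
        (use hom[OF r] SM in blast)
    with x show ?thesis by blast
  qed
  moreover have "homogeneous_subgroup M ?H"
  proof -
    have "generate (add_monoid M) (?H \<inter> (\<Union>n. grade M n)) \<subseteq> ?H"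
      by (rule generate_subset_additive_subgroup[OF L.abelian_group_axioms H]) simp
    moreover have "?S \<subseteq> ?H \<inter> (\<Union>n. grade M n)" by (auto intro: generate.incl)
    then have "?H \<subseteq> generate (add_monoid M) (?H \<inter> (\<Union>n. grade M n))"
      by (rule group.mono_generate[OF L.a_group])
    ultimately show ?thesis using H unfolding homogeneous_subgroup_def by (intro conjI equalityI)
  qed
  ultimately have sub: "graded_submodule D M ?H" by (simp add: graded_submodule_def)
  have "h0_dist A C M \<subseteq> ?H"
    unfolding h0_dist_def
  proof (rule generate_subset_additive_subgroup[OF L.abelian_group_axioms H], rule subsetI)
    fix m assume "m \<in> {m. (\<exists>n. m \<in> grade M n) \<and>
         (\<exists>F. finite F \<and> (\<forall>I \<in> F. strongly_distinguished A C I) \<and>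
            (\<forall>f \<in> carrier D \<inter> \<Inter>F. f \<odot>\<^bsub>M\<^esub> m = \<zero>\<^bsub>M\<^esub>))}"
    then obtain n F where n: "m \<in> grade M n" and F: "finite F" "\<forall>I \<in> F. strongly_distinguished A C I"
        "\<forall>f \<in> carrier D \<inter> \<Inter>F. f \<odot>\<^bsub>M\<^esub> m = \<zero>\<^bsub>M\<^esub>"
      by (elim CollectE conjE exE)
    have "m \<in> rational_part"
      by (rule torsion_in_rational_part[OF gM.D_carrier[OF n] F(1)]) (use F(2,3) in auto)
    with n show "m \<in> ?H" by (intro generate.incl) blast
  qed
  with sub have "H0_dist A C M \<subseteq> ?H" unfolding H0_dist_def by (intro Inter_lower) simp
  with HR show ?thesis by (rule order_trans[rotated])
qed

lemma rational_if_rational_part_everything: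
  assumes all: "rational_part = carrier M"
  shows "rational A C M"
proof -
  define \<rho> where "\<rho> x = (SOME t. represents t x)" for x
  have \<rho>: "represents (\<rho> x) x" if "x \<in> carrier M" for x
  proof -
    have "x \<in> rational_part" using that all by simp
    then have "\<exists>t. represents t x" by (simp add: rational_part_def)
    then show ?thesis unfolding \<rho>_def by (rule someI_ex)
  qed
  interpret N: graded_module A "com \<rho>" by (rule graded_module_com)
  have closed: "\<rho> x \<in> carrier (tensor A N0 C)" if "x \<in> carrier M" for x
    using \<rho>[OF that] by (simp add: represents_def)
  have slice: "slice A N0 C f (\<rho> x) = f \<odot>\<^bsub>M\<^esub> x" if "f \<in> carrier D" "x \<in> carrier M" for f x
    using \<rho>[OF that(2)] that(1) by (simp add: represents_def)
  have lin: "(\<lambda>x. f \<odot>\<^bsub>M\<^esub> x) \<in> linear_maps A (com \<rho>) (com \<rho>)" if f: "f \<in> carrier D" for f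
    using f smult_dual_smult[of _ f _ \<rho>]
    by (intro linear_mapsI) (simp_all add: L.smult_closed L.smult_r_distr)
  interpret act: rational_action A C \<phi> e deg "com \<rho>" "smult M"
  proof (intro rational_action.intro coalgebra_dual_basis_axioms N.graded_module_axioms rational_action_axioms.intro)
    fix x assume "x \<in> carrier (com \<rho>)"
    then have x: "x \<in> carrier M" by simp
    show "\<one>\<^bsub>D\<^esub> \<odot>\<^bsub>M\<^esub> x = x" by (rule L.smult_one[OF x])
    show "coact (com \<rho>) x \<in> carrier (tensor A (com \<rho>) C)"
      unfolding tensor_com[of \<rho>] com_simps by (rule closed[OF x])
    fix f assume f: "f \<in> carrier D"
    show "slice A (com \<rho>) C f (coact (com \<rho>) x) = f \<odot>\<^bsub>M\<^esub> x"
      unfolding slice_com[of \<rho>] com_simps by (rule slice[OF f x])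
    fix g assume "g \<in> carrier D"
    then show "(f \<otimes>\<^bsub>D\<^esub> g) \<odot>\<^bsub>M\<^esub> x = f \<odot>\<^bsub>M\<^esub> (g \<odot>\<^bsub>M\<^esub> x)"
      by (rule L.smult_assoc[OF f _ x])
  next
    show "smult M f \<in> linear_maps A (com \<rho>) (com \<rho>)" if "f \<in> carrier D" for f
      using lin[OF that] .
    show "f \<odot>\<^bsub>M\<^esub> x \<in> grade (com \<rho>) (i + k)" if "f \<in> grade D i" "x \<in> grade (com \<rho>) k" for f i x k
      using L.smult_grade[OF that(1), of x k] that(2) by simp
  qed
  have "id \<in> graded_isos D (adjoint_module A C (com \<rho>)) M"
  proof -
    have "smult (adjoint_module A C (com \<rho>)) f x = f \<odot>\<^bsub>M\<^esub> x" if "f \<in> carrier D" "x \<in> carrier M" for f x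
      using that by (simp add: smult_adjoint_module slice_com[of \<rho>] slice)
    then show ?thesis
      by (auto simp: graded_isos_def graded_linear_maps_def linear_maps_def bij_betw_def)
        (simp_all add: adjoint_module_def)
  qed
  then show ?thesis
    unfolding rational_def using act.graded_comodule by blast
qed

lemma distinguished_torsion_imp_rational:
  assumes "distinguished_torsion A C M"
  shows "rational A C M"
proof (rule rational_if_rational_part_everything)
  show "rational_part = carrier M"
    using H0_dist_in_rational_part assms additive_subgroup.a_subset[OF additive_subgroup_rational_part]
    by (simp add: distinguished_torsion_def)
qed

end

theorem corollary3p8:
  fixes A :: "('a, 'r) ring_scheme"
    and \<Gamma> :: "('a, 'c, 'z) gcoalgebra_scheme"
    and M :: "('c \<Rightarrow> 'a, 'm, 'y) gmodule_scheme"
  assumes "cring A"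
    and "graded_coalgebra A \<Gamma>"
    and "projective_module A \<Gamma>"
    and "graded_left_module (dual_algebra A \<Gamma>) M"
  shows "rational A \<Gamma> M \<longleftrightarrow> distinguished_torsion A \<Gamma> M"
proof
  interpret \<Gamma>: graded_coalgebra A \<Gamma> by fact
  show "distinguished_torsion A \<Gamma> M" if "rational A \<Gamma> M"
    using assms(4) that by (rule \<Gamma>.rational_imp_distinguished_torsion)
  show "rational A \<Gamma> M" if "distinguished_torsion A \<Gamma> M"
  proof -
    obtain \<phi> :: "'c \<times> int \<Rightarrow> 'c \<Rightarrow> 'a" and e :: "'c \<times> int \<Rightarrow> 'c" where
      "\<And>j. \<phi> j \<in> grade (dual_algebra A \<Gamma>) (- snd j)"
      "\<And>j. e j \<in> grade \<Gamma> (snd j)"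
      "\<And>x. x \<in> carrier \<Gamma> \<Longrightarrow>
         \<forall>\<^sub>F J in finite_subsets_at_top UNIV. finsum \<Gamma> (\<lambda>j. \<phi> j x \<odot>\<^bsub>\<Gamma>\<^esub> e j) J = x"
      by (rule homogeneous_dual_basis[OF \<Gamma>.graded_module_axioms assms(3)]) blast
    then have "coalgebra_dual_basis A \<Gamma> \<phi> e snd"
      by (intro coalgebra_dual_basis.intro coalgebra_dual_basis_axioms.intro assms(2))
    then have "module_over_dual A \<Gamma> \<phi> e snd M"
      using assms(4) by (rule module_over_dual.intro)
    then show ?thesis
      using that by (rule module_over_dual.distinguished_torsion_imp_rational)
  qed
qed

end
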